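(* Let $\Gamma\subseteq\mathbb{N}^2$ be finite and such that the model monomial weight $\varphi_\Gamma$ is homogeneous, and let $\sigma,\tau\geq 0$ be the numbers associated to $\Gamma$. Then there is a constant $c>0$ depending on $\Gamma$ such that the weighted Kohn Laplacian $\Box_{\varphi_\Gamma}$ is $\mu$-coercive with $$\mu(z,w)=c\,(1+|z|^\sigma+|w|^\tau)\qquad (z,w)\in\mathbb{C}^2 .$$
   Context: $\mathbb{N}=\{0,1,2,\dots\}$; $(z,w)$ are the coordinates of $\mathbb{C}^2$ (also written $z_1=z$, $z_2=w$). Model monomial weights. For $\Gamma\subseteq\mathbb{N}^2$ finite, $\varphi_\Gamma(z,w):=\sum_{(\alpha,\beta)\in\Gamma}|z^\alpha w^\beta|^2$. It is called homogeneous if there are integers $m,n\geq 1$ such that $(m,0),(0,n)\in\Gamma$ and $n\alpha+m\beta=nm$ for every $(\alpha,\beta)\in\Gamma$. It is called decoupled if every $(\alpha,\beta)\in\Gamma$ has $\alpha=0$ or $\beta=0$. The numbers $\sigma,\tau$. If $\varphi_\Gamma$ is not decoupled, $\sigma$ and $\tau$ are the smallest non-negative real numbers such that $\frac1\sigma\leq\frac{\beta}{\alpha}\leq\tau$ for all $(\alpha,\beta)\in\Gamma$ with $\alpha\neq0$ and $\beta\neq 0$; that is, $\sigma=\max\alpha/\beta$ and $\tau=\max\beta/\alpha$ over such $(\alpha,\beta)$. If $\varphi_\Gamma$ is decoupled, $\sigma=\tau=0$. Weighted Kohn Laplacian. Let $\varphi:\mathbb{C}^2\to\mathbb{R}$ be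 a $C^2$ plurisubharmonic function. $L^2(\mathbb{C}^2,\varphi)$ is the Hilbert space of (classes of) measurable $f:\mathbb{C}^2\to\mathbb{C}$ with $\|f\|_\varphi^2=\int_{\mathbb{C}^2}|f|^2e^{-2\varphi}<\infty$ (Lebesgue measure), and $L^2_{(0,q)}(\mathbb{C}^2,\varphi)$ is the Hilbert space of $(0,q)$-forms with coefficients in $L^2(\mathbb{C}^2,\varphi)$, with squared norm $\|\cdot\|_\varphi^2$ the sum of the squared norms of the coefficients with respect to the basis $d\overline z_1,d\overline z_2$ (for $q=1$) or $d\overline z_1\wedge d\overline z_2$ (for $q=2$). The operator $\overline\partial:L^2(\mathbb{C}^2,\varphi)\to L^2_{(0,1)}(\mathbb{C}^2,\varphi)$, $\overline\partial f=\sum_j\frac{\partial f}{\partial\overline z_j}d\overline z_j$, has domain $\mathcal{D}_0(\overline\partial)$ consisting of the $f\in L^2(\mathbb{C}^2,\varphi)$ whose distributional derivatives $\frac{\partial f}{\partial\overline z_j}$ are all in $L^2(\mathbb{C}^2,\varphi)$. The operator $\overline\partial:L^2_{(0,1)}(\mathbb{C}^2,\varphi)\to L^2_{(0,2)}(\mathbb{C}^2,\varphi)$, $\overline\partial(u_1d\overline z_1+u_2d\overline z_2)=\left(\frac{\partial u_2}{\partial\overline z_1}-\frac{\partial u_1}{\partial\overline z_2}\right)d\overline z_1\wedge d\overline z_2$, has domain $\mathcal{D}_1(\overline\partial)$ consisting of the $u\in L^2_{(0,1)}(\mathbb{C}^2,\varphi)$ for which the (distributional) coefficient on the right is in $L^2(\mathbb{C}^2,\varphi)$.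 Both are closed and densely defined; their Hilbert space adjoints are denoted $\overline\partial^*_\varphi$, with domains $\mathcal{D}_1(\overline\partial^*_\varphi)\subseteq L^2_{(0,1)}(\mathbb{C}^2,\varphi)$ and $\mathcal{D}_2(\overline\partial^*_\varphi)\subseteq L^2_{(0,2)}(\mathbb{C}^2,\varphi)$ respectively. The weighted Kohn Laplacian is $\Box_\varphi:=\overline\partial^*_\varphi\overline\partial+\overline\partial\,\overline\partial^*_\varphi$ on the domain of those $u\in\mathcal{D}_1(\overline\partial)\cap\mathcal{D}_1(\overline\partial^*_\varphi)$ with $\overline\partial u\in\mathcal{D}_2(\overline\partial^*_\varphi)$ and $\overline\partial^*_\varphi u\in\mathcal{D}_0(\overline\partial)$; it is a self-adjoint non-negative operator on $L^2_{(0,1)}(\mathbb{C}^2,\varphi)$. Its quadratic form is $\mathcal{E}_\varphi(u):=\|\overline\partial u\|_\varphi^2+\|\overline\partial^*_\varphi u\|_\varphi^2$ for $u\in\mathcal{D}(\mathcal{E}_\varphi):=\mathcal{D}_1(\overline\partial)\cap\mathcal{D}_1(\overline\partial^*_\varphi)$. $\mu$-coercivity. For measurable $\mu:\mathbb{C}^2\to[0,+\infty)$, $\Box_\varphi$ is called $\mu$-coercive if $\mathcal{E}_\varphi(u)\geq\|\mu u\|_\varphi^2$ for every $u\in\mathcal{D}(\mathcal{E}_\varphi)$. *)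

theory Defs
  imports "HOL-Analysis.Analysis"
begin

section \<open>Model monomial weights\<close>

type_synonym c2 = "complex \<times> complex"

definition monomial_weight :: "(nat \<times> nat) set \<Rightarrow> c2 \<Rightarrow> real" where
  "monomial_weight \<Gamma> = (\<lambda>(z, w). \<Sum>(\<alpha>, \<beta>)\<in>\<Gamma>. (cmod (z ^ \<alpha> * w ^ \<beta>))\<^sup>2)"

definition homogeneous :: "(nat \<times> nat) set \<Rightarrow> bool" where
  "homogeneous \<Gamma> \<longleftrightarrow> (\<exists>m n. m \<ge> 1 \<and> n \<ge> 1 \<and> (m, 0) \<in> \<Gamma> \<and> (0, n) \<in> \<Gamma> \<and>
     (\<forall>(\<alpha>, \<beta>)\<in>\<Gamma>. n * \<alpha> + m * \<beta> = n * m))"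

definition decoupled :: "(nat \<times> nat) set \<Rightarrow> bool" where
  "decoupled \<Gamma> \<longleftrightarrow> (\<forall>(\<alpha>, \<beta>)\<in>\<Gamma>. \<alpha> = 0 \<or> \<beta> = 0)"

definition sigma_exponent :: "(nat \<times> nat) set \<Rightarrow> real" where
  "sigma_exponent \<Gamma> = (if decoupled \<Gamma> then 0
     else Max {real \<alpha> / real \<beta> | \<alpha> \<beta>. (\<alpha>, \<beta>) \<in> \<Gamma> \<and> \<alpha> \<noteq> 0 \<and> \<beta> \<noteq> 0})"

definition tau_exponent :: "(nat \<times> nat) set \<Rightarrow> real" where
  "tau_exponent \<Gamma> = (if decoupled \<Gamma> then 0
     else Max {real \<beta> / real \<alpha> | \<alpha> \<beta>. (\<alpha>, \<beta>) \<in> \<Gamma> \<and> \<alpha> \<noteq> 0 \<and> \<beta> \<noteq> 0})"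

(* Real powers of a nonnegative base with 0 to the power 0 equal to 1,
   whereas "0 powr 0 = 0". *)
definition rpow :: "real \<Rightarrow> real \<Rightarrow> real" where
  "rpow x s = (if s = 0 then 1 else x powr s)"


section \<open>Weighted \<open>L\<^sup>2\<close> spaces\<close>

(* Elements of the Hilbert spaces are represented by functions instead of classes modulo null
   sets. Every class of Lebesgue measurable functions has a Borel representative. *)

definition wnorm2 :: "(c2 \<Rightarrow> real) \<Rightarrow> (c2 \<Rightarrow> complex) \<Rightarrow> ennreal" where
  "wnorm2 \<phi> f = (\<integral>\<^sup>+ p. ennreal ((cmod (f p))\<^sup>2 * exp (- 2 * \<phi> p)) \<partial>lborel)"

definition winner :: "(c2 \<Rightarrow> real) \<Rightarrow> (c2 \<Rightarrow> complex) \<Rightarrow> (c2 \<Rightarrow> complex) \<Rightarrow> complex" where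
  "winner \<phi> f g = (\<integral>p. f p * cnj (g p) * of_real (exp (- 2 * \<phi> p)) \<partial>lborel)"

definition L2 :: "(c2 \<Rightarrow> real) \<Rightarrow> (c2 \<Rightarrow> complex) set" where
  "L2 \<phi> = {f \<in> borel_measurable lborel. wnorm2 \<phi> f < \<infinity>}"

(* The pair (u1, u2) stands for the form u1 dzbar1 + u2 dzbar2. A (0,2)-form is represented
   by its coefficient with respect to dzbar1 wedge dzbar2, hence by an element of L2. *)
type_synonym form01 = "(c2 \<Rightarrow> complex) \<times> (c2 \<Rightarrow> complex)"

definition L2_01 :: "(c2 \<Rightarrow> real) \<Rightarrow> form01 set" where
  "L2_01 \<phi> = L2 \<phi> \<times> L2 \<phi>"

definition wnorm2_01 :: "(c2 \<Rightarrow> real) \<Rightarrow> form01 \<Rightarrow> ennreal" where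
  "wnorm2_01 \<phi> u = wnorm2 \<phi> (fst u) + wnorm2 \<phi> (snd u)"

definition winner_01 :: "(c2 \<Rightarrow> real) \<Rightarrow> form01 \<Rightarrow> form01 \<Rightarrow> complex" where
  "winner_01 \<phi> u v = winner \<phi> (fst u) (fst v) + winner \<phi> (snd u) (snd v)"


section \<open>Distributional derivatives\<close>

primrec Ck :: "nat \<Rightarrow> (c2 \<Rightarrow> complex) \<Rightarrow> bool" where
  "Ck 0 f \<longleftrightarrow> continuous_on UNIV f"
| "Ck (Suc k) f \<longleftrightarrow> (\<forall>p. f differentiable (at p)) \<and>
     (\<forall>v. Ck k (\<lambda>p. frechet_derivative f (at p) v))"

definition test_function :: "(c2 \<Rightarrow> complex) \<Rightarrow> bool" where
  "test_function \<psi> \<longleftrightarrow> (\<forall>k. Ck k \<psi>) \<and> compact (closure {p. \<psi> p \<noteq> 0})"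

definition dzbar1 :: "(c2 \<Rightarrow> complex) \<Rightarrow> c2 \<Rightarrow> complex" where
  "dzbar1 \<psi> p =
     (frechet_derivative \<psi> (at p) (1, 0) + \<i> * frechet_derivative \<psi> (at p) (\<i>, 0)) / 2"

definition dzbar2 :: "(c2 \<Rightarrow> complex) \<Rightarrow> c2 \<Rightarrow> complex" where
  "dzbar2 \<psi> p =
     (frechet_derivative \<psi> (at p) (0, 1) + \<i> * frechet_derivative \<psi> (at p) (0, \<i>)) / 2"

(* The distributions df/dzbar1 and df/dzbar2 evaluated at a test function. *)

definition dist_dzbar1 :: "(c2 \<Rightarrow> complex) \<Rightarrow> (c2 \<Rightarrow> complex) \<Rightarrow> complex" where
  "dist_dzbar1 f \<psi> = - (\<integral>p. f p * dzbar1 \<psi> p \<partial>lborel)"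

definition dist_dzbar2 :: "(c2 \<Rightarrow> complex) \<Rightarrow> (c2 \<Rightarrow> complex) \<Rightarrow> complex" where
  "dist_dzbar2 f \<psi> = - (\<integral>p. f p * dzbar2 \<psi> p \<partial>lborel)"

definition represents :: "(c2 \<Rightarrow> complex) \<Rightarrow> ((c2 \<Rightarrow> complex) \<Rightarrow> complex) \<Rightarrow> bool" where
  "represents g T \<longleftrightarrow> (\<forall>\<psi>. test_function \<psi> \<longrightarrow> (\<integral>p. g p * \<psi> p \<partial>lborel) = T \<psi>)"


section \<open>The \<open>\<partial>\<close>-bar operators and the quadratic form of the Kohn Laplacian\<close>

(* The values of the operators below are determined up to null sets: by the fundamental lemma of
   the calculus of variations, and for the adjoint by density of dom_dbar0 in L2. The chosen
   representative therefore does not affect norms and inner products. *)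

definition is_dbar0 :: "(c2 \<Rightarrow> complex) \<Rightarrow> form01 \<Rightarrow> bool" where
  "is_dbar0 f g \<longleftrightarrow> represents (fst g) (dist_dzbar1 f) \<and> represents (snd g) (dist_dzbar2 f)"

definition dom_dbar0 :: "(c2 \<Rightarrow> real) \<Rightarrow> (c2 \<Rightarrow> complex) set" where
  "dom_dbar0 \<phi> = {f \<in> L2 \<phi>. \<exists>g \<in> L2_01 \<phi>. is_dbar0 f g}"

definition dbar0 :: "(c2 \<Rightarrow> real) \<Rightarrow> (c2 \<Rightarrow> complex) \<Rightarrow> form01" where
  "dbar0 \<phi> f = (SOME g. g \<in> L2_01 \<phi> \<and> is_dbar0 f g)"

definition is_dbar1 :: "form01 \<Rightarrow> (c2 \<Rightarrow> complex) \<Rightarrow> bool" where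
  "is_dbar1 u h \<longleftrightarrow> represents h (\<lambda>\<psi>. dist_dzbar1 (snd u) \<psi> - dist_dzbar2 (fst u) \<psi>)"

definition dom_dbar1 :: "(c2 \<Rightarrow> real) \<Rightarrow> form01 set" where
  "dom_dbar1 \<phi> = {u \<in> L2_01 \<phi>. \<exists>h \<in> L2 \<phi>. is_dbar1 u h}"

definition dbar1 :: "(c2 \<Rightarrow> real) \<Rightarrow> form01 \<Rightarrow> c2 \<Rightarrow> complex" where
  "dbar1 \<phi> u = (SOME h. h \<in> L2 \<phi> \<and> is_dbar1 u h)"

definition is_dbar_adj :: "(c2 \<Rightarrow> real) \<Rightarrow> form01 \<Rightarrow> (c2 \<Rightarrow> complex) \<Rightarrow> bool" where
  "is_dbar_adj \<phi> u v \<longleftrightarrow> (\<forall>f \<in> dom_dbar0 \<phi>. winner_01 \<phi> (dbar0 \<phi> f) u = winner \<phi> f v)"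

definition dom_dbar_adj :: "(c2 \<Rightarrow> real) \<Rightarrow> form01 set" where
  "dom_dbar_adj \<phi> = {u \<in> L2_01 \<phi>. \<exists>v \<in> L2 \<phi>. is_dbar_adj \<phi> u v}"

definition dbar_adj :: "(c2 \<Rightarrow> real) \<Rightarrow> form01 \<Rightarrow> c2 \<Rightarrow> complex" where
  "dbar_adj \<phi> u = (SOME v. v \<in> L2 \<phi> \<and> is_dbar_adj \<phi> u v)"

definition dom_kohn_form :: "(c2 \<Rightarrow> real) \<Rightarrow> form01 set" where
  "dom_kohn_form \<phi> = dom_dbar1 \<phi> \<inter> dom_dbar_adj \<phi>"

definition kohn_form :: "(c2 \<Rightarrow> real) \<Rightarrow> form01 \<Rightarrow> ennreal" where
  "kohn_form \<phi> u = wnorm2 \<phi> (dbar1 \<phi> u) + wnorm2 \<phi> (dbar_adj \<phi> u)"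

(* Coercivity of the Kohn Laplacian is a condition on its quadratic form only. The inequality is
   between extended reals, so it includes the finiteness of the norm of \<mu> u. *)
definition kohn_laplacian_coercive :: "(c2 \<Rightarrow> real) \<Rightarrow> (c2 \<Rightarrow> real) \<Rightarrow> bool" where
  "kohn_laplacian_coercive \<phi> \<mu> \<longleftrightarrow> (\<forall>u \<in> dom_kohn_form \<phi>. kohn_form \<phi> u \<ge>
     wnorm2_01 \<phi> (\<lambda>p. of_real (\<mu> p) * fst u p, \<lambda>p. of_real (\<mu> p) * snd u p))"

end

theory Submission
  imports Defs "HOL-Real_Asymp.Real_Asymp"
begin

text \<open>
The Kohn identity turns the quadratic form on smooth compactly supported forms into
\<open>\<Sum>\<^sub>j\<^sub>k \<parallel>\<partial>u\<^sub>j/\<partial>zbar\<^sub>k\<parallel>\<^sup>2 + 2 \<integral> H(u,u)\<close>, where \<open>H\<close> is the complex Hessian of the weight. By homogeneity, where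
\<open>\<bar>z\<bar>\<^sup>m \<ge> \<bar>w\<bar>\<^sup>n\<close> every \<open>z\<close>-derivative of a monomial is dominated by that of \<open>z\<^sup>m\<close> (and symmetrically), so \<open>H\<close> is bounded
below by its diagonal and the two components decouple. For \<open>u\<^sub>2\<close> (and symmetrically for \<open>u\<^sub>1\<close>) fix a mixed monomial
with \<open>\<sigma> = \<alpha>/\<beta>\<close> and put \<open>T = \<bar>z\<bar>\<^sup>2\<^sup>\<sigma>\<close>: integrating the \<open>wbar\<close>-derivative of \<open>h \<bar>u\<^sub>2\<bar>\<^sup>2 exp(-2\<phi>)\<close> with
\<open>h = T wbar / (1 + T \<bar>w\<bar>\<^sup>2)\<close> controls \<open>T\<close> where \<open>T \<bar>w\<bar>\<^sup>2 \<le> 1\<close>, and elsewhere the diagonal Hessian entry exceeds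
\<open>T\<close>. The term \<open>\<bar>w\<bar>\<^sup>2\<^sup>\<tau>\<close> is at most \<open>1\<close> plus the Hessian entry, as \<open>\<tau> \<le> n - 1\<close>. A general form is mollified and then
cut off at radius \<open>R\<close>; constants need not be sharp, so it suffices that the errors vanish, first in the
mollification parameter and then as \<open>R\<close> grows.
\<close>

text \<open>Positivity of the Hessian alone cannot give the growth of \<open>mu\<close>. The
  diagonal entry belonging to \<open>u2\<close> vanishes along w = 0 unless some monomial has
  \<open>\<beta> = 1\<close>, whereas in the coupled case \<open>mu\<close> must grow like
  \<open>|z|^sigma\<close> there. The missing bound has to come from the w-derivative of the form
  itself, which is what the multiplier \<open>h\<close> extracts; its two decisive properties are
  that its wbar-derivative is \<open>T / (1 + T * |w|^2)^2\<close> and that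
  \<open>|h|^2 \<le> T / 4\<close>, so the cross terms can be absorbed.

  The order of the two limits is forced. The weighted adjoint contains the unbounded, nonconstant
  coefficients \<open>2 * pd_phi\<close>, so it does not commute with mollification, and the
  discrepancy is small only on a fixed ball. Constants that depend on the radius therefore multiply
  only quantities that tend to 0 with the mollification parameter; whatever survives that limit
  carries a constant independent of the radius or a factor of size \<open>1 / R^2\<close>.\<close>

section \<open>Wirtinger calculus on \<open>\<complex>\<^sup>2\<close>\<close>

text \<open>Keeps the simplifier from turning quantifiers over points of \<open>\<complex>\<^sup>2\<close> into quantifiers over coordinates.\<close>

declare split_paired_All [simp del] split_paired_Ex [simp del]

abbreviation dd :: "(c2 \<Rightarrow> complex) \<Rightarrow> c2 \<Rightarrow> c2 \<Rightarrow> complex" where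
  "dd f v \<equiv> \<lambda>p. frechet_derivative f (at p) v"

lemma dd_eq: "(f has_derivative f') (at p) \<Longrightarrow> dd f v p = f' v"
  using frechet_derivative_at by fastforce

lemma differentiable_has_dd: "f differentiable (at p) \<Longrightarrow> (f has_derivative (\<lambda>v. dd f v p)) (at p)"
  using frechet_derivative_works by (metis eta_contract_eq)

lemma Ck_imp_differentiable: "Ck (Suc k) f \<Longrightarrow> f differentiable (at p)"
  by simp

lemma Ck_dd: "Ck (Suc k) f \<Longrightarrow> Ck k (dd f v)"
  by simp

lemma Ck_Suc_imp: "Ck (Suc k) f \<Longrightarrow> Ck k f"
proof (induction k arbitrary: f)
  case 0
  then show ?case
    by (auto intro!: differentiable_imp_continuous_on simp: differentiable_on_def)
next
  case (Suc k)
  then show ?case by (metis Ck.simps(2))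
qed

lemma Ck_imp_continuous: "Ck k f \<Longrightarrow> continuous_on UNIV f"
  by (induction k) (auto dest: Ck_Suc_imp simp del: Ck.simps(2))

lemma dd_add:
  assumes "f differentiable (at p)" "g differentiable (at p)"
  shows "dd (\<lambda>p. f p + g p) v p = dd f v p + dd g v p"
  using has_derivative_add[OF assms[THEN differentiable_has_dd]] by (rule dd_eq)

lemma dd_mult:
  assumes "f differentiable (at p)" "g differentiable (at p)"
  shows "dd (\<lambda>p. f p * g p) v p = dd f v p * g p + f p * dd g v p"
  using dd_eq[OF has_derivative_mult[OF assms[THEN differentiable_has_dd]], of v] by simp

lemma dd_compose_linear:
  assumes "f differentiable (at p)" "bounded_linear L"
  shows "dd (\<lambda>p. L (f p)) v p = L (dd f v p)"
  using bounded_linear.has_derivative[OF assms(2) differentiable_has_dd[OF assms(1)]] by (rule dd_eq)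

lemma Ck_const: "Ck k (\<lambda>_. c)"
  by (induction k arbitrary: c) auto

lemma Ck_add: "Ck k f \<Longrightarrow> Ck k g \<Longrightarrow> Ck k (\<lambda>p. f p + g p)"
proof (induction k arbitrary: f g)
  case (Suc k)
  then have "dd (\<lambda>p. f p + g p) v = (\<lambda>p. dd f v p + dd g v p)" for v
    by (intro ext dd_add) auto
  with Suc show ?case by (auto intro: differentiable_add)
qed (auto intro: continuous_intros)

lemma Ck_compose_linear:
  assumes "Ck k f" "bounded_linear L"
  shows "Ck k (\<lambda>p. L (f p))"
  using assms(1)
proof (induction k arbitrary: f)
  case 0
  then show ?case using assms(2) by (simp add: bounded_linear.continuous_on)
next
  case (Suc k)
  have "dd (\<lambda>p. L (f p)) v = (\<lambda>p. L (dd f v p))" for v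
    using Suc.prems assms(2) by (intro ext dd_compose_linear) auto
  moreover have "(\<lambda>p. L (f p)) differentiable (at p)" for p
  proof -
    have "f differentiable (at p)" using Suc.prems by simp
    from bounded_linear.has_derivative[OF assms(2) differentiable_has_dd[OF this]]
    show ?thesis by (rule differentiableI)
  qed
  ultimately show ?case using Suc by auto
qed

lemma Ck_mult: "Ck k f \<Longrightarrow> Ck k g \<Longrightarrow> Ck k (\<lambda>p. f p * g p)"
proof (induction k arbitrary: f g)
  case (Suc k)
  then have "dd (\<lambda>p. f p * g p) v = (\<lambda>p. dd f v p * g p + f p * dd g v p)" for v
    by (intro ext dd_mult) auto
  moreover have "Ck k f" "Ck k g" using Suc.prems by (auto dest!: Ck_Suc_imp simp del: Ck.simps)
  ultimately show ?case using Suc by (auto intro!: differentiable_mult Ck_add)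
qed (auto intro: continuous_intros)

lemma Ck_linear:
  assumes "bounded_linear L"
  shows "Ck k L"
proof (cases k)
  case 0
  then show ?thesis using assms by (simp add: linear_continuous_on)
next
  case (Suc j)
  have "dd L v = (\<lambda>_. L v)" for v
    using assms by (intro ext dd_eq) (rule bounded_linear_imp_has_derivative)
  then show ?thesis
    using assms Suc by (auto simp: Ck_const intro: bounded_linear_imp_differentiable)
qed

lemma Ck_cnj: "Ck k f \<Longrightarrow> Ck k (\<lambda>p. cnj (f p))"
  by (rule Ck_compose_linear[OF _ bounded_linear_cnj])

lemma Ck_cmult: "Ck k f \<Longrightarrow> Ck k (\<lambda>p. c * f p)"
  by (rule Ck_mult[OF Ck_const])

lemma Ck_uminus: "Ck k f \<Longrightarrow> Ck k (\<lambda>p. - f p)"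
  using Ck_cmult[of k f "-1"] by simp

lemma Ck_diff: "Ck k f \<Longrightarrow> Ck k g \<Longrightarrow> Ck k (\<lambda>p. f p - g p)"
  using Ck_add[OF _ Ck_uminus, of k f g] by simp

lemma Ck_sum: "(\<And>i. i \<in> I \<Longrightarrow> Ck k (f i)) \<Longrightarrow> Ck k (\<lambda>p. \<Sum>i\<in>I. f i p)"
  by (induction I rule: infinite_finite_induct) (auto intro: Ck_const Ck_add)

lemma Ck_power: "Ck k f \<Longrightarrow> Ck k (\<lambda>p. f p ^ n)"
  by (induction n) (auto intro: Ck_const Ck_mult)

lemma Ck_fst: "Ck k fst" and Ck_snd: "Ck k snd"
  by (rule Ck_linear; rule bounded_linear_fst bounded_linear_snd)+

lemmas Ck_intros = Ck_const Ck_add Ck_mult Ck_cnj Ck_uminus Ck_diff Ck_sum Ck_power Ck_fst Ck_snd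

definition imul :: "c2 \<Rightarrow> c2" where
  "imul v = (\<i> * fst v, \<i> * snd v)"

text \<open>For general \<open>v\<close> this is the sum over j of \<open>cnj v_j\<close> times the
  zbar_j-derivative, and \<open>pd\<close> the sum of \<open>v_j\<close> times the z_j-derivative. A
  direction parameter lets one lemma serve both coordinates, with \<open>(1,0)\<close> and
  \<open>(0,1)\<close> inserted at the end.\<close>

definition pdbar :: "c2 \<Rightarrow> (c2 \<Rightarrow> complex) \<Rightarrow> c2 \<Rightarrow> complex" where
  "pdbar v f p = (dd f v p + \<i> * dd f (imul v) p) / 2"

definition pd :: "c2 \<Rightarrow> (c2 \<Rightarrow> complex) \<Rightarrow> c2 \<Rightarrow> complex" where
  "pd v f p = (dd f v p - \<i> * dd f (imul v) p) / 2"

lemma dzbar1_eq: "dzbar1 f = pdbar (1, 0) f" and dzbar2_eq: "dzbar2 f = pdbar (0, 1) f"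
  by (auto simp: fun_eq_iff dzbar1_def dzbar2_def pdbar_def imul_def)

lemma Ck_pdbar: "Ck (Suc k) f \<Longrightarrow> Ck k (pdbar v f)"
  unfolding pdbar_def[abs_def] divide_inverse by (intro Ck_intros Ck_dd)

lemma Ck_pd: "Ck (Suc k) f \<Longrightarrow> Ck k (pd v f)"
  unfolding pd_def[abs_def] divide_inverse by (intro Ck_intros Ck_dd)

lemma
  shows pdbar_const: "pdbar v (\<lambda>_. c) p = 0"
    and pd_const: "pd v (\<lambda>_. c) p = 0"
  by (simp_all add: pdbar_def pd_def)

lemma
  assumes "f differentiable (at p)"
  shows pdbar_cnj: "pdbar v (\<lambda>p. cnj (f p)) p = cnj (pd v f p)"
    and pd_cnj: "pd v (\<lambda>p. cnj (f p)) p = cnj (pdbar v f p)"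
  using assms by (simp_all add: pdbar_def pd_def dd_compose_linear[OF _ bounded_linear_cnj])

context
  fixes f g :: "c2 \<Rightarrow> complex" and p :: c2
  assumes fg: "f differentiable (at p)" "g differentiable (at p)"
begin

lemma pdbar_add: "pdbar v (\<lambda>p. f p + g p) p = pdbar v f p + pdbar v g p"
  and pd_add: "pd v (\<lambda>p. f p + g p) p = pd v f p + pd v g p"
  using fg by (simp_all add: pdbar_def pd_def dd_add field_simps)

lemma pdbar_mult: "pdbar v (\<lambda>p. f p * g p) p = pdbar v f p * g p + f p * pdbar v g p"
  and pd_mult: "pd v (\<lambda>p. f p * g p) p = pd v f p * g p + f p * pd v g p"
  using fg by (simp_all add: pdbar_def pd_def dd_mult field_simps)

end

lemma pdbar_cmult: "f differentiable (at p) \<Longrightarrow> pdbar v (\<lambda>p. c * f p) p = c * pdbar v f p"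
  and pd_cmult: "f differentiable (at p) \<Longrightarrow> pd v (\<lambda>p. c * f p) p = c * pd v f p"
  by (simp_all add: pdbar_mult pdbar_const pd_mult pd_const)

lemma pdbar_sum:
  "(\<And>i. i \<in> I \<Longrightarrow> f i differentiable (at p)) \<Longrightarrow> pdbar v (\<lambda>p. \<Sum>i\<in>I. f i p) p = (\<Sum>i\<in>I. pdbar v (f i) p)"
  by (induction I rule: infinite_finite_induct) (auto simp: pdbar_add pdbar_const differentiable_sum)

lemma pdbar_uminus: "f differentiable (at p) \<Longrightarrow> pdbar v (\<lambda>p. - f p) p = - pdbar v f p"
  using pdbar_cmult[of f p v "-1"] by simp

lemma differentiable_power_fun:
  fixes f :: "c2 \<Rightarrow> complex"
  shows "f differentiable (at p) \<Longrightarrow> (\<lambda>p. f p ^ n) differentiable (at p)"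
  by (induction n) (auto intro: differentiable_mult)

lemma pd_power: "f differentiable (at p) \<Longrightarrow> pd v (\<lambda>p. f p ^ n) p = of_nat n * f p ^ (n - 1) * pd v f p"
  and pdbar_power: "f differentiable (at p) \<Longrightarrow> pdbar v (\<lambda>p. f p ^ n) p = of_nat n * f p ^ (n - 1) * pdbar v f p"
proof (induction n)
  case (Suc n)
  { case 1
    then show ?case using Suc.IH(1)
      by (cases n) (auto simp: pd_mult differentiable_power_fun pd_const algebra_simps) }
  { case 2
    then show ?case using Suc.IH(2)
      by (cases n) (auto simp: pdbar_mult differentiable_power_fun pdbar_const algebra_simps) }
qed (auto simp: pd_const pdbar_const)

lemma
  shows pd_fst: "pd v fst p = fst v" and pd_snd: "pd v snd p = snd v"
    and pdbar_fst: "pdbar v fst p = 0" and pdbar_snd: "pdbar v snd p = 0"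
  by (simp_all add: pd_def pdbar_def imul_def dd_eq[OF bounded_linear_imp_has_derivative[OF bounded_linear_fst]]
    dd_eq[OF bounded_linear_imp_has_derivative[OF bounded_linear_snd]])

section \<open>Symmetry of mixed second derivatives\<close>

lemma line_has_vector_derivative:
  assumes "\<And>q. f differentiable (at q)"
  shows "((\<lambda>x. f (q + x *\<^sub>R a)) has_vector_derivative dd f a (q + x *\<^sub>R a)) (at x)"
proof -
  have "((\<lambda>x. q + x *\<^sub>R a) has_derivative (\<lambda>x. x *\<^sub>R a)) (at x)"
    by (auto intro!: derivative_eq_intros)
  from diff_chain_at[OF this differentiable_has_dd[OF assms]]
  have "((\<lambda>x. f (q + x *\<^sub>R a)) has_derivative (\<lambda>y. dd f (y *\<^sub>R a) (q + x *\<^sub>R a))) (at x)"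
    by (simp add: o_def)
  moreover have "dd f (y *\<^sub>R a) (q + x *\<^sub>R a) = y *\<^sub>R dd f a (q + x *\<^sub>R a)" for y
    using linear_frechet_derivative[OF assms] by (rule linear_scale)
  ultimately show ?thesis by (simp add: has_vector_derivative_def)
qed

lemma vector_derivative_bound:
  fixes g :: "real \<Rightarrow> complex"
  assumes "0 \<le> s" and g: "\<And>x. 0 \<le> x \<Longrightarrow> x \<le> s \<Longrightarrow> (g has_vector_derivative g' x) (at x)"
    and B: "\<And>x. 0 \<le> x \<Longrightarrow> x \<le> s \<Longrightarrow> norm (g' x) \<le> B"
  shows "norm (g s - g 0) \<le> s * B"
proof (cases "s = 0")
  case False
  have "continuous_on {0..s} g"
    using g by (intro continuous_at_imp_continuous_on ballI has_vector_derivative_continuous[of g]) auto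
  from mvt_general[OF _ this, of "\<lambda>x y. y *\<^sub>R g' x"] obtain x where "x \<in> {0<..<s}" "norm (g s - g 0) \<le> norm (s *\<^sub>R g' x)"
    using False assms(1) g by (auto simp: has_vector_derivative_def)
  then show ?thesis using B[of x] by (auto elim!: order_trans intro: mult_left_mono)
qed auto

text \<open>The mean value inequality is applied twice, first along \<open>a\<close> and then along
  \<open>b\<close>, with the expected linear term already subtracted so that only the oscillation of
  the second derivative near \<open>p\<close> remains. The second difference is symmetric in its two
  increments, which is the point of approximating it.\<close>

lemma second_difference_approx:
  assumes f: "Ck (Suc (Suc 0)) f" and "\<epsilon> > 0"
  shows "\<exists>\<delta>>0. \<forall>s t. 0 < s \<longrightarrow> s < \<delta> \<longrightarrow> 0 < t \<longrightarrow> t < \<delta> \<longrightarrow>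
    norm (f (p + s *\<^sub>R a + t *\<^sub>R b) - f (p + s *\<^sub>R a) - f (p + t *\<^sub>R b) + f p - (s * t) *\<^sub>R dd (dd f a) b p) \<le> s * t * \<epsilon>"
proof -
  let ?c = "dd (dd f a) b p"
  have "continuous_on UNIV (dd (dd f a) b)" using f by simp
  then have "isCont (dd (dd f a) b) p"
    by (simp add: continuous_on_eq_continuous_at)
  then obtain d where d: "d > 0" "\<And>q. norm (q - p) < d \<Longrightarrow> norm (dd (dd f a) b q - ?c) < \<epsilon>"
    using \<open>\<epsilon> > 0\<close> unfolding continuous_at_eps_delta dist_norm by blast
  \<comment> \<open>Keeps the whole parallelogram with sides up to \<open>\<delta>\<close> along
    \<open>a\<close> and \<open>b\<close> in the ball of radius \<open>d\<close>; the summand 1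
    covers \<open>a = b = 0\<close>.\<close>
  define \<delta> where "\<delta> = d / (norm a + norm b + 1)"
  have \<delta>: "\<delta> > 0" using d(1) by (simp add: \<delta>_def add_nonneg_pos)
  have small: "norm (x *\<^sub>R a + y *\<^sub>R b) < d" if "0 \<le> x" "x < \<delta>" "0 \<le> y" "y < \<delta>" for x y
  proof -
    have "norm (x *\<^sub>R a + y *\<^sub>R b) \<le> x * norm a + y * norm b"
      using that by (metis abs_of_nonneg norm_scaleR norm_triangle_ineq)
    also have "\<dots> \<le> \<delta> * norm a + \<delta> * norm b"
      using that by (intro add_mono mult_right_mono) auto
    also have "\<dots> < \<delta> * (norm a + norm b + 1)" using \<delta> by (simp add: algebra_simps)
    also have "\<dots> = d"
      unfolding \<delta>_def by (simp add: add_nonneg_pos less_imp_neq[THEN not_sym])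
    finally show ?thesis .
  qed
  show ?thesis
  proof (intro exI[of _ \<delta>] conjI \<delta> allI impI)
    fix s t :: real
    assume st: "0 < s" "s < \<delta>" "0 < t" "t < \<delta>"
    \<comment> \<open>The increment of \<open>\<phi>\<close> from 0 to \<open>s\<close> is the
      second difference minus its approximation; its derivative \<open>\<phi>'\<close> is again an
      increment, now along \<open>b\<close>, of the auxiliary \<open>\<psi>\<close> below.\<close>
    define \<phi> where "\<phi> x = f (p + t *\<^sub>R b + x *\<^sub>R a) - f (p + x *\<^sub>R a) - x *\<^sub>R (t *\<^sub>R ?c)" for x
    define \<phi>' where "\<phi>' x = dd f a (p + t *\<^sub>R b + x *\<^sub>R a) - dd f a (p + x *\<^sub>R a) - t *\<^sub>R ?c" for x
    have f1: "f differentiable (at q)" "dd f a differentiable (at q)" for q using f by auto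
    have "norm (\<phi> s - \<phi> 0) \<le> s * (t * \<epsilon>)"
    proof (rule vector_derivative_bound[where g' = \<phi>'])
      show "(\<phi> has_vector_derivative \<phi>' x) (at x)" for x
        unfolding \<phi>_def[abs_def] \<phi>'_def
        by (intro has_vector_derivative_diff line_has_vector_derivative f1)
          (auto intro!: derivative_eq_intros)
      show "norm (\<phi>' x) \<le> t * \<epsilon>" if x: "0 \<le> x" "x \<le> s" for x
      proof -
        define \<psi> where "\<psi> y = dd f a (p + x *\<^sub>R a + y *\<^sub>R b) - y *\<^sub>R ?c" for y
        have "norm (\<psi> t - \<psi> 0) \<le> t * \<epsilon>"
        proof (rule vector_derivative_bound[where g' = "\<lambda>y. dd (dd f a) b (p + x *\<^sub>R a + y *\<^sub>R b) - ?c"])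
          show "(\<psi> has_vector_derivative dd (dd f a) b (p + x *\<^sub>R a + y *\<^sub>R b) - ?c) (at y)" for y
            unfolding \<psi>_def[abs_def]
            by (intro has_vector_derivative_diff line_has_vector_derivative f1)
              (auto intro!: derivative_eq_intros)
          show "norm (dd (dd f a) b (p + x *\<^sub>R a + y *\<^sub>R b) - ?c) \<le> \<epsilon>" if "0 \<le> y" "y \<le> t" for y
            using d(2)[of "p + x *\<^sub>R a + y *\<^sub>R b"] small[of x y] that x st by (auto simp: add.assoc)
        qed (use st in auto)
        also have "\<psi> t - \<psi> 0 = \<phi>' x" by (simp add: \<psi>_def \<phi>'_def algebra_simps)
        finally show ?thesis .
      qed
    qed (use st in auto)
    also have "\<phi> s - \<phi> 0 = f (p + s *\<^sub>R a + t *\<^sub>R b) - f (p + s *\<^sub>R a) - f (p + t *\<^sub>R b) + f p - (s * t) *\<^sub>R ?c"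
      by (simp add: \<phi>_def algebra_simps)
    finally show "norm (f (p + s *\<^sub>R a + t *\<^sub>R b) - f (p + s *\<^sub>R a) - f (p + t *\<^sub>R b) + f p - (s * t) *\<^sub>R ?c) \<le> s * t * \<epsilon>"
      by (simp add: mult.assoc)
  qed
qed

text \<open>Both orders of differentiation approximate one and the same second difference with equal
  increments, so they differ by at most every positive \<open>\<epsilon>\<close>.\<close>

lemma dd_commute:
  assumes f: "Ck (Suc (Suc 0)) f"
  shows "dd (dd f a) b p = dd (dd f b) a p"
proof -
  let ?x = "dd (dd f a) b p" and ?y = "dd (dd f b) a p"
  have "norm (?x - ?y) \<le> 0 + \<epsilon>" if "\<epsilon> > 0" for \<epsilon>
  proof -
    have "\<epsilon> / 2 > 0" using that by simp
    from second_difference_approx[OF f this, of p a b] second_difference_approx[OF f this, of p b a]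
    obtain d1 d2 where d: "d1 > 0" "d2 > 0"
      and *: "\<And>s t. 0 < s \<Longrightarrow> s < d1 \<Longrightarrow> 0 < t \<Longrightarrow> t < d1 \<Longrightarrow>
        norm (f (p + s *\<^sub>R a + t *\<^sub>R b) - f (p + s *\<^sub>R a) - f (p + t *\<^sub>R b) + f p - (s * t) *\<^sub>R ?x) \<le> s * t * (\<epsilon> / 2)"
        "\<And>s t. 0 < s \<Longrightarrow> s < d2 \<Longrightarrow> 0 < t \<Longrightarrow> t < d2 \<Longrightarrow>
        norm (f (p + s *\<^sub>R b + t *\<^sub>R a) - f (p + s *\<^sub>R b) - f (p + t *\<^sub>R a) + f p - (s * t) *\<^sub>R ?y) \<le> s * t * (\<epsilon> / 2)"
      by blast
    define s where "s = min d1 d2 / 2"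
    have s: "0 < s" "s < d1" "s < d2" using d by (auto simp: s_def)
    let ?A = "f (p + s *\<^sub>R a + s *\<^sub>R b) - f (p + s *\<^sub>R a) - f (p + s *\<^sub>R b) + f p"
    have "norm (?A - (s * s) *\<^sub>R ?x) \<le> s * s * (\<epsilon> / 2)" using *(1)[of s s] s by auto
    moreover have "norm (?A - (s * s) *\<^sub>R ?y) \<le> s * s * (\<epsilon> / 2)" using *(2)[of s s] s by (auto simp: algebra_simps)
    ultimately have "norm ((?A - (s * s) *\<^sub>R ?y) - (?A - (s * s) *\<^sub>R ?x)) \<le> s * s * (\<epsilon> / 2) + s * s * (\<epsilon> / 2)"
      by (blast intro: order_trans[OF norm_triangle_ineq4 add_mono])
    then have "norm ((s * s) *\<^sub>R ?x - (s * s) *\<^sub>R ?y) \<le> s * s * (\<epsilon> / 2) + s * s * (\<epsilon> / 2)"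
      by (simp only: diff_diff_eq2 diff_add_eq diff_diff_eq) (simp add: algebra_simps)
    also have "(s * s) *\<^sub>R ?x - (s * s) *\<^sub>R ?y = (s * s) *\<^sub>R (?x - ?y)" by (simp add: algebra_simps)
    finally have "(s * s) * norm (?x - ?y) \<le> (s * s) * \<epsilon>" by (simp add: mult.commute)
    then show ?thesis using s by simp
  qed
  then have "norm (?x - ?y) \<le> 0" by (rule field_le_epsilon)
  then show ?thesis by simp
qed

lemma pdbar_pd_commute:
  assumes f: "Ck (Suc (Suc 0)) f"
  shows "pdbar v (pd v' f) p = pd v' (pdbar v f) p"
proof -
  have d: "dd f a differentiable (at p)" for a using f by simp
  have 1: "pdbar v (pd v' f) p = inverse 2 * (pdbar v (dd f v') p - \<i> * pdbar v (dd f (imul v')) p)"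
  proof -
    have "pd v' f = (\<lambda>p. inverse 2 * (dd f v' p + (- \<i>) * dd f (imul v') p))"
      by (auto simp: pd_def)
    then show ?thesis
      by (simp only:) (subst pdbar_cmult pdbar_add | intro differentiable_add differentiable_mult d differentiable_const | simp)+
  qed
  have 2: "pd v' (pdbar v f) p = inverse 2 * (pd v' (dd f v) p + \<i> * pd v' (dd f (imul v)) p)"
  proof -
    have "pdbar v f = (\<lambda>p. inverse 2 * (dd f v p + \<i> * dd f (imul v) p))"
      by (auto simp: pdbar_def)
    then show ?thesis
      by (simp only:) (subst pd_cmult pd_add | intro differentiable_add differentiable_mult d differentiable_const | simp)+
  qed
  have c: "dd (dd f a) b p = dd (dd f b) a p" for a b by (rule dd_commute[OF f])
  show ?thesis unfolding 1 2 by (simp add: pd_def pdbar_def c[of v'] c[of "imul v'"] field_simps)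
qed

section \<open>Compact support and integration by parts\<close>

text \<open>Vanishing off a ball replaces compactness of the closed support: it passes to sums,
  products and derivatives without topology, and \<open>test_functionI\<close> and
  \<open>test_function_csupp\<close> translate between the two.\<close>

definition csupp :: "(c2 \<Rightarrow> complex) \<Rightarrow> bool" where
  "csupp f \<longleftrightarrow> (\<exists>R. \<forall>p. R < norm p \<longrightarrow> f p = 0)"

lemma integral_translate:
  fixes f :: "c2 \<Rightarrow> complex"
  assumes "f \<in> borel_measurable borel"
  shows "(\<integral>p. f (c + p) \<partial>lborel) = (\<integral>p. f p \<partial>lborel)"
proof -
  have "(\<integral>p. f p \<partial>lborel) = (\<integral>p. f p \<partial>distr lborel borel ((+) c))"
    by (simp add: lborel_distr_plus)
  also have "\<dots> = (\<integral>p. f (c + p) \<partial>lborel)"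
    using assms by (intro integral_distr) auto
  finally show ?thesis by simp
qed

lemma integrable_csupp:
  assumes "continuous_on UNIV f" "csupp f"
  shows "integrable lborel f"
proof -
  obtain R where R: "\<And>p. R < norm p \<Longrightarrow> f p = 0" using assms(2) unfolding csupp_def by blast
  have "integrable lborel (\<lambda>p. indicator (cball 0 R) p *\<^sub>R f p)"
    by (rule borel_integrable_compact) (use assms(1) continuous_on_subset in auto)
  also have "(\<lambda>p. indicator (cball 0 R) p *\<^sub>R f p) = f"
    by (auto simp: fun_eq_iff indicator_def) (meson R not_le)
  finally show ?thesis .
qed

lemma integrable_csupp_real:
  fixes f :: "c2 \<Rightarrow> real"
  assumes "continuous_on UNIV f" "csupp (\<lambda>p. complex_of_real (f p))"
  shows "integrable lborel f"
proof -
  have "integrable lborel (\<lambda>p. complex_of_real (f p))"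
    using assms by (intro integrable_csupp) (auto intro!: continuous_intros)
  then show ?thesis using complex_of_real_integrable_eq by blast
qed

lemma csupp_bounded:
  assumes "continuous_on UNIV f" "csupp f"
  shows "\<exists>B\<ge>0. \<forall>p. norm (f p) \<le> B"
proof -
  obtain R where R: "\<And>p. R < norm p \<Longrightarrow> f p = 0" using assms(2) unfolding csupp_def by blast
  have "compact (f ` cball 0 R)"
    by (intro compact_continuous_image) (use assms(1) continuous_on_subset in auto)
  then have "bounded (f ` cball 0 R)" by (rule compact_imp_bounded)
  then obtain B where B: "B > 0" "\<And>p. p \<in> cball 0 R \<Longrightarrow> norm (f p) \<le> B" by (auto simp: bounded_pos)
  show ?thesis
  proof (intro exI[of _ B] conjI allI)
    show "norm (f p) \<le> B" for p
      using B R[of p] by (cases "norm p \<le> R") auto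
  qed (use B in auto)
qed

text \<open>The complement of a closed ball is open, so \<open>G\<close> vanishes on a neighbourhood
  of each such point in the line through it, and uniqueness of the derivative gives 0.\<close>

lemma line_derivative_csupp:
  assumes "\<And>p x. ((\<lambda>s. G (p + s *\<^sub>R v)) has_vector_derivative G' (p + x *\<^sub>R v)) (at x)" "csupp G"
  shows "csupp G'"
proof -
  obtain R where R: "\<And>p. R < norm p \<Longrightarrow> G p = 0" using assms(2) unfolding csupp_def by blast
  have "G' p = 0" if "R < norm p" for p
  proof -
    have "isCont (\<lambda>s. norm (p + s *\<^sub>R v)) (0::real)" by (intro continuous_intros)
    then have "((\<lambda>s. norm (p + s *\<^sub>R v)) \<longlongrightarrow> norm p) (at (0::real))" by (simp add: isCont_def)
    then have "\<forall>\<^sub>F s in at (0::real). R < norm (p + s *\<^sub>R v)"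
      by (rule order_tendstoD(1)) (rule that)
    then have ev: "\<forall>\<^sub>F s in at (0::real). G (p + s *\<^sub>R v) = 0"
      by eventually_elim (rule R)
    have "((\<lambda>s. 0) has_vector_derivative G' p) (at 0)"
    proof (rule has_vector_derivative_transform_within_open[where f = "\<lambda>s. G (p + s *\<^sub>R v)" and S = "{s. R < norm (p + s *\<^sub>R v)}"])
      show "((\<lambda>s. G (p + s *\<^sub>R v)) has_vector_derivative G' p) (at 0)"
        using assms(1)[of p 0] by simp
      show "open {s. R < norm (p + s *\<^sub>R v)}"
        by (intro open_Collect_less continuous_intros)
    qed (use R that in auto)
    then show ?thesis
      using has_vector_derivative_const vector_derivative_unique_at by blast
  qed
  then show ?thesis unfolding csupp_def by blast
qed

text \<open>
  Differentiability is required only along the line: the multiplier of the uncertainty principle contains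
  \<open>\<bar>z\<bar>\<close> to a possibly small power, which need not be differentiable in \<open>z\<close>.
\<close>

lemma integral_line_derivative:
  assumes G: "continuous_on UNIV G" "csupp G" and G': "continuous_on UNIV G'"
    and der: "\<And>p x. ((\<lambda>s. G (p + s *\<^sub>R v)) has_vector_derivative G' (p + x *\<^sub>R v)) (at x)"
  shows "(\<integral>p. G' p \<partial>lborel) = 0"
proof -
  obtain R where R: "\<And>p. R < norm p \<Longrightarrow> G p = 0" using G(2) unfolding csupp_def by blast
  obtain B where B: "B \<ge> 0" "\<And>p. norm (G' p) \<le> B"
    using csupp_bounded[OF G' line_derivative_csupp[OF der G(2)]] by blast
  \<comment> \<open>The difference quotients \<open>D n\<close> with step \<open>s n\<close> have
    integral 0 by translation invariance and converge to \<open>G'\<close>. Steps at most 1 keep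
    their supports in the ball enlarged by \<open>norm v\<close>, where \<open>B\<close> dominates
    them.\<close>
  define s :: "nat \<Rightarrow> real" where "s n = 1 / real (Suc n)" for n
  have s: "0 < s n" "s n \<le> 1" for n by (auto simp: s_def)
  define D where "D n p = (G (p + s n *\<^sub>R v) - G p) /\<^sub>R s n" for n p
  have [measurable]: "G \<in> borel_measurable borel" "G' \<in> borel_measurable borel"
    using G G' by (auto intro: borel_measurable_continuous_onI)
  have intG: "integrable lborel G" by (rule integrable_csupp[OF G])
  have "continuous_on UNIV (\<lambda>p::c2. G (p + s n *\<^sub>R v))" for n
    by (intro continuous_on_compose2[OF G(1)] continuous_intros) auto
  moreover have "csupp (\<lambda>p. G (p + s n *\<^sub>R v))" for n
    unfolding csupp_def
  proof (intro exI[of _ "R + norm v"] allI impI)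
    fix p :: c2 assume "R + norm v < norm p"
    moreover have "norm (s n *\<^sub>R v) \<le> norm v" using s[of n] by (simp add: mult_left_le_one_le)
    ultimately have "R < norm (p + s n *\<^sub>R v)" using norm_diff_ineq[of p "s n *\<^sub>R v"] by linarith
    then show "G (p + s n *\<^sub>R v) = 0" by (rule R)
  qed
  ultimately have intGs: "integrable lborel (\<lambda>p. G (p + s n *\<^sub>R v))" for n
    by (rule integrable_csupp)
  have D0: "(\<integral>p. D n p \<partial>lborel) = 0" for n
    using intG intGs[of n] integral_translate[of G "s n *\<^sub>R v"]
    by (simp add: D_def add.commute)
  have "(\<lambda>n. \<integral>p. D n p \<partial>lborel) \<longlonglongrightarrow> (\<integral>p. G' p \<partial>lborel)"
  proof (rule integral_dominated_convergence)
    show "integrable lborel (\<lambda>p::c2. indicator (cball 0 (R + norm v)) p *\<^sub>R B)"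
      by (rule borel_integrable_compact) auto
    show "AE p in lborel. (\<lambda>n. D n p) \<longlonglongrightarrow> G' p"
    proof (rule AE_I2)
      fix p :: c2
      have "((\<lambda>y. (G (p + y *\<^sub>R v) - G p) /\<^sub>R y) \<longlongrightarrow> G' p) (at 0)"
      proof (rule Lim_null[THEN iffD2], rule tendsto_norm_zero_cancel)
        have "((\<lambda>y. norm (G (p + y *\<^sub>R v) - G p - y *\<^sub>R G' p) / norm y) \<longlongrightarrow> 0) (at 0)"
          using der[of p 0] by (simp add: has_vector_derivative_def has_derivative_iff_norm)
        then show "((\<lambda>y. norm ((G (p + y *\<^sub>R v) - G p) /\<^sub>R y - G' p)) \<longlongrightarrow> 0) (at 0)"
        proof (rule Lim_transform_eventually)
          have "norm (G (p + y *\<^sub>R v) - G p - y *\<^sub>R G' p) / norm y = norm ((G (p + y *\<^sub>R v) - G p) /\<^sub>R y - G' p)"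
            if "y \<noteq> 0" for y
          proof -
            have "(G (p + y *\<^sub>R v) - G p) /\<^sub>R y - G' p = (G (p + y *\<^sub>R v) - G p - y *\<^sub>R G' p) /\<^sub>R y"
              using that by (simp add: scaleR_diff_right)
            then show ?thesis by (simp add: norm_mult divide_inverse mult.commute)
          qed
          then show "\<forall>\<^sub>F y in at 0. norm (G (p + y *\<^sub>R v) - G p - y *\<^sub>R G' p) / norm y =
              norm ((G (p + y *\<^sub>R v) - G p) /\<^sub>R y - G' p)"
            by (auto simp: eventually_at_filter)
        qed
      qed
      moreover have "filterlim s (at 0) sequentially"
        unfolding filterlim_at s_def using LIMSEQ_inverse_real_of_nat
        by (auto simp: inverse_eq_divide intro!: always_eventually)
      ultimately show "(\<lambda>n. D n p) \<longlonglongrightarrow> G' p"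
        unfolding D_def by (rule filterlim_compose)
    qed
    show "AE p in lborel. norm (D n p) \<le> indicator (cball 0 (R + norm v)) p *\<^sub>R B" for n
    proof (rule AE_I2)
      fix p :: c2
      show "norm (D n p) \<le> indicator (cball 0 (R + norm v)) p *\<^sub>R B"
      proof (cases "p \<in> cball 0 (R + norm v)")
        case True
        have "norm (G (p + s n *\<^sub>R v) - G (p + 0 *\<^sub>R v)) \<le> s n * B"
          by (rule vector_derivative_bound[OF _ der]) (use s[of n] B in auto)
        then have "norm (G (p + s n *\<^sub>R v) - G p) \<le> s n * B" by simp
        then show ?thesis using True s[of n] by (simp add: D_def norm_mult divide_simps mult.commute)
      next
        case False
        moreover have "norm (s n *\<^sub>R v) \<le> norm v" using s[of n] by (simp add: mult_left_le_one_le)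
        ultimately have "R < norm (p + s n *\<^sub>R v)" "R < norm p"
          using norm_ge_zero[of v] norm_diff_ineq[of p "s n *\<^sub>R v"] by (simp_all add: not_le del: norm_ge_zero)
        then show ?thesis using R B(1) by (simp add: D_def)
      qed
    qed
    show "(\<lambda>p. D n p) \<in> borel_measurable lborel" for n unfolding D_def by measurable
  qed (auto simp: G'[THEN borel_measurable_continuous_onI])
  then show ?thesis by (simp add: D0 LIMSEQ_const_iff)
qed

lemma csupp_mult_left: "csupp f \<Longrightarrow> csupp (\<lambda>p. f p * g p)"
  and csupp_mult_right: "csupp f \<Longrightarrow> csupp (\<lambda>p. g p * f p)"
  and csupp_cnj: "csupp f \<Longrightarrow> csupp (\<lambda>p. cnj (f p))"
  and csupp_uminus: "csupp f \<Longrightarrow> csupp (\<lambda>p. - f p)"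
  by (auto simp: csupp_def)

lemma csupp_add: "csupp f \<Longrightarrow> csupp g \<Longrightarrow> csupp (\<lambda>p. f p + g p)"
proof -
  assume "csupp f" "csupp g"
  then obtain R S where "\<forall>p. R < norm p \<longrightarrow> f p = 0" "\<forall>p. S < norm p \<longrightarrow> g p = 0"
    unfolding csupp_def by blast
  then show ?thesis unfolding csupp_def by (intro exI[of _ "max R S"]) auto
qed

lemma csupp_diff: "csupp f \<Longrightarrow> csupp g \<Longrightarrow> csupp (\<lambda>p. f p - g p)"
  using csupp_add[OF _ csupp_uminus, of f g] by simp

lemma csupp_dd: "Ck (Suc 0) f \<Longrightarrow> csupp f \<Longrightarrow> csupp (dd f v)"
  by (rule line_derivative_csupp[OF line_has_vector_derivative]) auto

lemma csupp_pdbar: "Ck (Suc 0) f \<Longrightarrow> csupp f \<Longrightarrow> csupp (pdbar v f)"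
  unfolding pdbar_def[abs_def] divide_inverse by (intro csupp_mult_left csupp_add csupp_mult_right csupp_dd)

lemma csupp_pd: "Ck (Suc 0) f \<Longrightarrow> csupp f \<Longrightarrow> csupp (pd v f)"
  unfolding pd_def[abs_def] divide_inverse by (intro csupp_mult_left csupp_diff csupp_mult_right csupp_dd)

lemma integral_dd: "Ck (Suc 0) f \<Longrightarrow> csupp f \<Longrightarrow> (\<integral>p. dd f v p \<partial>lborel) = 0"
  by (rule integral_line_derivative[OF _ _ _ line_has_vector_derivative])
    (auto dest: Ck_imp_continuous[of "Suc 0"] simp del: Ck.simps(2) intro: Ck_imp_differentiable Ck_imp_continuous Ck_dd)

lemma integral_pdbar:
  assumes "Ck (Suc 0) f" "csupp f"
  shows "(\<integral>p. pdbar v f p \<partial>lborel) = 0"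
proof -
  have "integrable lborel (dd f v)" for v
    using assms by (intro integrable_csupp csupp_dd) auto
  then show ?thesis using integral_dd[OF assms] by (simp add: pdbar_def)
qed

section \<open>The Kohn identity\<close>

definition mono_fun :: "nat \<times> nat \<Rightarrow> c2 \<Rightarrow> complex" where
  "mono_fun \<gamma> p = fst p ^ fst \<gamma> * snd p ^ snd \<gamma>"

definition wexp :: "(nat \<times> nat) set \<Rightarrow> c2 \<Rightarrow> real" where
  "wexp \<Gamma> p = exp (- 2 * monomial_weight \<Gamma> p)"

definition cwexp :: "(nat \<times> nat) set \<Rightarrow> c2 \<Rightarrow> complex" where
  "cwexp \<Gamma> p = complex_of_real (wexp \<Gamma> p)"

text \<open>
  Below, \<open>pd_phi\<close>, \<open>hess\<close> and \<open>hess_diag\<close> are the first derivative, the entries and the diagonal entries of the complex Hessian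
  of the weight, written through the holomorphic monomials, and \<open>pdbar_adj\<close> is the formal adjoint of \<open>pdbar\<close> with respect
  to \<open>exp(-2\<phi>)\<close>.
\<close>

definition pd_phi :: "(nat \<times> nat) set \<Rightarrow> c2 \<Rightarrow> c2 \<Rightarrow> complex" where
  "pd_phi \<Gamma> v p = (\<Sum>\<gamma>\<in>\<Gamma>. pd v (mono_fun \<gamma>) p * cnj (mono_fun \<gamma> p))"

definition hess :: "(nat \<times> nat) set \<Rightarrow> c2 \<Rightarrow> c2 \<Rightarrow> c2 \<Rightarrow> complex" where
  "hess \<Gamma> v v' p = (\<Sum>\<gamma>\<in>\<Gamma>. pd v (mono_fun \<gamma>) p * cnj (pd v' (mono_fun \<gamma>) p))"

definition hess_diag :: "(nat \<times> nat) set \<Rightarrow> c2 \<Rightarrow> c2 \<Rightarrow> real" where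
  "hess_diag \<Gamma> v p = (\<Sum>\<gamma>\<in>\<Gamma>. (cmod (pd v (mono_fun \<gamma>) p))\<^sup>2)"

definition pdbar_adj :: "(nat \<times> nat) set \<Rightarrow> c2 \<Rightarrow> (c2 \<Rightarrow> complex) \<Rightarrow> c2 \<Rightarrow> complex" where
  "pdbar_adj \<Gamma> v f p = - pd v f p + 2 * pd_phi \<Gamma> v p * f p"

lemma Ck_mono_fun: "Ck k (mono_fun \<gamma>)"
  unfolding mono_fun_def[abs_def] by (intro Ck_intros)

lemma mono_fun_differentiable: "mono_fun \<gamma> differentiable (at p)"
  by (rule Ck_imp_differentiable[OF Ck_mono_fun])

lemma pdbar_mono_fun: "pdbar v (mono_fun \<gamma>) p = 0"
proof -
  have d: "(\<lambda>p::c2. fst p ^ n) differentiable (at p)" "(\<lambda>p::c2. snd p ^ n) differentiable (at p)" for n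
    using Ck_imp_differentiable[OF Ck_power[OF Ck_fst]] Ck_imp_differentiable[OF Ck_power[OF Ck_snd]] by auto
  have d1: "fst differentiable (at p)" "snd differentiable (at p)"
    using Ck_imp_differentiable[OF Ck_fst] Ck_imp_differentiable[OF Ck_snd] by auto
  show ?thesis
    unfolding mono_fun_def[abs_def] by (simp add: pdbar_mult d pdbar_power d1 pdbar_fst pdbar_snd)
qed

lemma pd_mono_fun:
  "pd v (mono_fun (\<alpha>, \<beta>)) p = of_nat \<alpha> * fst p ^ (\<alpha> - 1) * snd p ^ \<beta> * fst v + of_nat \<beta> * fst p ^ \<alpha> * snd p ^ (\<beta> - 1) * snd v"
proof -
  have d: "(\<lambda>p::c2. fst p ^ n) differentiable (at p)" "(\<lambda>p::c2. snd p ^ n) differentiable (at p)" for n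
    using Ck_imp_differentiable[OF Ck_power[OF Ck_fst]] Ck_imp_differentiable[OF Ck_power[OF Ck_snd]] by auto
  have d1: "fst differentiable (at p)" "snd differentiable (at p)"
    using Ck_imp_differentiable[OF Ck_fst] Ck_imp_differentiable[OF Ck_snd] by auto
  show ?thesis
    unfolding mono_fun_def[abs_def] by (simp add: pd_mult d pd_power d1 pd_fst pd_snd)
qed

lemma Ck_pd_mono_fun: "Ck k (pd v (mono_fun \<gamma>))"
  by (rule Ck_pd[OF Ck_mono_fun])

lemma pdbar_pd_mono_fun: "pdbar v (pd v' (mono_fun \<gamma>)) p = 0"
proof -
  have "pdbar v (mono_fun \<gamma>) = (\<lambda>_. 0)" by (auto simp: pdbar_mono_fun)
  then show ?thesis by (simp add: pdbar_pd_commute[OF Ck_mono_fun] pd_const)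
qed

lemma Ck_pd_phi: "Ck k (pd_phi \<Gamma> v)"
  unfolding pd_phi_def[abs_def] by (intro Ck_intros Ck_pd_mono_fun Ck_mono_fun)

lemma Ck_hess: "Ck k (hess \<Gamma> v v')"
  unfolding hess_def[abs_def] by (intro Ck_intros Ck_pd_mono_fun)

lemma pdbar_pd_phi: "pdbar v' (pd_phi \<Gamma> v) p = hess \<Gamma> v v' p"
proof -
  have 1: "(\<lambda>p. pd v (mono_fun \<gamma>) p * cnj (mono_fun \<gamma> p)) differentiable (at p)" for \<gamma>
    by (intro Ck_imp_differentiable[of 0] Ck_mult Ck_cnj Ck_pd_mono_fun Ck_mono_fun)
  have 2: "pd v (mono_fun \<gamma>) differentiable (at p)" "(\<lambda>p. cnj (mono_fun \<gamma> p)) differentiable (at p)" for \<gamma>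
    by (intro Ck_imp_differentiable[of 0] Ck_mult Ck_cnj Ck_pd_mono_fun Ck_mono_fun)+
  show ?thesis
    unfolding pd_phi_def[abs_def] hess_def
    by (simp add: pdbar_sum 1 pdbar_mult 2 pdbar_pd_mono_fun pdbar_cnj mono_fun_differentiable)
qed

lemma hess_diag: "hess \<Gamma> v v p = complex_of_real (hess_diag \<Gamma> v p)"
  by (simp only: hess_def hess_diag_def of_real_sum complex_norm_square)

lemma hess_diag_nonneg: "0 \<le> hess_diag \<Gamma> v p"
  by (auto simp: hess_diag_def intro: sum_nonneg)

lemma monomial_weight_eq: "complex_of_real (monomial_weight \<Gamma> p) = (\<Sum>\<gamma>\<in>\<Gamma>. mono_fun \<gamma> p * cnj (mono_fun \<gamma> p))"
proof -
  have "monomial_weight \<Gamma> p = (\<Sum>\<gamma>\<in>\<Gamma>. (cmod (mono_fun \<gamma> p))\<^sup>2)"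
    by (simp add: monomial_weight_def mono_fun_def split_beta)
  then show ?thesis by (simp only: of_real_sum complex_norm_square)
qed

text \<open>Exhibits the weight as a complex exponential of a polynomial in z, w and their
  conjugates, so that the calculus for complex-valued functions applies to it.\<close>

lemma cwexp_eq: "cwexp \<Gamma> = (\<lambda>p. exp (- 2 * (\<Sum>\<gamma>\<in>\<Gamma>. mono_fun \<gamma> p * cnj (mono_fun \<gamma> p))))"
  by (auto simp: cwexp_def wexp_def exp_of_real[symmetric] monomial_weight_eq[symmetric])

lemma wexp_pos: "0 < wexp \<Gamma> p"
  by (simp add: wexp_def)

lemma exp_has_dd:
  assumes "f differentiable (at p)"
  shows "((\<lambda>p. exp (f p)) has_derivative (\<lambda>v. dd f v p * exp (f p))) (at p)"
proof -
  have "(exp has_derivative (\<lambda>y. exp (f p) * y)) (at (f p))"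
    using DERIV_exp[of "f p"] by (simp add: has_field_derivative_def)
  from diff_chain_at[OF differentiable_has_dd[OF assms] this]
  show ?thesis by (simp add: o_def mult.commute)
qed

lemma Ck_exp: "Ck (Suc 0) f \<Longrightarrow> Ck (Suc 0) (\<lambda>p. exp (f p))"
proof -
  assume f: "Ck (Suc 0) f"
  then have d: "f differentiable (at p)" for p by simp
  have "dd (\<lambda>p. exp (f p)) v = (\<lambda>p. dd f v p * exp (f p))" for v
    by (intro ext dd_eq[OF exp_has_dd[OF d]])
  moreover have "continuous_on UNIV (\<lambda>p. dd f v p * exp (f p))" for v
    using f Ck_imp_continuous[OF f] by (auto intro!: continuous_intros)
  moreover have "(\<lambda>p. exp (f p)) differentiable (at p)" for p
    by (rule differentiableI[OF exp_has_dd[OF d]])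
  ultimately show ?thesis by simp
qed

lemma Ck_cwexp: "Ck (Suc 0) (cwexp \<Gamma>)"
  unfolding cwexp_eq by (intro Ck_exp Ck_intros Ck_mono_fun)

lemma continuous_wexp: "continuous_on UNIV (wexp \<Gamma>)"
proof -
  have "wexp \<Gamma> = (\<lambda>p. Re (cwexp \<Gamma> p))" by (auto simp: cwexp_def)
  then show ?thesis using Ck_imp_continuous[OF Ck_cwexp] by (auto intro: continuous_intros)
qed

lemma pdbar_exp: "f differentiable (at p) \<Longrightarrow> pdbar v (\<lambda>p. exp (f p)) p = exp (f p) * pdbar v f p"
  by (simp add: pdbar_def dd_eq[OF exp_has_dd] field_simps)

text \<open>The constant \<open>c\<close> is left free for two uses: \<open>c = -2\<close> is the
  weight itself, and \<open>c = 2\<close> its inverse, which enters the test functions of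
  \<open>adjoint_mollify\<close>.\<close>

lemma pdbar_exp_weight:
  "pdbar v (\<lambda>p. exp (c * (\<Sum>\<gamma>\<in>\<Gamma>. mono_fun \<gamma> p * cnj (mono_fun \<gamma> p)))) p
    = c * cnj (pd_phi \<Gamma> v p) * exp (c * (\<Sum>\<gamma>\<in>\<Gamma>. mono_fun \<gamma> p * cnj (mono_fun \<gamma> p)))"
proof -
  have d: "(\<lambda>p. mono_fun \<gamma> p * cnj (mono_fun \<gamma> p)) differentiable (at p)" "(\<lambda>p. cnj (mono_fun \<gamma> p)) differentiable (at p)" for \<gamma>
    by (intro Ck_imp_differentiable[of 0] Ck_mult Ck_cnj Ck_mono_fun)+
  have ds: "(\<lambda>p. \<Sum>\<gamma>\<in>\<Gamma>. mono_fun \<gamma> p * cnj (mono_fun \<gamma> p)) differentiable (at p)"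
    by (intro Ck_imp_differentiable[of 0] Ck_sum Ck_mult Ck_cnj Ck_mono_fun)
  have de: "(\<lambda>p. c * (\<Sum>\<gamma>\<in>\<Gamma>. mono_fun \<gamma> p * cnj (mono_fun \<gamma> p))) differentiable (at p)"
    by (intro Ck_imp_differentiable[of 0] Ck_cmult Ck_sum Ck_mult Ck_cnj Ck_mono_fun)
  have "pdbar v (\<lambda>p. \<Sum>\<gamma>\<in>\<Gamma>. mono_fun \<gamma> p * cnj (mono_fun \<gamma> p)) p = cnj (pd_phi \<Gamma> v p)"
    by (simp add: pdbar_sum d pdbar_mult mono_fun_differentiable pdbar_mono_fun pdbar_cnj pd_phi_def mult.commute)
  then have "pdbar v (\<lambda>p. c * (\<Sum>\<gamma>\<in>\<Gamma>. mono_fun \<gamma> p * cnj (mono_fun \<gamma> p))) p = c * cnj (pd_phi \<Gamma> v p)"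
    by (subst pdbar_cmult[OF ds]) simp
  then show ?thesis
    by (subst pdbar_exp[OF de]) simp
qed

lemma pdbar_cwexp: "pdbar v (cwexp \<Gamma>) p = - 2 * cnj (pd_phi \<Gamma> v p) * cwexp \<Gamma> p"
  unfolding cwexp_eq by (rule pdbar_exp_weight)

lemma Ck_pdbar_adj: "Ck (Suc k) f \<Longrightarrow> Ck k (pdbar_adj \<Gamma> v f)"
  unfolding pdbar_adj_def[abs_def] by (intro Ck_intros Ck_pd Ck_pd_phi) (auto dest: Ck_Suc_imp simp del: Ck.simps)

section \<open>Weighted inner products and the formal adjoint\<close>

definition wip :: "(nat \<times> nat) set \<Rightarrow> (c2 \<Rightarrow> complex) \<Rightarrow> (c2 \<Rightarrow> complex) \<Rightarrow> complex" where
  "wip \<Gamma> f g = (\<integral>p. f p * cnj (g p) * cwexp \<Gamma> p \<partial>lborel)"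

definition wsq :: "(nat \<times> nat) set \<Rightarrow> (c2 \<Rightarrow> complex) \<Rightarrow> real" where
  "wsq \<Gamma> f = (\<integral>p. (cmod (f p))\<^sup>2 * wexp \<Gamma> p \<partial>lborel)"

lemma wip_self: "wip \<Gamma> f f = complex_of_real (wsq \<Gamma> f)"
  unfolding wip_def wsq_def cwexp_def complex_norm_square[symmetric] of_real_mult[symmetric]
  by (rule integral_complex_of_real)

lemma wip_cnj: "cnj (wip \<Gamma> f g) = wip \<Gamma> g f"
proof -
  have "cnj (wip \<Gamma> f g) = (\<integral>p. cnj (f p * cnj (g p) * cwexp \<Gamma> p) \<partial>lborel)"
    unfolding wip_def by (rule Bochner_Integration.integral_cnj[symmetric])
  also have "\<dots> = wip \<Gamma> g f"
    unfolding wip_def by (simp add: cwexp_def mult_ac)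
  finally show ?thesis .
qed

definition nice :: "(c2 \<Rightarrow> complex) \<Rightarrow> bool" where
  "nice f \<longleftrightarrow> continuous_on UNIV f \<and> csupp f"

lemma continuous_cwexp: "continuous_on UNIV (cwexp \<Gamma>)"
  by (rule Ck_imp_continuous[OF Ck_cwexp])

lemma integrable_wip: "nice f \<Longrightarrow> continuous_on UNIV g \<Longrightarrow> integrable lborel (\<lambda>p. f p * cnj (g p) * cwexp \<Gamma> p)"
  unfolding nice_def
  by (intro integrable_csupp csupp_mult_left continuous_intros continuous_cwexp) auto

lemma
  assumes "nice f" "nice g" "nice k"
  shows wip_add_left: "wip \<Gamma> (\<lambda>p. f p + g p) k = wip \<Gamma> f k + wip \<Gamma> g k"
    and wip_add_right: "wip \<Gamma> k (\<lambda>p. f p + g p) = wip \<Gamma> k f + wip \<Gamma> k g"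
    and wip_diff_left: "wip \<Gamma> (\<lambda>p. f p - g p) k = wip \<Gamma> f k - wip \<Gamma> g k"
    and wip_diff_right: "wip \<Gamma> k (\<lambda>p. f p - g p) = wip \<Gamma> k f - wip \<Gamma> k g"
  using assms unfolding wip_def
  by (simp_all add: ring_distribs nice_def integrable_wip[unfolded nice_def])

lemma csupp_pdbar_adj: "Ck (Suc 0) f \<Longrightarrow> csupp f \<Longrightarrow> csupp (pdbar_adj \<Gamma> v f)"
  unfolding pdbar_adj_def[abs_def] by (intro csupp_add csupp_uminus csupp_pd csupp_mult_right)

text \<open>Differentiating the weight yields the factor
  \<open>-2 * cnj (pd_phi \<Gamma> v p)\<close>, which together with the derivative of
  \<open>cnj (g p)\<close> is exactly \<open>- cnj (pdbar_adj \<Gamma> v g p)\<close>. Integrating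
  this product rule gives the duality in \<open>wip_by_parts\<close>.\<close>

lemma pdbar_weighted:
  assumes f: "Ck (Suc 0) f" and g: "Ck (Suc 0) g"
  shows "pdbar v (\<lambda>p. f p * cnj (g p) * cwexp \<Gamma> p) p
    = pdbar v f p * cnj (g p) * cwexp \<Gamma> p - f p * cnj (pdbar_adj \<Gamma> v g p) * cwexp \<Gamma> p"
proof -
  have d: "f differentiable (at p)" "g differentiable (at p)" "(\<lambda>p. cnj (g p)) differentiable (at p)"
    "(\<lambda>p. f p * cnj (g p)) differentiable (at p)" "cwexp \<Gamma> differentiable (at p)"
    by (intro Ck_imp_differentiable[of 0] Ck_mult Ck_cnj f g Ck_cwexp)+
  show ?thesis
    by (simp add: pdbar_mult d pdbar_cnj pdbar_cwexp pdbar_adj_def algebra_simps)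
qed

lemma wip_by_parts:
  assumes f: "Ck (Suc 0) f" and g: "Ck (Suc 0) g" and supp: "csupp f \<or> csupp g"
  shows "wip \<Gamma> (pdbar v f) g = wip \<Gamma> f (pdbar_adj \<Gamma> v g)"
proof -
  let ?F = "\<lambda>p. f p * cnj (g p) * cwexp \<Gamma> p"
  have C: "Ck (Suc 0) ?F" by (intro Ck_mult f Ck_cnj g Ck_cwexp)
  have s: "csupp ?F" using supp by (auto simp: csupp_def)
  have cont: "continuous_on UNIV f" "continuous_on UNIV g" "continuous_on UNIV (pdbar v f)" "continuous_on UNIV (pdbar_adj \<Gamma> v g)"
    using f g by (auto intro: Ck_imp_continuous[OF Ck_pdbar] Ck_imp_continuous[OF Ck_pdbar_adj] Ck_imp_continuous simp del: Ck.simps)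
  have s1: "csupp (\<lambda>p. pdbar v f p * cnj (g p))" "csupp (\<lambda>p. f p * cnj (pdbar_adj \<Gamma> v g p))"
  proof -
    show "csupp (\<lambda>p. pdbar v f p * cnj (g p))"
      by (cases "csupp f") (use supp in \<open>auto intro: csupp_mult_left[OF csupp_pdbar[OF f]] csupp_mult_right[OF csupp_cnj]\<close>)
    show "csupp (\<lambda>p. f p * cnj (pdbar_adj \<Gamma> v g p))"
      by (cases "csupp f") (use supp in \<open>auto intro: csupp_mult_left csupp_mult_right[OF csupp_cnj[OF csupp_pdbar_adj[OF g]]]\<close>)
  qed
  have "(\<integral>p. pdbar v f p * cnj (g p) * cwexp \<Gamma> p - f p * cnj (pdbar_adj \<Gamma> v g p) * cwexp \<Gamma> p \<partial>lborel) = 0"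
    using integral_pdbar[OF C s, of v] by (simp add: pdbar_weighted[OF f g])
  moreover have "integrable lborel (\<lambda>p. pdbar v f p * cnj (g p) * cwexp \<Gamma> p)"
    "integrable lborel (\<lambda>p. f p * cnj (pdbar_adj \<Gamma> v g p) * cwexp \<Gamma> p)"
    by (intro integrable_csupp csupp_mult_left[OF s1(1)] csupp_mult_left[OF s1(2)] continuous_intros continuous_cwexp cont)+
  ultimately show ?thesis
    unfolding wip_def by simp
qed

lemma nice_pdbar: "Ck (Suc 0) f \<Longrightarrow> csupp f \<Longrightarrow> nice (pdbar v f)"
  unfolding nice_def using Ck_imp_continuous[OF Ck_pdbar] csupp_pdbar by blast

lemma nice_pdbar_adj: "Ck (Suc 0) f \<Longrightarrow> csupp f \<Longrightarrow> nice (pdbar_adj \<Gamma> v f)"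
  unfolding nice_def using Ck_imp_continuous[OF Ck_pdbar_adj] csupp_pdbar_adj by blast

text \<open>One adjoint is moved off \<open>g\<close> and commuted past the other. Since
  \<open>pd\<close> and \<open>pdbar\<close> commute, the commutator is only the
  \<open>pdbar\<close>-derivative of the coefficient \<open>2 * pd_phi\<close>, that is,
  multiplication by twice a Hessian entry; then the remaining adjoint is moved back to
  \<open>g\<close>.\<close>

lemma wip_commutator:
  assumes f: "Ck (Suc (Suc 0)) f" "csupp f" and g: "Ck (Suc (Suc 0)) g" "csupp g"
  shows "wip \<Gamma> (pdbar_adj \<Gamma> v f) (pdbar_adj \<Gamma> v' g) = wip \<Gamma> (pdbar v' f) (pdbar v g) + 2 * wip \<Gamma> (\<lambda>p. hess \<Gamma> v v' p * f p) g"
proof -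
  have f1: "Ck (Suc 0) f" and g1: "Ck (Suc 0) g" using f g Ck_Suc_imp by blast+
  have Df: "Ck (Suc 0) (pdbar_adj \<Gamma> v f)" by (rule Ck_pdbar_adj[OF f(1)])
  have pf: "Ck (Suc 0) (pdbar v' f)" by (rule Ck_pdbar[OF f(1)])
  have "wip \<Gamma> (pdbar_adj \<Gamma> v f) (pdbar_adj \<Gamma> v' g) = wip \<Gamma> (pdbar v' (pdbar_adj \<Gamma> v f)) g"
    by (rule wip_by_parts[symmetric, OF Df g1]) (use g in auto)
  also have "pdbar v' (pdbar_adj \<Gamma> v f) = (\<lambda>p. pdbar_adj \<Gamma> v (pdbar v' f) p + 2 * (hess \<Gamma> v v' p * f p))"
  proof
    fix p
    have d: "pd v f differentiable (at p)" "(\<lambda>p. - pd v f p) differentiable (at p)" "(\<lambda>p. 2 * pd_phi \<Gamma> v p) differentiable (at p)" "pd_phi \<Gamma> v differentiable (at p)"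
      "(\<lambda>p. 2 * pd_phi \<Gamma> v p * f p) differentiable (at p)" "f differentiable (at p)"
      by (intro Ck_imp_differentiable[of 0] Ck_intros Ck_pd f(1) f1 Ck_pd_phi)+
    show "pdbar v' (pdbar_adj \<Gamma> v f) p = pdbar_adj \<Gamma> v (pdbar v' f) p + 2 * (hess \<Gamma> v v' p * f p)"
      unfolding pdbar_adj_def[abs_def]
      by (simp only: pdbar_add d pdbar_uminus pdbar_mult pdbar_const pdbar_pd_commute[OF f(1)] pdbar_pd_phi differentiable_const)
        (simp add: algebra_simps)
  qed
  also have "wip \<Gamma> (\<lambda>p. pdbar_adj \<Gamma> v (pdbar v' f) p + 2 * (hess \<Gamma> v v' p * f p)) g =
      wip \<Gamma> (pdbar_adj \<Gamma> v (pdbar v' f)) g + wip \<Gamma> (\<lambda>p. 2 * (hess \<Gamma> v v' p * f p)) g"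
  proof (rule wip_add_left)
    show "nice (pdbar_adj \<Gamma> v (pdbar v' f))" by (rule nice_pdbar_adj[OF pf csupp_pdbar[OF f1 f(2)]])
    show "nice (\<lambda>p. 2 * (hess \<Gamma> v v' p * f p))" "nice g"
      unfolding nice_def using f g1 g f1
      by (auto intro!: csupp_mult_right continuous_intros Ck_imp_continuous[OF Ck_hess] intro: Ck_imp_continuous simp del: Ck.simps)
  qed
  also have "wip \<Gamma> (\<lambda>p. 2 * (hess \<Gamma> v v' p * f p)) g = 2 * wip \<Gamma> (\<lambda>p. hess \<Gamma> v v' p * f p) g"
    unfolding wip_def by (simp add: mult.assoc)
  also have "wip \<Gamma> (pdbar_adj \<Gamma> v (pdbar v' f)) g = wip \<Gamma> (pdbar v' f) (pdbar v g)"
    using wip_by_parts[OF g1 pf, of \<Gamma> v] g(2) wip_cnj by metis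
  finally show ?thesis .
qed

text \<open>The complex Hessian applied to the vector \<open>(a, b)\<close>. As the weight is a sum
  of squared moduli of holomorphic functions, its Hessian is a Gram matrix and the form is a sum of
  squares.\<close>

definition hess_form :: "(nat \<times> nat) set \<Rightarrow> c2 \<Rightarrow> complex \<Rightarrow> complex \<Rightarrow> real" where
  "hess_form \<Gamma> p a b = (\<Sum>\<gamma>\<in>\<Gamma>. (cmod (pd (1, 0) (mono_fun \<gamma>) p * a + pd (0, 1) (mono_fun \<gamma>) p * b))\<^sup>2)"

lemma hess_form_eq:
  "complex_of_real (hess_form \<Gamma> p a b) = hess \<Gamma> (1,0) (1,0) p * a * cnj a + hess \<Gamma> (1,0) (0,1) p * a * cnj b
    + hess \<Gamma> (0,1) (1,0) p * b * cnj a + hess \<Gamma> (0,1) (0,1) p * b * cnj b"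
  unfolding hess_form_def hess_def of_real_sum complex_norm_square sum_distrib_right sum.distrib[symmetric]
  by (intro sum.cong refl) (simp add: algebra_simps)

text \<open>After expanding both squares, the cross terms of the first one cancel against the
  derivative parts that \<open>wip_commutator\<close> produces from the cross terms of the second;
  what is left of the commutators assembles to the Hessian form.\<close>

lemma kohn_identity:
  assumes U: "Ck (Suc (Suc 0)) U1" "csupp U1" "Ck (Suc (Suc 0)) U2" "csupp U2"
  shows "wsq \<Gamma> (\<lambda>p. pdbar (1,0) U2 p - pdbar (0,1) U1 p) + wsq \<Gamma> (\<lambda>p. pdbar_adj \<Gamma> (1,0) U1 p + pdbar_adj \<Gamma> (0,1) U2 p)
    = wsq \<Gamma> (pdbar (1,0) U1) + wsq \<Gamma> (pdbar (0,1) U1) + wsq \<Gamma> (pdbar (1,0) U2) + wsq \<Gamma> (pdbar (0,1) U2)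
      + 2 * (\<integral>p. hess_form \<Gamma> p (U1 p) (U2 p) * wexp \<Gamma> p \<partial>lborel)"
proof -
  let ?a = "(1,0) :: c2" and ?b = "(0,1) :: c2"
  have U1: "Ck (Suc 0) U1" "Ck (Suc 0) U2" using U Ck_Suc_imp by blast+
  have n: "nice (pdbar v U1)" "nice (pdbar v U2)" "nice (pdbar_adj \<Gamma> v U1)" "nice (pdbar_adj \<Gamma> v U2)" for v
    using U U1 by (auto intro: nice_pdbar nice_pdbar_adj simp del: Ck.simps)
  have nd: "nice f \<Longrightarrow> nice g \<Longrightarrow> nice (\<lambda>p. f p - g p)" "nice f \<Longrightarrow> nice g \<Longrightarrow> nice (\<lambda>p. f p + g p)" for f g
    by (auto simp: nice_def intro: continuous_intros csupp_diff csupp_add)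
  have i: "integrable lborel (\<lambda>p. hess \<Gamma> v v' p * f p * cnj (g p) * cwexp \<Gamma> p)" if "f \<in> {U1, U2}" "g \<in> {U1, U2}" for v v' f g
  proof -
    have "continuous_on UNIV U1" "continuous_on UNIV U2" using U1 Ck_imp_continuous by blast+
    then show ?thesis using that U
      by (intro integrable_csupp csupp_mult_left continuous_intros Ck_imp_continuous[OF Ck_hess] continuous_cwexp csupp_mult_right) auto
  qed
  have H: "complex_of_real (\<integral>p. hess_form \<Gamma> p (U1 p) (U2 p) * wexp \<Gamma> p \<partial>lborel) =
      wip \<Gamma> (\<lambda>p. hess \<Gamma> ?a ?a p * U1 p) U1 + wip \<Gamma> (\<lambda>p. hess \<Gamma> ?a ?b p * U1 p) U2
      + wip \<Gamma> (\<lambda>p. hess \<Gamma> ?b ?a p * U2 p) U1 + wip \<Gamma> (\<lambda>p. hess \<Gamma> ?b ?b p * U2 p) U2"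
  proof -
    have "complex_of_real (\<integral>p. hess_form \<Gamma> p (U1 p) (U2 p) * wexp \<Gamma> p \<partial>lborel) =
      (\<integral>p. hess \<Gamma> ?a ?a p * U1 p * cnj (U1 p) * cwexp \<Gamma> p + hess \<Gamma> ?a ?b p * U1 p * cnj (U2 p) * cwexp \<Gamma> p
        + hess \<Gamma> ?b ?a p * U2 p * cnj (U1 p) * cwexp \<Gamma> p + hess \<Gamma> ?b ?b p * U2 p * cnj (U2 p) * cwexp \<Gamma> p \<partial>lborel)"
      unfolding integral_complex_of_real[symmetric]
      by (intro Bochner_Integration.integral_cong refl) (simp add: hess_form_eq cwexp_def[symmetric] distrib_right)
    also have "\<dots> = wip \<Gamma> (\<lambda>p. hess \<Gamma> ?a ?a p * U1 p) U1 + wip \<Gamma> (\<lambda>p. hess \<Gamma> ?a ?b p * U1 p) U2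
      + wip \<Gamma> (\<lambda>p. hess \<Gamma> ?b ?a p * U2 p) U1 + wip \<Gamma> (\<lambda>p. hess \<Gamma> ?b ?b p * U2 p) U2"
      unfolding wip_def
      by (subst Bochner_Integration.integral_add | intro Bochner_Integration.integrable_add i | simp)+
    finally show ?thesis .
  qed
  have "complex_of_real (wsq \<Gamma> (\<lambda>p. pdbar ?a U2 p - pdbar ?b U1 p) + wsq \<Gamma> (\<lambda>p. pdbar_adj \<Gamma> ?a U1 p + pdbar_adj \<Gamma> ?b U2 p))
    = complex_of_real (wsq \<Gamma> (pdbar ?a U1) + wsq \<Gamma> (pdbar ?b U1) + wsq \<Gamma> (pdbar ?a U2) + wsq \<Gamma> (pdbar ?b U2)
      + 2 * (\<integral>p. hess_form \<Gamma> p (U1 p) (U2 p) * wexp \<Gamma> p \<partial>lborel))"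
    unfolding of_real_add of_real_mult wip_self[symmetric] H
    by (simp only: wip_diff_left wip_diff_right wip_add_left wip_add_right n nd wip_commutator U) simp
  then show ?thesis unfolding of_real_eq_iff .
qed

section \<open>Uncertainty principle and the complex Hessian\<close>

text \<open>Along a real line \<open>cnj (L + s * c)\<close> equals
  \<open>cnj L + s * cnj c\<close>, which is holomorphic in a complex \<open>s\<close>. The quotient
  is therefore differentiated as a rational function of a complex variable and then restricted to
  real \<open>s\<close>.\<close>

lemma has_vector_derivative_cutoff_quotient:
  fixes L c :: complex and t x :: real
  assumes "0 \<le> t"
  defines "N \<equiv> 1 + of_real t * ((L + of_real x * c) * cnj (L + of_real x * c))"
  shows "((\<lambda>s. of_real t * cnj (L + of_real s * c) / (1 + of_real t * ((L + of_real s * c) * cnj (L + of_real s * c))))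
    has_vector_derivative (of_real t * cnj c / N - of_real t * cnj (L + of_real x * c) * of_real t
      * (c * cnj (L + of_real x * c) + (L + of_real x * c) * cnj c) / N\<^sup>2)) (at x)"
proof -
  have N: "N = of_real (1 + t * (cmod (L + of_real x * c))\<^sup>2)"
    unfolding N_def of_real_add of_real_mult complex_norm_square by simp
  have "1 + t * (cmod (L + of_real x * c))\<^sup>2 > 0"
    using assms(1) by (simp add: add_pos_nonneg)
  then have "N \<noteq> 0" unfolding N of_real_eq_0_iff by linarith
  then have N0: "1 + of_real t * ((L + of_real x * c) * (cnj L + of_real x * cnj c)) \<noteq> 0"
    by (simp add: N_def)
  \<comment> \<open>The left side is the unsimplified shape in which
    \<open>derivative_eq_intros\<close> delivers the derivative of the quotient.\<close>
  have quot: "((0 * M + (0 + (1 * c' + 0 * x')) * t') * D - t' * M * (0 + (0 * (Lx * M) + ((0 + (1 * c + 0 * x')) * M + (0 + (1 * c' + 0 * x')) * Lx) * t'))) / (D * D)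
      = t' * c' / D - t' * M * t' * (c * M + Lx * c') / D\<^sup>2" if "D \<noteq> 0" for M c' x' t' D Lx :: complex
    using that by (simp add: field_simps power2_eq_square)
  have "((\<lambda>s. of_real t * (cnj L + s * cnj c) / (1 + of_real t * ((L + s * c) * (cnj L + s * cnj c))))
    has_field_derivative (of_real t * cnj c / N - of_real t * cnj (L + of_real x * c) * of_real t
      * (c * cnj (L + of_real x * c) + (L + of_real x * c) * cnj c) / N\<^sup>2)) (at (of_real x))"
    unfolding N_def complex_cnj_add complex_cnj_mult complex_cnj_complex_of_real
    by (rule derivative_eq_intros refl N0)+ (rule quot[OF N0])
  from has_vector_derivative_real_field[OF this] show ?thesis
    by simp
qed

lemma line_of_linear:
  assumes "bounded_linear (l :: c2 \<Rightarrow> complex)"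
  shows "l (p + s *\<^sub>R a) = l p + of_real s * l a"
proof -
  interpret bounded_linear l by fact
  show ?thesis by (simp add: add scaleR scaleR_conv_of_real)
qed

text \<open>Along \<open>a\<close> the function \<open>T\<close> is constant, so the multiplier
  \<open>h\<close> is a smooth function of the linear form \<open>l\<close> there although
  \<open>T\<close> is merely continuous on the whole space. Hence the integrand is a genuine line
  derivative of the compactly supported \<open>h * F\<close>.\<close>

lemma integral_cutoff_line:
  fixes T :: "c2 \<Rightarrow> real" and l :: "c2 \<Rightarrow> complex" and F :: "c2 \<Rightarrow> complex"
  assumes F: "Ck (Suc 0) F" "csupp F" and l: "bounded_linear l"
    and T: "continuous_on UNIV T" "\<And>p. 0 \<le> T p" "\<And>p s. T (p + s *\<^sub>R a) = T p"
  defines "N \<equiv> \<lambda>p. 1 + of_real (T p) * (l p * cnj (l p))"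
  defines "h \<equiv> \<lambda>p. of_real (T p) * cnj (l p) / N p"
  defines "h' \<equiv> \<lambda>p. of_real (T p) * cnj (l a) / N p - of_real (T p) * cnj (l p) * of_real (T p)
      * (l a * cnj (l p) + l p * cnj (l a)) / (N p)\<^sup>2"
  shows "(\<integral>p. h' p * F p + h p * dd F a p \<partial>lborel) = 0"
    and "integrable lborel (\<lambda>p. h' p * F p + h p * dd F a p)"
proof -
  have contl: "continuous_on UNIV l" by (rule linear_continuous_on[OF l])
  have N: "N p = of_real (1 + T p * (cmod (l p))\<^sup>2)" for p
    unfolding N_def of_real_add of_real_mult complex_norm_square by simp
  have N0: "N p \<noteq> 0" for p
  proof -
    have "1 + T p * (cmod (l p))\<^sup>2 > 0" using T(2)[of p] by (simp add: add_pos_nonneg)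
    then show ?thesis unfolding N of_real_eq_0_iff by linarith
  qed
  have cN: "continuous_on UNIV N"
    unfolding N_def by (intro continuous_intros contl T)
  have ch: "continuous_on UNIV h"
    unfolding h_def by (intro continuous_intros contl T cN) (use N0 in auto)
  have ch': "continuous_on UNIV h'"
    unfolding h'_def by (intro continuous_intros contl T cN) (use N0 in auto)
  have d: "\<And>q. F differentiable (at q)" using F(1) by simp
  have cF: "continuous_on UNIV F" by (rule Ck_imp_continuous[OF F(1)])
  have cdF: "continuous_on UNIV (dd F a)" using F(1) by simp
  have der: "((\<lambda>s. h (p + s *\<^sub>R a) * F (p + s *\<^sub>R a)) has_vector_derivative
      (h' (p + x *\<^sub>R a) * F (p + x *\<^sub>R a) + h (p + x *\<^sub>R a) * dd F a (p + x *\<^sub>R a))) (at x)" for p x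
  proof -
    have "((\<lambda>s. h (p + s *\<^sub>R a)) has_vector_derivative h' (p + x *\<^sub>R a)) (at x)"
      using has_vector_derivative_cutoff_quotient[OF T(2)[of p], of "l p" "l a" x]
      by (simp add: h_def h'_def N_def line_of_linear[OF l] T(3))
    from has_vector_derivative_mult[OF this line_has_vector_derivative[OF d]]
    show ?thesis by (simp add: add.commute)
  qed
  have c': "continuous_on UNIV (\<lambda>p. h' p * F p + h p * dd F a p)"
    by (intro continuous_intros ch ch' cF cdF)
  show "(\<integral>p. h' p * F p + h p * dd F a p \<partial>lborel) = 0"
    by (rule integral_line_derivative[OF _ _ c' der])
      (intro continuous_intros ch cF csupp_mult_right F(2))+
  show "integrable lborel (\<lambda>p. h' p * F p + h p * dd F a p)"
    by (intro integrable_csupp c' csupp_add csupp_mult_right csupp_dd F)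
qed

lemma wsq_nonneg: "0 \<le> wsq \<Gamma> f"
  unfolding wsq_def by (intro Bochner_Integration.integral_nonneg mult_nonneg_nonneg less_imp_le[OF wexp_pos]) auto

lemma wsq_pdbar_adj:
  assumes f: "Ck (Suc (Suc 0)) f" "csupp f"
  shows "wsq \<Gamma> (pdbar_adj \<Gamma> v f) = wsq \<Gamma> (pdbar v f) + 2 * (\<integral>p. hess_diag \<Gamma> v p * (cmod (f p))\<^sup>2 * wexp \<Gamma> p \<partial>lborel)"
proof -
  have "wip \<Gamma> (\<lambda>p. hess \<Gamma> v v p * f p) f = complex_of_real (\<integral>p. hess_diag \<Gamma> v p * (cmod (f p))\<^sup>2 * wexp \<Gamma> p \<partial>lborel)"
    unfolding wip_def integral_complex_of_real[symmetric]
    by (intro Bochner_Integration.integral_cong refl)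
      (simp only: hess_diag cwexp_def of_real_mult complex_norm_square mult.assoc)
  then have "complex_of_real (wsq \<Gamma> (pdbar_adj \<Gamma> v f)) = complex_of_real (wsq \<Gamma> (pdbar v f) + 2 * (\<integral>p. hess_diag \<Gamma> v p * (cmod (f p))\<^sup>2 * wexp \<Gamma> p \<partial>lborel))"
    unfolding of_real_add of_real_mult wip_self[symmetric]
    by (simp add: wip_commutator[OF f f])
  then show ?thesis unfolding of_real_eq_iff .
qed

lemma continuous_hess_diag: "continuous_on UNIV (hess_diag \<Gamma> v)"
  unfolding hess_diag_def[abs_def] by (intro continuous_intros Ck_imp_continuous[OF Ck_pd_mono_fun])

lemma integrable_weighted_square:
  assumes "continuous_on UNIV f" "csupp f" "continuous_on UNIV k"
  shows "integrable lborel (\<lambda>p. k p * (cmod (f p))\<^sup>2 * wexp \<Gamma> p)"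
proof (rule integrable_csupp_real)
  show "continuous_on UNIV (\<lambda>p. k p * (cmod (f p))\<^sup>2 * wexp \<Gamma> p)"
    by (intro continuous_intros assms continuous_wexp)
  show "csupp (\<lambda>p. complex_of_real (k p * (cmod (f p))\<^sup>2 * wexp \<Gamma> p))"
    using assms(2) by (auto simp: csupp_def)
qed

text \<open>From \<open>4 * (T * q) \<le> (1 + T * q)^2\<close> follows
  \<open>|h|^2 \<le> T / 4\<close>. If \<open>T * q < 1\<close> the denominator is at most 4,
  otherwise \<open>L\<close> takes over; either way \<open>T / 4\<close> is available. The cross
  terms, split by \<open>x * y \<le> x^2 / 4 + y^2\<close>, consume \<open>T / 8\<close> of it, and
  \<open>T / 8\<close> remains.\<close>

lemma uncertainty_pointwise:
  fixes T q r x y L :: real and h A B :: complex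
  assumes T: "0 \<le> T" "0 \<le> q" and big: "1 \<le> T * q \<Longrightarrow> T \<le> L" and L: "0 \<le> L"
    and h: "(cmod h)\<^sup>2 = T\<^sup>2 * q / (1 + T * q)\<^sup>2"
  shows "T * (cmod f)\<^sup>2 / 8 \<le> T / (1 + T * q)\<^sup>2 * (cmod f)\<^sup>2 + Re (h * (A * cnj f - f * cnj B))
     + ((cmod A)\<^sup>2 + (cmod B)\<^sup>2 + L * (cmod f)\<^sup>2)"
proof -
  have N: "1 + T * q \<ge> 1" using T by simp
  have "4 * (T * q) \<le> (1 + T * q)\<^sup>2"
    using zero_le_power2[of "1 - T * q"] by (simp add: power2_eq_square algebra_simps)
  then have "T * (4 * (T * q)) \<le> T * (1 + T * q)\<^sup>2" using T by (intro mult_left_mono) auto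
  then have h4: "(cmod h)\<^sup>2 \<le> T / 4"
    unfolding h by (subst pos_divide_le_eq) (use N in \<open>simp, simp add: power2_eq_square algebra_simps\<close>)
  have 1: "T / 4 \<le> T / (1 + T * q)\<^sup>2 + L"
  proof (cases "1 \<le> T * q")
    case True
    then have "T / 4 \<le> L" using big T by linarith
    moreover have "0 \<le> T / (1 + T * q)\<^sup>2" using T by simp
    ultimately show ?thesis by linarith
  next
    case False
    then have "(1 + T * q)\<^sup>2 \<le> 2\<^sup>2" using N by (intro power_mono) auto
    moreover have "0 < (1 + T * q)\<^sup>2" using N by (intro zero_less_power) linarith
    ultimately have "T / 4 \<le> T / (1 + T * q)\<^sup>2" using T by (intro divide_left_mono) simp_all
    then show ?thesis using L by simp
  qed
  have 2: "cmod h * (cmod a * cmod f) \<le> (cmod h)\<^sup>2 * (cmod f)\<^sup>2 / 4 + (cmod a)\<^sup>2" for a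
    using zero_le_power2[of "cmod h * cmod f / 2 - cmod a"] by (simp add: power2_eq_square field_simps)
  have "- Re (h * (A * cnj f - f * cnj B)) \<le> cmod (h * (A * cnj f - f * cnj B))"
    using abs_Re_le_cmod[of "h * (A * cnj f - f * cnj B)"] by linarith
  also have "\<dots> \<le> cmod h * (cmod A * cmod f + cmod B * cmod f)"
    unfolding norm_mult[of h]
    by (intro mult_left_mono order_trans[OF norm_triangle_ineq4]) (auto simp: norm_mult)
  also have "\<dots> \<le> (cmod h)\<^sup>2 * (cmod f)\<^sup>2 / 2 + (cmod A)\<^sup>2 + (cmod B)\<^sup>2"
    using 2[of A] 2[of B] by (simp add: distrib_left)
  also have "(cmod h)\<^sup>2 * (cmod f)\<^sup>2 \<le> T / 4 * (cmod f)\<^sup>2" by (intro mult_right_mono h4) auto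
  finally have 3: "- Re (h * (A * cnj f - f * cnj B)) \<le> T / 8 * (cmod f)\<^sup>2 + (cmod A)\<^sup>2 + (cmod B)\<^sup>2" by simp
  have "T / 4 * (cmod f)\<^sup>2 \<le> (T / (1 + T * q)\<^sup>2 + L) * (cmod f)\<^sup>2"
    by (intro mult_right_mono 1) auto
  then show ?thesis using 3 unfolding distrib_right by linarith
qed

text \<open>The conditions on \<open>l\<close> make it the complex coordinate in direction
  \<open>v\<close>, and \<open>T\<close> depends only on the other coordinate. Then \<open>h\<close>
  has conjugate derivative \<open>T / (1 + T * |l|^2)^2\<close> in direction \<open>v\<close>, which
  is comparable to \<open>T\<close> in the region where the Hessian may be small.\<close>

lemma scalar_uncertainty:
  fixes T :: "c2 \<Rightarrow> real" and l :: "c2 \<Rightarrow> complex"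
  assumes f: "Ck (Suc (Suc 0)) f" "csupp f"
    and l: "bounded_linear l" "l v = 1" "l (imul v) = \<i>"
    and T: "continuous_on UNIV T" "\<And>p. 0 \<le> T p" "\<And>p s. T (p + s *\<^sub>R v) = T p" "\<And>p s. T (p + s *\<^sub>R imul v) = T p"
    and big: "\<And>p. 1 \<le> T p * (cmod (l p))\<^sup>2 \<Longrightarrow> T p \<le> hess_diag \<Gamma> v p"
  shows "(\<integral>p. T p * (cmod (f p))\<^sup>2 * wexp \<Gamma> p \<partial>lborel)
    \<le> 24 * (wsq \<Gamma> (pdbar v f) + (\<integral>p. hess_diag \<Gamma> v p * (cmod (f p))\<^sup>2 * wexp \<Gamma> p \<partial>lborel))"
proof -
  define F where "F = (\<lambda>p. f p * cnj (f p) * cwexp \<Gamma> p)"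
  define N where "N = (\<lambda>p. 1 + complex_of_real (T p) * (l p * cnj (l p)))"
  define h where "h = (\<lambda>p. complex_of_real (T p) * cnj (l p) / N p)"
  have f1: "Ck (Suc 0) f" using f Ck_Suc_imp by blast
  have F: "Ck (Suc 0) F" "csupp F"
    unfolding F_def by (intro Ck_mult Ck_cnj f1 Ck_cwexp csupp_mult_left f)+
  \<comment> \<open>\<open>h1 c\<close> is the derivative of \<open>h\<close> along a direction on
    which \<open>l\<close> takes the value \<open>c\<close>; the values 1 and \<open>\<i>\<close>
    belong to \<open>v\<close> and \<open>imul v\<close>.\<close>
  define h1 where "h1 = (\<lambda>c p. of_real (T p) * cnj c / N p - of_real (T p) * cnj (l p) * of_real (T p)
      * (c * cnj (l p) + l p * cnj c) / (N p)\<^sup>2)"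
  have A: "(\<integral>p. h1 1 p * F p + h p * dd F v p \<partial>lborel) = 0" "integrable lborel (\<lambda>p. h1 1 p * F p + h p * dd F v p)"
    using integral_cutoff_line[OF F l(1) T(1,2,3)] unfolding h1_def h_def N_def l(2) by simp_all
  have B: "(\<integral>p. h1 \<i> p * F p + h p * dd F (imul v) p \<partial>lborel) = 0" "integrable lborel (\<lambda>p. h1 \<i> p * F p + h p * dd F (imul v) p)"
    using integral_cutoff_line[OF F l(1) T(1,2,4)] unfolding h1_def h_def N_def l(3) by simp_all
  have Nr: "N p = of_real (1 + T p * (cmod (l p))\<^sup>2)" for p
    unfolding N_def of_real_add of_real_mult complex_norm_square by simp
  have Npos: "1 + T p * (cmod (l p))\<^sup>2 > 0" for p
    using T(2)[of p] by (simp add: add_pos_nonneg)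
  have N0: "N p \<noteq> 0" for p
    using Npos[of p] unfolding Nr of_real_eq_0_iff by linarith
  \<comment> \<open>This is the conjugate derivative of \<open>h * F\<close> in direction
    \<open>v\<close>, assembled from two line derivatives because \<open>h\<close> need not be
    Frechet differentiable.\<close>
  define Q where "Q = (\<lambda>p. ((h1 1 p * F p + h p * dd F v p) + \<i> * (h1 \<i> p * F p + h p * dd F (imul v) p)) / 2)"
  have Q0: "(\<integral>p. Q p \<partial>lborel) = 0" and Qi: "integrable lborel Q"
    using A B unfolding Q_def by simp_all
  have Q: "Q p = of_real (T p / (1 + T p * (cmod (l p))\<^sup>2)\<^sup>2) * F p + h p * pdbar v F p" for p
  proof -
    have "(h1 1 p + \<i> * h1 \<i> p) / 2 = of_real (T p) / N p - of_real (T p) * of_real (T p) * (l p * cnj (l p)) / (N p)\<^sup>2"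
      using N0[of p] by (simp add: h1_def field_simps power2_eq_square)
    also have "\<dots> = of_real (T p) * (N p - of_real (T p) * (l p * cnj (l p))) / (N p)\<^sup>2"
      using N0[of p] by (simp add: field_simps power2_eq_square)
    also have "\<dots> = of_real (T p) / (N p)\<^sup>2" by (simp add: N_def)
    finally have "(h1 1 p + \<i> * h1 \<i> p) / 2 = of_real (T p / (1 + T p * (cmod (l p))\<^sup>2)\<^sup>2)"
      by (simp add: Nr)
    note c = this
    have "Q p = (h1 1 p + \<i> * h1 \<i> p) / 2 * F p + h p * pdbar v F p"
      unfolding pdbar_def Q_def by (simp add: field_simps)
    then show ?thesis unfolding c .
  qed
  have pw: "T p * (cmod (f p))\<^sup>2 * wexp \<Gamma> p \<le> 8 * (Re (Q p) + (cmod (pdbar v f p))\<^sup>2 * wexp \<Gamma> p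
    + (cmod (pdbar_adj \<Gamma> v f p))\<^sup>2 * wexp \<Gamma> p + hess_diag \<Gamma> v p * (cmod (f p))\<^sup>2 * wexp \<Gamma> p)" for p
  proof -
    let ?t = "T p / (1 + T p * (cmod (l p))\<^sup>2)\<^sup>2"
    have hh: "(cmod (h p))\<^sup>2 = (T p)\<^sup>2 * (cmod (l p))\<^sup>2 / (1 + T p * (cmod (l p))\<^sup>2)\<^sup>2"
      unfolding h_def Nr norm_mult norm_divide norm_of_real using Npos[of p] by (simp add: power_mult_distrib power_divide)
    have "F p = of_real ((cmod (f p))\<^sup>2 * wexp \<Gamma> p)"
      unfolding F_def cwexp_def of_real_mult complex_norm_square by simp
    moreover have "pdbar v F p = (pdbar v f p * cnj (f p) - f p * cnj (pdbar_adj \<Gamma> v f p)) * of_real (wexp \<Gamma> p)"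
      unfolding F_def pdbar_weighted[OF f1 f1] by (simp add: cwexp_def algebra_simps)
    ultimately have "Q p = of_real (?t * (cmod (f p))\<^sup>2 * wexp \<Gamma> p)
        + h p * (pdbar v f p * cnj (f p) - f p * cnj (pdbar_adj \<Gamma> v f p)) * of_real (wexp \<Gamma> p)"
      unfolding Q by (simp only: of_real_mult mult.assoc)
    moreover have Re_of: "Re (z * complex_of_real r) = Re z * r" for z r by simp
    ultimately have "Re (Q p) = (?t * (cmod (f p))\<^sup>2 + Re (h p * (pdbar v f p * cnj (f p) - f p * cnj (pdbar_adj \<Gamma> v f p)))) * wexp \<Gamma> p"
      by (simp only: plus_complex.sel Re_complex_of_real Re_of distrib_right)
    moreover have "T p * (cmod (f p))\<^sup>2 / 8 * wexp \<Gamma> p \<le> (?t * (cmod (f p))\<^sup>2 + Re (h p * (pdbar v f p * cnj (f p) - f p * cnj (pdbar_adj \<Gamma> v f p)))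
     + ((cmod (pdbar v f p))\<^sup>2 + (cmod (pdbar_adj \<Gamma> v f p))\<^sup>2 + hess_diag \<Gamma> v p * (cmod (f p))\<^sup>2)) * wexp \<Gamma> p"
      using wexp_pos[of \<Gamma> p] by (intro mult_right_mono uncertainty_pointwise T big hess_diag_nonneg hh) auto
    ultimately show ?thesis by (simp add: algebra_simps)
  qed
  have cf: "continuous_on UNIV f" by (rule Ck_imp_continuous[OF f(1)])
  have n: "continuous_on UNIV (pdbar v f)" "csupp (pdbar v f)" "continuous_on UNIV (pdbar_adj \<Gamma> v f)" "csupp (pdbar_adj \<Gamma> v f)"
    using nice_pdbar[OF f1 f(2)] nice_pdbar_adj[OF f1 f(2)] by (auto simp: nice_def)
  have ints: "integrable lborel Q" "integrable lborel (\<lambda>p. (cmod (pdbar v f p))\<^sup>2 * wexp \<Gamma> p)"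
    "integrable lborel (\<lambda>p. (cmod (pdbar_adj \<Gamma> v f p))\<^sup>2 * wexp \<Gamma> p)"
    "integrable lborel (\<lambda>p. hess_diag \<Gamma> v p * (cmod (f p))\<^sup>2 * wexp \<Gamma> p)"
    using Qi integrable_weighted_square[OF n(1,2), of "\<lambda>_. 1" \<Gamma>] integrable_weighted_square[OF n(3,4), of "\<lambda>_. 1" \<Gamma>]
      integrable_weighted_square[OF cf f(2) continuous_hess_diag] by simp_all
  have "(\<integral>p. T p * (cmod (f p))\<^sup>2 * wexp \<Gamma> p \<partial>lborel) \<le> (\<integral>p. 8 * (Re (Q p) + (cmod (pdbar v f p))\<^sup>2 * wexp \<Gamma> p
    + (cmod (pdbar_adj \<Gamma> v f p))\<^sup>2 * wexp \<Gamma> p + hess_diag \<Gamma> v p * (cmod (f p))\<^sup>2 * wexp \<Gamma> p) \<partial>lborel)"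
    by (intro integral_mono pw integrable_weighted_square cf f T integrable_mult_right Bochner_Integration.integrable_add integrable_Re ints)
  also have "\<dots> = 8 * (wsq \<Gamma> (pdbar v f) + wsq \<Gamma> (pdbar_adj \<Gamma> v f) + (\<integral>p. hess_diag \<Gamma> v p * (cmod (f p))\<^sup>2 * wexp \<Gamma> p \<partial>lborel))"
    unfolding wsq_def using ints Q0 by (simp add: integral_Re)
  finally have "(\<integral>p. T p * (cmod (f p))\<^sup>2 * wexp \<Gamma> p \<partial>lborel)
    \<le> 8 * (wsq \<Gamma> (pdbar v f) + wsq \<Gamma> (pdbar_adj \<Gamma> v f) + (\<integral>p. hess_diag \<Gamma> v p * (cmod (f p))\<^sup>2 * wexp \<Gamma> p \<partial>lborel))" .
  \<comment> \<open>By \<open>wsq_pdbar_adj\<close> the bracket is twice the derivative term plus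
    three times the Hessian term, so the factor 8 becomes at most 24 on both.\<close>
  moreover have "0 \<le> wsq \<Gamma> (pdbar v f)" by (rule wsq_nonneg)
  ultimately show ?thesis unfolding wsq_pdbar_adj[OF f] by simp
qed

section \<open>Lower bounds for the complex Hessian\<close>

text \<open>The index \<open>g0\<close> isolates \<open>a\<close>, because its
  \<open>B\<close>-coefficient vanishes; domination then bounds every \<open>A g * a\<close> by the
  whole form. Subtracting it leaves \<open>B g * b\<close> with factor 4, and 1 + 4 = 5 per
  index.\<close>

lemma dominated_hessian:
  fixes A B :: "'i \<Rightarrow> complex"
  assumes G: "finite G" "g0 \<in> G" "B g0 = 0" "\<And>g. g \<in> G \<Longrightarrow> cmod (A g) \<le> cmod (A g0)"
  shows "(\<Sum>g\<in>G. (cmod (A g))\<^sup>2) * (cmod a)\<^sup>2 + (\<Sum>g\<in>G. (cmod (B g))\<^sup>2) * (cmod b)\<^sup>2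
    \<le> 5 * real (card G) * (\<Sum>g\<in>G. (cmod (A g * a + B g * b))\<^sup>2)"
proof -
  let ?H = "\<Sum>g\<in>G. (cmod (A g * a + B g * b))\<^sup>2"
  have le: "(cmod (A g * a + B g * b))\<^sup>2 \<le> ?H" if "g \<in> G" for g
    using G(1) that by (intro member_le_sum) auto
  have 1: "(cmod (A g * a))\<^sup>2 \<le> ?H" if "g \<in> G" for g
  proof -
    have "cmod (A g * a) \<le> cmod (A g0 * a)" using G(4)[OF that] by (auto simp: norm_mult intro: mult_right_mono)
    then have "(cmod (A g * a))\<^sup>2 \<le> (cmod (A g0 * a))\<^sup>2" by (intro power_mono) auto
    also have "\<dots> \<le> ?H" using le[OF G(2)] G(3) by simp
    finally show ?thesis .
  qed
  have 2: "(cmod (B g * b))\<^sup>2 \<le> 4 * ?H" if "g \<in> G" for g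
  proof -
    have "cmod (B g * b) \<le> cmod (A g * a + B g * b) + cmod (A g * a)"
      using norm_triangle_ineq4[of "A g * a + B g * b" "A g * a"] by simp
    then have "(cmod (B g * b))\<^sup>2 \<le> (cmod (A g * a + B g * b) + cmod (A g * a))\<^sup>2" by (intro power_mono) auto
    also have "\<dots> \<le> 2 * (cmod (A g * a + B g * b))\<^sup>2 + 2 * (cmod (A g * a))\<^sup>2"
      using zero_le_power2[of "cmod (A g * a + B g * b) - cmod (A g * a)"] by (simp add: power2_eq_square algebra_simps)
    also have "\<dots> \<le> 4 * ?H" using le[OF that] 1[OF that] by simp
    finally show ?thesis .
  qed
  have "(\<Sum>g\<in>G. (cmod (A g))\<^sup>2) * (cmod a)\<^sup>2 + (\<Sum>g\<in>G. (cmod (B g))\<^sup>2) * (cmod b)\<^sup>2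
    = (\<Sum>g\<in>G. (cmod (A g * a))\<^sup>2 + (cmod (B g * b))\<^sup>2)"
    by (simp add: sum.distrib sum_distrib_right norm_mult power_mult_distrib)
  also have "\<dots> \<le> (\<Sum>g\<in>G. 5 * ?H)" by (intro sum_mono) (use 1 2 in fastforce)
  also have "\<dots> = 5 * real (card G) * ?H" by simp
  finally show ?thesis .
qed

text \<open>Homogeneity reads \<open>m * \<beta> = (m - \<alpha>) * n\<close>, so raising
  \<open>y^n \<le> x^m\<close> to the power \<open>\<beta>\<close> and taking n-th roots gives
  \<open>y^\<beta> \<le> x^(m - \<alpha>)\<close>. The truncated exponent at
  \<open>\<alpha> = 0\<close> is harmless because its coefficient is 0.\<close>

lemma monomial_derivative_bound:
  fixes x y :: real
  assumes xy: "0 \<le> x" "0 \<le> y" "y ^ n \<le> x ^ m" and n: "1 \<le> n" "1 \<le> m" and ab: "n * \<alpha> + m * \<beta> = n * m"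
  shows "real \<alpha> * x ^ (\<alpha> - 1) * y ^ \<beta> \<le> real m * x ^ (m - 1)"
proof (cases "\<alpha> = 0")
  case False
  have "n * \<alpha> \<le> n * m" using ab by linarith
  then have am: "\<alpha> \<le> m" using n by simp
  have mb: "m * \<beta> = (m - \<alpha>) * n" using ab am by (simp add: algebra_simps diff_mult_distrib2)
  have "(y ^ \<beta>) ^ n = (y ^ n) ^ \<beta>" by (simp add: power_mult[symmetric] mult.commute)
  also have "\<dots> \<le> (x ^ m) ^ \<beta>" using xy by (intro power_mono) auto
  also have "\<dots> = (x ^ (m - \<alpha>)) ^ n" by (simp add: power_mult[symmetric] mb)
  finally have "y ^ \<beta> \<le> x ^ (m - \<alpha>)"
    using power_mono_iff[of "y ^ \<beta>" "x ^ (m - \<alpha>)" n] xy n by simp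
  then have "real \<alpha> * x ^ (\<alpha> - 1) * y ^ \<beta> \<le> real m * x ^ (\<alpha> - 1) * x ^ (m - \<alpha>)"
    using am xy by (intro mult_mono) auto
  also have "\<dots> = real m * x ^ (m - 1)"
    using False am by (simp add: mult.assoc power_add[symmetric])
  finally show ?thesis .
qed (use xy in auto)

text \<open>Comparing \<open>|z|^m\<close> with \<open>|w|^n\<close> decides which pure monomial
  plays the distinguished index of \<open>dominated_hessian\<close>: a pure power has zero
  derivative in the other variable.\<close>

lemma hessian_diagonal:
  assumes \<Gamma>: "finite \<Gamma>" "homogeneous \<Gamma>"
  shows "hess_diag \<Gamma> (1,0) p * (cmod a)\<^sup>2 + hess_diag \<Gamma> (0,1) p * (cmod b)\<^sup>2 \<le> 5 * real (card \<Gamma>) * hess_form \<Gamma> p a b"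
proof -
  obtain m n where mn: "m \<ge> 1" "n \<ge> 1" "(m, 0) \<in> \<Gamma>" "(0, n) \<in> \<Gamma>"
    and hom': "\<forall>(\<alpha>, \<beta>)\<in>\<Gamma>. n * \<alpha> + m * \<beta> = n * m"
    using \<Gamma>(2) unfolding homogeneous_def by blast
  have hom: "n * \<alpha> + m * \<beta> = n * m" if "(\<alpha>, \<beta>) \<in> \<Gamma>" for \<alpha> \<beta>
    using hom' that by auto
  consider "cmod (snd p) ^ n \<le> cmod (fst p) ^ m" | "cmod (fst p) ^ m \<le> cmod (snd p) ^ n" by linarith
  then show ?thesis
  proof cases
    case 1
    have "cmod (pd (1,0) (mono_fun \<gamma>) p) \<le> cmod (pd (1,0) (mono_fun (m,0)) p)" if "\<gamma> \<in> \<Gamma>" for \<gamma>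
    proof (cases \<gamma>)
      case (Pair \<alpha> \<beta>)
      with that monomial_derivative_bound[OF _ _ 1 mn(2,1) hom] show ?thesis
        by (simp add: pd_mono_fun norm_mult norm_power)
    qed
    then show ?thesis unfolding hess_diag_def hess_form_def
      by (intro dominated_hessian[OF \<Gamma>(1) mn(3)]) (auto simp: pd_mono_fun)
  next
    case 2
    have "cmod (pd (0,1) (mono_fun \<gamma>) p) \<le> cmod (pd (0,1) (mono_fun (0,n)) p)" if "\<gamma> \<in> \<Gamma>" for \<gamma>
    proof (cases \<gamma>)
      case (Pair \<alpha> \<beta>)
      have "m * \<beta> + n * \<alpha> = m * n" using hom that Pair by (simp add: algebra_simps)
      from monomial_derivative_bound[OF _ _ 2 mn(1,2) this] Pair show ?thesis
        by (simp add: pd_mono_fun norm_mult norm_power mult_ac)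
    qed
    then have "hess_diag \<Gamma> (0,1) p * (cmod b)\<^sup>2 + hess_diag \<Gamma> (1,0) p * (cmod a)\<^sup>2
      \<le> 5 * real (card \<Gamma>) * (\<Sum>\<gamma>\<in>\<Gamma>. (cmod (pd (0, 1) (mono_fun \<gamma>) p * b + pd (1, 0) (mono_fun \<gamma>) p * a))\<^sup>2)"
      unfolding hess_diag_def by (intro dominated_hessian[OF \<Gamma>(1) mn(4)]) (auto simp: pd_mono_fun)
    then show ?thesis unfolding hess_form_def by (simp add: add.commute)
  qed
qed

section \<open>Coercivity on smooth forms\<close>

definition mu :: "(nat \<times> nat) set \<Rightarrow> c2 \<Rightarrow> real" where
  "mu \<Gamma> p = 1 + rpow (cmod (fst p)) (sigma_exponent \<Gamma>) + rpow (cmod (snd p)) (tau_exponent \<Gamma>)"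

lemma rpow_nonneg: "0 \<le> rpow x s"
  by (simp add: rpow_def)

lemma continuous_rpow:
  assumes "0 \<le> s" "continuous_on UNIV f" "\<And>p. 0 \<le> f p"
  shows "continuous_on UNIV (\<lambda>p. rpow (f p) s)"
proof (cases "s = 0")
  case False
  then have "0 < s" using assms(1) by simp
  then have "continuous_on UNIV (\<lambda>p. f p powr s)"
    using assms by (intro continuous_on_powr' continuous_on_const) simp_all
  then show ?thesis using False by (simp add: rpow_def)
qed (simp add: rpow_def)

section \<open>The exponents \<open>sigma_exponent\<close> and \<open>tau_exponent\<close> against
  the Hessian\<close>

text \<open>A maximum over a finite nonempty set is realised by an actual mixed monomial, so the
  growth of \<open>mu\<close> can be compared with a single summand of the Hessian.\<close>

lemma exponent_attained:
  assumes \<Gamma>: "finite \<Gamma>" and nd: "\<not> decoupled \<Gamma>"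
  shows "\<exists>\<alpha> \<beta>. (\<alpha>, \<beta>) \<in> \<Gamma> \<and> \<alpha> \<noteq> 0 \<and> \<beta> \<noteq> 0 \<and> sigma_exponent \<Gamma> = real \<alpha> / real \<beta>"
    and "\<exists>\<alpha> \<beta>. (\<alpha>, \<beta>) \<in> \<Gamma> \<and> \<alpha> \<noteq> 0 \<and> \<beta> \<noteq> 0 \<and> tau_exponent \<Gamma> = real \<beta> / real \<alpha>"
proof -
  let ?S = "{real \<alpha> / real \<beta> | \<alpha> \<beta>. (\<alpha>, \<beta>) \<in> \<Gamma> \<and> \<alpha> \<noteq> 0 \<and> \<beta> \<noteq> 0}"
  let ?T = "{real \<beta> / real \<alpha> | \<alpha> \<beta>. (\<alpha>, \<beta>) \<in> \<Gamma> \<and> \<alpha> \<noteq> 0 \<and> \<beta> \<noteq> 0}"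
  have "finite ((\<lambda>(\<alpha>, \<beta>). real \<alpha> / real \<beta>) ` \<Gamma>)" using \<Gamma> by simp
  then have "finite ?S" by (rule rev_finite_subset) force
  moreover have "finite ((\<lambda>(\<alpha>, \<beta>). real \<beta> / real \<alpha>) ` \<Gamma>)" using \<Gamma> by simp
  then have "finite ?T" by (rule rev_finite_subset) force
  moreover have "?S \<noteq> {}" "?T \<noteq> {}" using nd unfolding decoupled_def by fastforce+
  ultimately have "Max ?S \<in> ?S" "Max ?T \<in> ?T" by (meson Max_in)+
  then show "\<exists>\<alpha> \<beta>. (\<alpha>, \<beta>) \<in> \<Gamma> \<and> \<alpha> \<noteq> 0 \<and> \<beta> \<noteq> 0 \<and> sigma_exponent \<Gamma> = real \<alpha> / real \<beta>"
    "\<exists>\<alpha> \<beta>. (\<alpha>, \<beta>) \<in> \<Gamma> \<and> \<alpha> \<noteq> 0 \<and> \<beta> \<noteq> 0 \<and> tau_exponent \<Gamma> = real \<beta> / real \<alpha>"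
    using nd unfolding sigma_exponent_def tau_exponent_def by auto
qed

lemma exponent_nonneg: "finite \<Gamma> \<Longrightarrow> 0 \<le> sigma_exponent \<Gamma>" "finite \<Gamma> \<Longrightarrow> 0 \<le> tau_exponent \<Gamma>"
  using exponent_attained[of \<Gamma>]
  by (cases "decoupled \<Gamma>"; force simp: sigma_exponent_def tau_exponent_def)+

lemma continuous_mu: "finite \<Gamma> \<Longrightarrow> continuous_on UNIV (mu \<Gamma>)"
  unfolding mu_def[abs_def] by (intro continuous_intros continuous_rpow exponent_nonneg) auto

text \<open>With \<open>T\<close> the squared power on the left,
  \<open>T^\<beta> = x^(2 * \<alpha>)\<close>. Hence the right side equals
  \<open>\<beta>^2 * T * (T * y^2)^(\<beta> - 1)\<close>, and every factor besides \<open>T\<close>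
  is at least 1.\<close>

lemma rpow_below_mixed_term:
  fixes x y :: real
  assumes xy: "0 \<le> x" "0 \<le> y" and ab: "\<alpha> \<noteq> 0" "\<beta> \<noteq> 0"
    and big: "1 \<le> (rpow x (real \<alpha> / real \<beta>))\<^sup>2 * y\<^sup>2"
  shows "(rpow x (real \<alpha> / real \<beta>))\<^sup>2 \<le> (real \<beta> * x ^ \<alpha> * y ^ (\<beta> - 1))\<^sup>2"
proof -
  define T where "T = (rpow x (real \<alpha> / real \<beta>))\<^sup>2"
  have r: "rpow x (real \<alpha> / real \<beta>) ^ \<beta> = x ^ \<alpha>"
  proof (cases "x = 0")
    case False
    then have "(x powr (real \<alpha> / real \<beta>)) ^ \<beta> = x powr (real \<alpha>)"
      using xy ab by (simp add: powr_realpow[symmetric] powr_powr)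
    then show ?thesis using False xy ab by (simp add: rpow_def powr_realpow)
  qed (use ab in \<open>simp add: rpow_def power_0_left\<close>)
  have T0: "0 \<le> T" by (simp add: T_def)
  have b1: "1 \<le> real \<beta> ^ 2" using ab by (intro one_le_power) simp
  have "T * 1 \<le> T * (T * y\<^sup>2) ^ (\<beta> - 1)"
    using big T0 by (intro mult_left_mono one_le_power) (auto simp: T_def)
  also have "\<dots> = T ^ \<beta> * (y ^ (\<beta> - 1))\<^sup>2"
    using ab by (cases \<beta>) (simp_all add: power_mult_distrib power_mult[symmetric] mult_ac)
  also have "T ^ \<beta> = (x ^ \<alpha>)\<^sup>2"
    unfolding T_def r[symmetric] by (simp add: power_mult[symmetric] mult.commute)
  also have "(x ^ \<alpha>)\<^sup>2 * (y ^ (\<beta> - 1))\<^sup>2 \<le> (real \<beta>)\<^sup>2 * ((x ^ \<alpha>)\<^sup>2 * (y ^ (\<beta> - 1))\<^sup>2)"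
    using mult_right_mono[OF b1, of "(x ^ \<alpha>)\<^sup>2 * (y ^ (\<beta> - 1))\<^sup>2"] by simp
  finally show ?thesis by (simp add: T_def power_mult_distrib mult_ac)
qed

text \<open>For \<open>y \<le> 1\<close> the power is at most 1; beyond 1 a larger exponent gives a
  larger power, and the exponent is at most \<open>n - 1\<close>.\<close>

lemma rpow_le_pure_term:
  fixes y :: real
  assumes "0 \<le> y" "0 \<le> s" "s \<le> real n - 1" "1 \<le> n"
  shows "(rpow y s)\<^sup>2 \<le> 1 + (real n * y ^ (n - 1))\<^sup>2"
proof (cases "y \<le> 1")
  case True
  have "rpow y s \<le> 1" using assms True by (simp add: rpow_def powr_le1)
  then have "(rpow y s)\<^sup>2 \<le> 1\<^sup>2" by (intro power_mono rpow_nonneg)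
  then show ?thesis by (simp add: add_increasing2)
next
  case False
  have "rpow y s = y powr s" using False by (simp add: rpow_def)
  also have "\<dots> \<le> y powr real (n - 1)" using assms False by (intro powr_mono) auto
  also have "\<dots> = y ^ (n - 1)" using False by (intro powr_realpow) simp
  also have "\<dots> \<le> real n * y ^ (n - 1)" using assms by (simp add: mult_le_cancel_right1)
  finally have "(rpow y s)\<^sup>2 \<le> (real n * y ^ (n - 1))\<^sup>2" by (intro power_mono rpow_nonneg)
  then show ?thesis by simp
qed

lemma hess_diag_ge: "finite \<Gamma> \<Longrightarrow> \<gamma> \<in> \<Gamma> \<Longrightarrow> (cmod (pd v (mono_fun \<gamma>) p))\<^sup>2 \<le> hess_diag \<Gamma> v p"
  unfolding hess_diag_def by (intro member_le_sum) auto

text \<open>In a mixed monomial both parts of \<open>n * \<alpha> + m * \<beta> = n * m\<close> are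
  positive, so \<open>\<alpha> < m\<close> and \<open>\<beta> < n\<close>; dividing by a positive
  integer only decreases the quotient.\<close>

lemma exponent_bounds:
  assumes \<Gamma>: "finite \<Gamma>" and mn: "m \<ge> 1" "n \<ge> 1"
    and hom: "\<And>\<alpha> \<beta>. (\<alpha>, \<beta>) \<in> \<Gamma> \<Longrightarrow> n * \<alpha> + m * \<beta> = n * m"
  shows "sigma_exponent \<Gamma> \<le> real m - 1" "tau_exponent \<Gamma> \<le> real n - 1"
proof -
  have *: "\<alpha> < m \<and> \<beta> < n" if "(\<alpha>, \<beta>) \<in> \<Gamma>" "\<alpha> \<noteq> 0" "\<beta> \<noteq> 0" for \<alpha> \<beta>
  proof -
    have "0 < n * \<alpha>" "0 < m * \<beta>" using that mn by auto
    then have "n * \<alpha> < n * m" "m * \<beta> < m * n" using hom[OF that(1)] mult.commute[of m n] by linarith+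
    then show ?thesis by simp
  qed
  show "sigma_exponent \<Gamma> \<le> real m - 1"
  proof (cases "decoupled \<Gamma>")
    case False
    from exponent_attained(1)[OF \<Gamma> this] obtain \<alpha> \<beta>
      where ab: "(\<alpha>, \<beta>) \<in> \<Gamma>" "\<alpha> \<noteq> 0" "\<beta> \<noteq> 0" and s: "sigma_exponent \<Gamma> = real \<alpha> / real \<beta>" by blast
    have "real \<alpha> / real \<beta> \<le> real \<alpha> / 1" using ab by (intro divide_left_mono) auto
    also have "\<dots> \<le> real m - 1" using *[OF ab] by simp
    finally show ?thesis by (simp add: s)
  qed (use mn in \<open>simp add: sigma_exponent_def\<close>)
  show "tau_exponent \<Gamma> \<le> real n - 1"
  proof (cases "decoupled \<Gamma>")
    case False
    from exponent_attained(2)[OF \<Gamma> this] obtain \<alpha> \<beta>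
      where ab: "(\<alpha>, \<beta>) \<in> \<Gamma>" "\<alpha> \<noteq> 0" "\<beta> \<noteq> 0" and s: "tau_exponent \<Gamma> = real \<beta> / real \<alpha>" by blast
    have "real \<beta> / real \<alpha> \<le> real \<beta> / 1" using ab by (intro divide_left_mono) auto
    also have "\<dots> \<le> real n - 1" using *[OF ab] by simp
    finally show ?thesis by (simp add: s)
  qed (use mn in \<open>simp add: tau_exponent_def\<close>)
qed

text \<open>\<open>scalar_uncertainty\<close> is used for \<open>T^2\<close> and again for the
  constant 1. Together with \<open>(1 + T + S)^2 \<le> 6 + 3 * T^2 + 3 * hess_diag\<close> this
  gives 6 * 24 + 3 * 24 + 3 = 219.\<close>

lemma weighted_norm_bound:
  fixes T S :: "c2 \<Rightarrow> real" and l :: "c2 \<Rightarrow> complex"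
  assumes f: "Ck (Suc (Suc 0)) f" "csupp f"
    and l: "bounded_linear l" "l v = 1" "l (imul v) = \<i>"
    and T: "continuous_on UNIV T" "\<And>p s. T (p + s *\<^sub>R v) = T p" "\<And>p s. T (p + s *\<^sub>R imul v) = T p"
    and big: "\<And>p. 1 \<le> (T p)\<^sup>2 * (cmod (l p))\<^sup>2 \<Longrightarrow> (T p)\<^sup>2 \<le> hess_diag \<Gamma> v p"
    and big1: "\<And>p. 1 \<le> (cmod (l p))\<^sup>2 \<Longrightarrow> 1 \<le> hess_diag \<Gamma> v p"
    and S: "continuous_on UNIV S" "\<And>p. (S p)\<^sup>2 \<le> 1 + hess_diag \<Gamma> v p"
  shows "(\<integral>p. (1 + T p + S p)\<^sup>2 * (cmod (f p))\<^sup>2 * wexp \<Gamma> p \<partial>lborel)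
    \<le> 219 * (wsq \<Gamma> (pdbar v f) + (\<integral>p. hess_diag \<Gamma> v p * (cmod (f p))\<^sup>2 * wexp \<Gamma> p \<partial>lborel))"
proof -
  let ?X = "wsq \<Gamma> (pdbar v f) + (\<integral>p. hess_diag \<Gamma> v p * (cmod (f p))\<^sup>2 * wexp \<Gamma> p \<partial>lborel)"
  have cf: "continuous_on UNIV f" by (rule Ck_imp_continuous[OF f(1)])
  have cT: "continuous_on UNIV (\<lambda>p. (T p)\<^sup>2)" by (intro continuous_intros T)
  have i: "integrable lborel (\<lambda>p. k p * (cmod (f p))\<^sup>2 * wexp \<Gamma> p)" if "continuous_on UNIV k" for k
    by (rule integrable_weighted_square[OF cf f(2) that])
  have 1: "(\<integral>p. (T p)\<^sup>2 * (cmod (f p))\<^sup>2 * wexp \<Gamma> p \<partial>lborel) \<le> 24 * ?X"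
    by (rule scalar_uncertainty[OF f l cT]) (use T big in auto)
  have 2: "(\<integral>p. 1 * (cmod (f p))\<^sup>2 * wexp \<Gamma> p \<partial>lborel) \<le> 24 * ?X"
    by (rule scalar_uncertainty[OF f l]) (use big1 in auto)
  have 3: "(1 + T p + S p)\<^sup>2 \<le> 6 * 1 + (3 * (T p)\<^sup>2 + 3 * hess_diag \<Gamma> v p)" for p
  proof -
    have "(1 + T p + S p)\<^sup>2 \<le> 3 * (1 + (T p)\<^sup>2 + (S p)\<^sup>2)"
      using zero_le_power2[of "1 - T p"] zero_le_power2[of "1 - S p"] zero_le_power2[of "T p - S p"]
      by (simp add: power2_eq_square algebra_simps)
    then show ?thesis using S(2)[of p] by simp
  qed
  have "(\<integral>p. (1 + T p + S p)\<^sup>2 * (cmod (f p))\<^sup>2 * wexp \<Gamma> p \<partial>lborel)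
    \<le> (\<integral>p. (6 * 1 + (3 * (T p)\<^sup>2 + 3 * hess_diag \<Gamma> v p)) * (cmod (f p))\<^sup>2 * wexp \<Gamma> p \<partial>lborel)"
    by (intro integral_mono i continuous_intros T S continuous_hess_diag mult_right_mono 3) (auto simp: less_imp_le[OF wexp_pos])
  also have "\<dots> = (\<integral>p. 6 * (1 * (cmod (f p))\<^sup>2 * wexp \<Gamma> p) + (3 * ((T p)\<^sup>2 * (cmod (f p))\<^sup>2 * wexp \<Gamma> p)
      + 3 * (hess_diag \<Gamma> v p * (cmod (f p))\<^sup>2 * wexp \<Gamma> p)) \<partial>lborel)"
    by (intro Bochner_Integration.integral_cong refl) (simp only: distrib_right mult.assoc)
  also have "\<dots> = 6 * (\<integral>p. 1 * (cmod (f p))\<^sup>2 * wexp \<Gamma> p \<partial>lborel) + (3 * (\<integral>p. (T p)\<^sup>2 * (cmod (f p))\<^sup>2 * wexp \<Gamma> p \<partial>lborel)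
      + 3 * (\<integral>p. hess_diag \<Gamma> v p * (cmod (f p))\<^sup>2 * wexp \<Gamma> p \<partial>lborel))"
    using i[OF continuous_on_const, of 1] i[OF cT] i[OF continuous_hess_diag, of \<Gamma> v] by simp
  also have "\<dots> \<le> 6 * (24 * ?X) + (3 * (24 * ?X) + 3 * ?X)"
  proof -
    have "0 \<le> wsq \<Gamma> (pdbar v f)" by (rule wsq_nonneg)
    then show ?thesis by (intro add_mono mult_left_mono 1 2) simp_all
  qed
  finally show ?thesis by simp
qed

definition smooth_coercive :: "(nat \<times> nat) set \<Rightarrow> real \<Rightarrow> bool" where
  "smooth_coercive \<Gamma> K \<longleftrightarrow> (\<forall>U1 U2. Ck (Suc (Suc 0)) U1 \<longrightarrow> csupp U1 \<longrightarrow> Ck (Suc (Suc 0)) U2 \<longrightarrow> csupp U2 \<longrightarrow>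
    (\<integral>p. (mu \<Gamma> p)\<^sup>2 * (cmod (U1 p))\<^sup>2 * wexp \<Gamma> p \<partial>lborel) + (\<integral>p. (mu \<Gamma> p)\<^sup>2 * (cmod (U2 p))\<^sup>2 * wexp \<Gamma> p \<partial>lborel)
    \<le> K * (wsq \<Gamma> (\<lambda>p. pdbar (1,0) U2 p - pdbar (0,1) U1 p) + wsq \<Gamma> (\<lambda>p. pdbar_adj \<Gamma> (1,0) U1 p + pdbar_adj \<Gamma> (0,1) U2 p)))"

lemma coercive_on_smooth_forms:
  assumes \<Gamma>: "finite \<Gamma>" "homogeneous \<Gamma>"
  shows "\<exists>K>0. smooth_coercive \<Gamma> K"
proof -
  define a b :: c2 where "a = (1,0)" and "b = (0,1)"
  obtain m n where mn: "m \<ge> 1" "n \<ge> 1" "(m, 0) \<in> \<Gamma>" "(0, n) \<in> \<Gamma>"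
    and hom': "\<forall>(\<alpha>, \<beta>)\<in>\<Gamma>. n * \<alpha> + m * \<beta> = n * m"
    using \<Gamma>(2) unfolding homogeneous_def by blast
  have hom: "n * \<alpha> + m * \<beta> = n * m" if "(\<alpha>, \<beta>) \<in> \<Gamma>" for \<alpha> \<beta>
    using hom' that by auto
  define T S where "T p = rpow (cmod (fst p)) (sigma_exponent \<Gamma>)" and "S p = rpow (cmod (snd p)) (tau_exponent \<Gamma>)" for p :: c2
  have cT: "continuous_on UNIV T" "continuous_on UNIV S"
    unfolding T_def[abs_def] S_def[abs_def] using exponent_nonneg[OF \<Gamma>(1)] by (auto intro!: continuous_rpow continuous_intros)
  have La: "(real m * cmod (fst p) ^ (m - 1))\<^sup>2 \<le> hess_diag \<Gamma> a p" for p
    using hess_diag_ge[OF \<Gamma>(1) mn(3), of a p] by (simp add: pd_mono_fun a_def norm_mult norm_power)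
  have Lb: "(real n * cmod (snd p) ^ (n - 1))\<^sup>2 \<le> hess_diag \<Gamma> b p" for p
    using hess_diag_ge[OF \<Gamma>(1) mn(4), of b p] by (simp add: pd_mono_fun b_def norm_mult norm_power)
  have one: "1 \<le> (real k * x ^ (k - 1))\<^sup>2" if "1 \<le> x\<^sup>2" "0 \<le> x" "1 \<le> k" for k and x :: real
  proof -
    have "1 \<le> x" using that by (metis one_power2 power2_le_imp_le)
    then have "1 * 1 \<le> real k * x ^ (k - 1)" using that by (intro mult_mono one_le_power) auto
    then show ?thesis by (simp add: one_le_power)
  qed
  \<comment> \<open>In the decoupled case there is no mixed monomial, but then \<open>T\<close> is 1
    and the pure power of w supplies an entry at least 1 where \<open>|w| \<ge> 1\<close>.\<close>
  have bigb: "(T p)\<^sup>2 \<le> hess_diag \<Gamma> b p" if "1 \<le> (T p)\<^sup>2 * (cmod (snd p))\<^sup>2" for p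
  proof (cases "decoupled \<Gamma>")
    case True
    then have "T p = 1" by (simp add: T_def rpow_def sigma_exponent_def)
    then show ?thesis using one[of "cmod (snd p)" n] that Lb[of p] mn by simp
  next
    case False
    from exponent_attained(1)[OF \<Gamma>(1) this] obtain \<alpha> \<beta>
      where ab: "(\<alpha>, \<beta>) \<in> \<Gamma>" "\<alpha> \<noteq> 0" "\<beta> \<noteq> 0" and s: "sigma_exponent \<Gamma> = real \<alpha> / real \<beta>" by blast
    have "(T p)\<^sup>2 \<le> (real \<beta> * cmod (fst p) ^ \<alpha> * cmod (snd p) ^ (\<beta> - 1))\<^sup>2"
      using rpow_below_mixed_term[OF _ _ ab(2,3)] that by (simp add: T_def s)
    also have "\<dots> \<le> hess_diag \<Gamma> b p"
      using hess_diag_ge[OF \<Gamma>(1) ab(1), of b p] by (simp add: pd_mono_fun b_def norm_mult norm_power)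
    finally show ?thesis .
  qed
  have biga: "(S p)\<^sup>2 \<le> hess_diag \<Gamma> a p" if "1 \<le> (S p)\<^sup>2 * (cmod (fst p))\<^sup>2" for p
  proof (cases "decoupled \<Gamma>")
    case True
    then have "S p = 1" by (simp add: S_def rpow_def tau_exponent_def)
    then show ?thesis using one[of "cmod (fst p)" m] that La[of p] mn by simp
  next
    case False
    from exponent_attained(2)[OF \<Gamma>(1) this] obtain \<alpha> \<beta>
      where ab: "(\<alpha>, \<beta>) \<in> \<Gamma>" "\<alpha> \<noteq> 0" "\<beta> \<noteq> 0" and s: "tau_exponent \<Gamma> = real \<beta> / real \<alpha>" by blast
    have "(S p)\<^sup>2 \<le> (real \<alpha> * cmod (snd p) ^ \<beta> * cmod (fst p) ^ (\<alpha> - 1))\<^sup>2"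
      using rpow_below_mixed_term[OF _ _ ab(3,2)] that by (simp add: S_def s)
    also have "\<dots> \<le> hess_diag \<Gamma> a p"
      using hess_diag_ge[OF \<Gamma>(1) ab(1), of a p] by (simp add: pd_mono_fun a_def norm_mult norm_power mult_ac)
    finally show ?thesis .
  qed
  have Sb: "(S p)\<^sup>2 \<le> 1 + hess_diag \<Gamma> b p" for p
    using rpow_le_pure_term[OF norm_ge_zero exponent_nonneg(2)[OF \<Gamma>(1)] exponent_bounds(2)[OF \<Gamma>(1) mn(1,2) hom] mn(2), of "snd p"] Lb[of p]
    by (simp add: S_def)
  have Ta: "(T p)\<^sup>2 \<le> 1 + hess_diag \<Gamma> a p" for p
    using rpow_le_pure_term[OF norm_ge_zero exponent_nonneg(1)[OF \<Gamma>(1)] exponent_bounds(1)[OF \<Gamma>(1) mn(1,2) hom] mn(1), of "fst p"] La[of p]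
    by (simp add: T_def)
  have one_a: "1 \<le> hess_diag \<Gamma> a p" if "1 \<le> (cmod (fst p))\<^sup>2" for p
    using one[OF that _ mn(1)] La[of p] by simp
  have one_b: "1 \<le> hess_diag \<Gamma> b p" if "1 \<le> (cmod (snd p))\<^sup>2" for p
    using one[OF that _ mn(2)] Lb[of p] by simp
  define C where "C = 5 * real (card \<Gamma>)"
  have C0: "0 \<le> C" by (simp add: C_def)
  show ?thesis unfolding smooth_coercive_def
  \<comment> \<open>On the right side the derivatives cost one copy of the energy and the Hessian
    terms cost \<open>C\<close> copies, both multiplied by 219.\<close>
  proof (intro exI[of _ "219 * (1 + C)"] conjI allI impI)
    show "0 < 219 * (1 + C)" using C0 by simp
    fix U1 U2
    assume U: "Ck (Suc (Suc 0)) U1" "csupp U1" "Ck (Suc (Suc 0)) U2" "csupp U2"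
    let ?E = "wsq \<Gamma> (\<lambda>p. pdbar (1,0) U2 p - pdbar (0,1) U1 p) + wsq \<Gamma> (\<lambda>p. pdbar_adj \<Gamma> (1,0) U1 p + pdbar_adj \<Gamma> (0,1) U2 p)"
    have c: "continuous_on UNIV U1" "continuous_on UNIV U2" using U Ck_imp_continuous by blast+
    have A: "(\<integral>p. (mu \<Gamma> p)\<^sup>2 * (cmod (U1 p))\<^sup>2 * wexp \<Gamma> p \<partial>lborel)
      \<le> 219 * (wsq \<Gamma> (pdbar a U1) + (\<integral>p. hess_diag \<Gamma> a p * (cmod (U1 p))\<^sup>2 * wexp \<Gamma> p \<partial>lborel))"
    proof -
      \<comment> \<open>For \<open>U1\<close> the active direction is z, so the multiplier that is
        constant along it is \<open>S\<close>, a function of w; \<open>T\<close> is left to the pure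
        monomial. For \<open>U2\<close> below the roles are exchanged.\<close>
      have "mu \<Gamma> = (\<lambda>p. 1 + S p + T p)" by (auto simp: mu_def S_def T_def)
      then show ?thesis
        by (simp only:) (rule weighted_norm_bound[OF U(1,2) bounded_linear_fst _ _ cT(2) _ _ biga one_a cT(1) Ta];
          simp add: a_def imul_def S_def)
    qed
    have B: "(\<integral>p. (mu \<Gamma> p)\<^sup>2 * (cmod (U2 p))\<^sup>2 * wexp \<Gamma> p \<partial>lborel)
      \<le> 219 * (wsq \<Gamma> (pdbar b U2) + (\<integral>p. hess_diag \<Gamma> b p * (cmod (U2 p))\<^sup>2 * wexp \<Gamma> p \<partial>lborel))"
    proof -
      have "mu \<Gamma> = (\<lambda>p. 1 + T p + S p)" by (auto simp: mu_def S_def T_def)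
      then show ?thesis
        by (simp only:) (rule weighted_norm_bound[OF U(3,4) bounded_linear_snd _ _ cT(1) _ _ bigb one_b cT(2) Sb];
          simp add: b_def imul_def T_def)
    qed
    have i1: "integrable lborel (\<lambda>p. hess_diag \<Gamma> a p * (cmod (U1 p))\<^sup>2 * wexp \<Gamma> p)"
      and i2: "integrable lborel (\<lambda>p. hess_diag \<Gamma> b p * (cmod (U2 p))\<^sup>2 * wexp \<Gamma> p)"
      by (rule integrable_weighted_square[OF _ _ continuous_hess_diag]; use c U in simp)+
    have iH: "integrable lborel (\<lambda>p. hess_form \<Gamma> p (U1 p) (U2 p) * wexp \<Gamma> p)"
    proof (rule integrable_csupp_real)
      show "continuous_on UNIV (\<lambda>p. hess_form \<Gamma> p (U1 p) (U2 p) * wexp \<Gamma> p)"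
        unfolding hess_form_def by (intro continuous_intros c continuous_wexp Ck_imp_continuous[OF Ck_pd_mono_fun])
      obtain R1 R2 where "\<forall>p. R1 < norm p \<longrightarrow> U1 p = 0" "\<forall>p. R2 < norm p \<longrightarrow> U2 p = 0"
        using U unfolding csupp_def by blast
      then show "csupp (\<lambda>p. complex_of_real (hess_form \<Gamma> p (U1 p) (U2 p) * wexp \<Gamma> p))"
        unfolding csupp_def hess_form_def by (intro exI[of _ "max R1 R2"]) auto
    qed
    have "(\<integral>p. hess_diag \<Gamma> a p * (cmod (U1 p))\<^sup>2 * wexp \<Gamma> p \<partial>lborel) + (\<integral>p. hess_diag \<Gamma> b p * (cmod (U2 p))\<^sup>2 * wexp \<Gamma> p \<partial>lborel)
      = (\<integral>p. hess_diag \<Gamma> a p * (cmod (U1 p))\<^sup>2 * wexp \<Gamma> p + hess_diag \<Gamma> b p * (cmod (U2 p))\<^sup>2 * wexp \<Gamma> p \<partial>lborel)"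
      using i1 i2 by simp
    also have "\<dots> \<le> (\<integral>p. C * (hess_form \<Gamma> p (U1 p) (U2 p) * wexp \<Gamma> p) \<partial>lborel)"
    proof (intro integral_mono Bochner_Integration.integrable_add i1 i2 integrable_mult_right iH)
      fix p
      show "hess_diag \<Gamma> a p * (cmod (U1 p))\<^sup>2 * wexp \<Gamma> p + hess_diag \<Gamma> b p * (cmod (U2 p))\<^sup>2 * wexp \<Gamma> p \<le> C * (hess_form \<Gamma> p (U1 p) (U2 p) * wexp \<Gamma> p)"
        using mult_right_mono[OF hessian_diagonal[OF \<Gamma>, of p "U1 p" "U2 p"] less_imp_le[OF wexp_pos[of \<Gamma> p]]]
        by (simp add: a_def b_def C_def algebra_simps)
    qed
    also have "\<dots> = C * (\<integral>p. hess_form \<Gamma> p (U1 p) (U2 p) * wexp \<Gamma> p \<partial>lborel)" by simp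
    finally have D: "(\<integral>p. hess_diag \<Gamma> a p * (cmod (U1 p))\<^sup>2 * wexp \<Gamma> p \<partial>lborel) + (\<integral>p. hess_diag \<Gamma> b p * (cmod (U2 p))\<^sup>2 * wexp \<Gamma> p \<partial>lborel)
      \<le> C * (\<integral>p. hess_form \<Gamma> p (U1 p) (U2 p) * wexp \<Gamma> p \<partial>lborel)" .
    have H0: "0 \<le> (\<integral>p. hess_form \<Gamma> p (U1 p) (U2 p) * wexp \<Gamma> p \<partial>lborel)"
      by (intro Bochner_Integration.integral_nonneg mult_nonneg_nonneg less_imp_le[OF wexp_pos]) (auto simp: hess_form_def intro!: sum_nonneg)
    have E: "?E = wsq \<Gamma> (pdbar a U1) + wsq \<Gamma> (pdbar b U1) + wsq \<Gamma> (pdbar a U2) + wsq \<Gamma> (pdbar b U2)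
      + 2 * (\<integral>p. hess_form \<Gamma> p (U1 p) (U2 p) * wexp \<Gamma> p \<partial>lborel)"
      unfolding a_def b_def by (rule kohn_identity[OF U])
    define W where "W = ?E"
    have nn: "0 \<le> wsq \<Gamma> (pdbar v f)" for v f by (rule wsq_nonneg)
    \<comment> \<open>The derivatives of \<open>U1\<close> along \<open>b\<close> and of
      \<open>U2\<close> along \<open>a\<close> are nonnegative terms of the Kohn identity and are
      discarded.\<close>
    have 1: "wsq \<Gamma> (pdbar a U1) + wsq \<Gamma> (pdbar b U2) \<le> W"
      unfolding W_def E using nn[of b U1] nn[of a U2] H0 by linarith
    have "(\<integral>p. hess_form \<Gamma> p (U1 p) (U2 p) * wexp \<Gamma> p \<partial>lborel) \<le> W"
      unfolding W_def E using nn[of b U1] nn[of a U2] nn[of a U1] nn[of b U2] H0 by linarith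
    then have 2: "C * (\<integral>p. hess_form \<Gamma> p (U1 p) (U2 p) * wexp \<Gamma> p \<partial>lborel) \<le> C * W"
      using C0 by (rule mult_left_mono)
    have eq: "219 * (1 + C) * W = 219 * (W + C * W)" by (simp add: algebra_simps)
    have arith: "x + y \<le> 219 * (w + d)" if "x \<le> 219 * (n1 + l1)" "y \<le> 219 * (n2 + l2)" "l1 + l2 \<le> k" "n1 + n2 \<le> w" "k \<le> d"
      for x y w d n1 n2 l1 l2 k :: real
      using that unfolding distrib_left by linarith
    show "(\<integral>p. (mu \<Gamma> p)\<^sup>2 * (cmod (U1 p))\<^sup>2 * wexp \<Gamma> p \<partial>lborel) + (\<integral>p. (mu \<Gamma> p)\<^sup>2 * (cmod (U2 p))\<^sup>2 * wexp \<Gamma> p \<partial>lborel)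
      \<le> 219 * (1 + C) * ?E"
      unfolding W_def[symmetric] eq by (rule arith[OF A B D 1 2])
  qed
qed

section \<open>Mollifiers\<close>

text \<open>The classical flat function divided by powers of its argument. The family is closed
  under differentiation up to linear combinations, so smoothness of all orders follows by one
  induction with \<open>j\<close> arbitrary.\<close>

definition flat :: "nat \<Rightarrow> real \<Rightarrow> real" where
  "flat j x = (if 0 < x then exp (- 1 / x) / x ^ j else 0)"

lemma flat_nonneg: "0 \<le> flat j x"
  by (simp add: flat_def)

text \<open>Comes from \<open>exp (1 / x) \<ge> (1 / (n * x))^n\<close> with
  \<open>n = j + 2\<close>, the power that leaves \<open>x^2\<close> after division by
  \<open>x^j\<close>. A quadratic bound makes the derivative at 0 exist and vanish.\<close>

lemma flat_le_square: "flat j x \<le> real (j + 2) ^ (j + 2) * x\<^sup>2"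
proof (cases "0 < x")
  case True
  define n where "n = j + 2"
  have n: "n > 0" by (simp add: n_def)
  have "(1 + (1 / x) / real n) ^ n \<le> exp (1 / x)"
    using True n by (intro exp_ge_one_plus_x_over_n_power_n) (auto intro: order_trans[of _ 0])
  moreover have "((1 / x) / real n) ^ n \<le> (1 + (1 / x) / real n) ^ n"
    using True by (intro power_mono) auto
  ultimately have "1 / (x ^ n * real n ^ n) \<le> exp (1 / x)"
    by (simp add: power_divide power_mult_distrib)
  then have "1 \<le> exp (1 / x) * (x ^ n * real n ^ n)"
    using True n by (subst (asm) pos_divide_le_eq) auto
  then have "exp (- (1 / x)) * 1 \<le> exp (- (1 / x)) * (exp (1 / x) * (x ^ n * real n ^ n))"
    by (rule mult_left_mono) simp
  also have "\<dots> = x ^ n * real n ^ n"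
    by (simp add: mult.assoc[symmetric] exp_add[symmetric])
  finally have "exp (- (1 / x)) \<le> (real n ^ n * x\<^sup>2) * x ^ j"
    by (simp add: n_def power_add power2_eq_square mult_ac)
  then show ?thesis using True by (simp add: flat_def pos_divide_le_eq n_def)
qed (simp add: flat_def)

lemma flat_has_real_derivative:
  "(flat j has_real_derivative (flat (j + 2) x - real j * flat (j + 1) x)) (at x)"
proof -
  consider "0 < x" | "x < 0" | "x = 0" by linarith
  then show ?thesis
  proof cases
    case 1
    have "((\<lambda>x. exp (- 1 / x) / x ^ j) has_real_derivative (flat (j + 2) x - real j * flat (j + 1) x)) (at x)"
    proof -
      have "((\<lambda>x. exp (- 1 / x) / x ^ j) has_real_derivative
          (exp (- 1 / x) * (1 / x\<^sup>2) * x ^ j - exp (- 1 / x) * (real j * x ^ (j - 1))) / (x ^ j * x ^ j)) (at x)"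
        using 1 by (auto intro!: derivative_eq_intros simp: power2_eq_square)
      also have "(exp (- 1 / x) * (1 / x\<^sup>2) * x ^ j - exp (- 1 / x) * (real j * x ^ (j - 1))) / (x ^ j * x ^ j)
          = flat (j + 2) x - real j * flat (j + 1) x"
        using 1 by (cases j) (simp_all add: flat_def field_simps power2_eq_square)
      finally show ?thesis .
    qed
    then show ?thesis
      by (rule DERIV_cong_ev[OF refl _ refl, THEN iffD1, rotated])
        (use 1 in \<open>auto simp: flat_def eventually_nhds intro!: exI[of _ "{0<..}"]\<close>)
  next
    case 2
    have "((\<lambda>x. 0) has_real_derivative (flat (j + 2) x - real j * flat (j + 1) x)) (at x)"
      using 2 by (simp add: flat_def)
    then show ?thesis
      by (rule DERIV_cong_ev[OF refl _ refl, THEN iffD1, rotated])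
        (use 2 in \<open>auto simp: flat_def eventually_nhds intro!: exI[of _ "{..<0}"]\<close>)
  next
    case 3
    let ?C = "real (j + 2) ^ (j + 2)"
    have "((\<lambda>h. flat j h / h) \<longlongrightarrow> 0) (at 0)"
    proof (rule Lim_null_comparison)
      have "norm (flat j h / h) \<le> ?C * \<bar>h\<bar>" if "h \<noteq> 0" for h
      proof -
        have "flat j h \<le> ?C * \<bar>h\<bar> * \<bar>h\<bar>" using flat_le_square[of j h] by (simp add: power2_eq_square mult.assoc)
        then show ?thesis using that flat_nonneg[of j h] by (simp add: pos_divide_le_eq)
      qed
      then show "\<forall>\<^sub>F h in at 0. norm (flat j h / h) \<le> ?C * \<bar>h\<bar>" by (auto simp: eventually_at_filter)
      show "((\<lambda>h. ?C * \<bar>h\<bar>) \<longlongrightarrow> 0) (at 0)" by (auto intro!: tendsto_eq_intros)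
    qed
    then show ?thesis using 3 by (simp add: DERIV_def flat_def)
  qed
qed

text \<open>The squared norm keeps the function smooth at the origin, \<open>1 / sqrt k\<close> is
  the radius of the support, and \<open>j\<close> is carried along so that derivatives are again
  bumps times linear functions.\<close>

definition bump :: "nat \<Rightarrow> real \<Rightarrow> c2 \<Rightarrow> real" where
  "bump j k p = flat j (1 - k * (norm p)\<^sup>2)"

lemma bump_has_derivative:
  "((\<lambda>p. complex_of_real (bump j k p)) has_derivative
    (\<lambda>v. complex_of_real (bump (j + 2) k p - real j * bump (j + 1) k p) * complex_of_real (- 2 * k * (p \<bullet> v)))) (at p)"
proof -
  have "((\<lambda>p::c2. 1 - k * (p \<bullet> p)) has_derivative (\<lambda>v. - 2 * k * (p \<bullet> v))) (at p)"
    by (auto intro!: derivative_eq_intros simp: inner_commute algebra_simps)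
  then have "((\<lambda>p::c2. 1 - k * (norm p)\<^sup>2) has_derivative (\<lambda>v. - 2 * k * (p \<bullet> v))) (at p)"
    by (simp add: power2_norm_eq_inner)
  from diff_chain_at[OF this flat_has_real_derivative[unfolded has_field_derivative_def]]
  have "(bump j k has_derivative (\<lambda>v. (bump (j + 2) k p - real j * bump (j + 1) k p) * (- 2 * k * (p \<bullet> v)))) (at p)"
    by (simp add: o_def bump_def[abs_def])
  from bounded_linear.has_derivative[OF bounded_linear_of_real this]
  show ?thesis by simp
qed

lemma Ck_inner: "Ck n (\<lambda>p. complex_of_real (p \<bullet> v))"
  by (rule Ck_linear) (intro bounded_linear_compose[OF bounded_linear_of_real] bounded_linear_inner_left)

lemma Ck_bump: "Ck n (\<lambda>p. complex_of_real (bump j k p))"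
proof (induction n arbitrary: j)
  case 0
  then show ?case
    by (simp only: Ck.simps(1)) (intro continuous_at_imp_continuous_on ballI has_derivative_continuous[OF bump_has_derivative])
next
  case (Suc n)
  have "dd (\<lambda>p. complex_of_real (bump j k p)) v =
      (\<lambda>p. (complex_of_real (bump (j + 2) k p) - of_nat j * complex_of_real (bump (j + 1) k p)) * (complex_of_real (- 2 * k) * complex_of_real (p \<bullet> v)))" for v
    by (intro ext) (simp add: dd_eq[OF bump_has_derivative])
  moreover have "Ck n (\<lambda>p. (complex_of_real (bump (j + 2) k p) - of_nat j * complex_of_real (bump (j + 1) k p)) * (complex_of_real (- 2 * k) * complex_of_real (p \<bullet> v)))" for v
    by (intro Ck_intros Suc.IH Ck_inner)
  moreover have "(\<lambda>p. complex_of_real (bump j k p)) differentiable (at p)" for p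
    by (rule differentiableI[OF bump_has_derivative])
  ultimately show ?case by simp
qed

lemma bump_nonneg: "0 \<le> bump j k p"
  by (simp add: bump_def flat_nonneg)

lemma bump_eq_0: "1 \<le> k * (norm p)\<^sup>2 \<Longrightarrow> bump j k p = 0"
  by (simp add: bump_def flat_def)

lemma continuous_bump: "continuous_on UNIV (bump j k)"
proof -
  have "continuous_on UNIV (\<lambda>p. Re (complex_of_real (bump j k p)))"
    by (intro continuous_intros Ck_imp_continuous[OF Ck_bump])
  then show ?thesis by simp
qed

lemma csupp_bump: "0 < k \<Longrightarrow> csupp (\<lambda>p. complex_of_real (bump j k p))"
  unfolding csupp_def
proof (intro exI[of _ "1 / sqrt k"] allI impI)
  fix p :: c2 assume k: "0 < k" and "1 / sqrt k < norm p"
  then have "(1 / sqrt k)\<^sup>2 \<le> (norm p)\<^sup>2" by (intro power_mono) auto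
  then have "1 \<le> k * (norm p)\<^sup>2" using k by (simp add: power_divide pos_divide_le_eq mult.commute)
  then show "complex_of_real (bump j k p) = 0" by (simp add: bump_eq_0)
qed

text \<open>A vanishing integral would make the open set where the continuous bump is nonzero
  negligible, hence empty; but it contains the origin.\<close>

lemma integral_bump_pos:
  assumes "0 < k"
  shows "0 < (\<integral>p. bump 0 k p \<partial>lborel)"
proof -
  have int: "integrable lborel (bump 0 k)"
    by (rule integrable_csupp_real[OF continuous_bump csupp_bump[OF assms]])
  have "0 \<le> (\<integral>p. bump 0 k p \<partial>lborel)"
    by (intro Bochner_Integration.integral_nonneg bump_nonneg)
  moreover have "(\<integral>p. bump 0 k p \<partial>lborel) \<noteq> 0"
  proof
    assume "(\<integral>p. bump 0 k p \<partial>lborel) = 0"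
    then have "AE p in lborel. bump 0 k p = 0"
      using integral_nonneg_eq_0_iff_AE[OF int] bump_nonneg by auto
    moreover have "open {p. bump 0 k p \<noteq> 0}"
      by (intro open_Collect_neq continuous_bump continuous_on_const)
    ultimately have "negligible {p. bump 0 k p \<noteq> 0}"
      by (subst (asm) AE_iff_null) (auto simp: negligible_iff_null_sets intro: null_sets_completionI)
    then have "{p. bump 0 k p \<noteq> 0} = {}"
      using open_not_negligible \<open>open _\<close> by blast
    moreover have "bump 0 k 0 \<noteq> 0" by (simp add: bump_def flat_def)
    ultimately show False by blast
  qed
  ultimately show ?thesis by simp
qed

definition rho :: "nat \<Rightarrow> c2 \<Rightarrow> real" where
  "rho n p = bump 0 ((real n + 1)\<^sup>2) p / (\<integral>p. bump 0 ((real n + 1)\<^sup>2) p \<partial>lborel)"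

lemma rho_nonneg: "0 \<le> rho n p"
  unfolding rho_def by (intro divide_nonneg_nonneg bump_nonneg Bochner_Integration.integral_nonneg)

lemma rho_eq_0: "1 / (real n + 1) \<le> norm p \<Longrightarrow> rho n p = 0"
proof -
  assume "1 / (real n + 1) \<le> norm p"
  then have "1 \<le> (real n + 1) * norm p" by (simp add: pos_divide_le_eq add_nonneg_pos mult.commute)
  then have "1\<^sup>2 \<le> ((real n + 1) * norm p)\<^sup>2" by (intro power_mono) auto
  then show ?thesis by (simp add: rho_def bump_eq_0 power_mult_distrib)
qed

lemma rho_eq: "rho n p = inverse (\<integral>p. bump 0 ((real n + 1)\<^sup>2) p \<partial>lborel) * bump 0 ((real n + 1)\<^sup>2) p"
  by (simp add: rho_def divide_inverse)

lemma Ck_rho: "Ck k (\<lambda>p. complex_of_real (rho n p))"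
  unfolding rho_eq of_real_mult by (intro Ck_cmult Ck_bump)

lemma continuous_rho: "continuous_on UNIV (rho n)"
  unfolding rho_eq[abs_def] by (intro continuous_intros continuous_bump)

lemma csupp_rho: "csupp (\<lambda>p. complex_of_real (rho n p))"
  unfolding csupp_def using rho_eq_0 by (intro exI[of _ "1 / (real n + 1)"]) (auto intro: less_imp_le)

lemma integral_rho: "(\<integral>p. rho n p \<partial>lborel) = 1"
  using integral_bump_pos[of "(real n + 1)\<^sup>2"] unfolding rho_def by (simp add: add_nonneg_pos)

section \<open>Test functions and reflected kernels\<close>

lemma test_functionI: "(\<And>k. Ck k \<psi>) \<Longrightarrow> csupp \<psi> \<Longrightarrow> test_function \<psi>"
proof -
  assume C: "\<And>k. Ck k \<psi>" and "csupp \<psi>"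
  then obtain R where "\<And>p. R < norm p \<Longrightarrow> \<psi> p = 0" unfolding csupp_def by blast
  then have "{p. \<psi> p \<noteq> 0} \<subseteq> cball 0 R" by (auto simp: not_less[symmetric])
  then have "bounded {p. \<psi> p \<noteq> 0}" using bounded_cball bounded_subset by blast
  then show ?thesis using C unfolding test_function_def by simp
qed

lemma test_function_csupp: "test_function \<psi> \<Longrightarrow> csupp \<psi>"
proof -
  assume "test_function \<psi>"
  then have "bounded (closure {p. \<psi> p \<noteq> 0})" unfolding test_function_def by (simp add: compact_imp_bounded)
  then have "bounded {p. \<psi> p \<noteq> 0}" using bounded_subset closure_subset by blast
  then obtain R where "\<And>p. \<psi> p \<noteq> 0 \<Longrightarrow> norm p \<le> R" unfolding bounded_iff by blast
  then show ?thesis unfolding csupp_def by (intro exI[of _ R]) force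
qed

lemma reflect_has_derivative:
  assumes "\<psi> differentiable (at (p - q))"
  shows "((\<lambda>q. \<psi> (p - q)) has_derivative (\<lambda>v. - dd \<psi> v (p - q))) (at q)"
proof -
  have "((\<lambda>q::c2. p - q) has_derivative (\<lambda>v. - v)) (at q)" by (auto intro!: derivative_eq_intros)
  from diff_chain_at[OF this differentiable_has_dd[OF assms]]
  show ?thesis using linear_neg[OF linear_frechet_derivative[OF assms]] by (simp add: o_def)
qed

lemma Ck_reflect: "Ck k \<psi> \<Longrightarrow> Ck k (\<lambda>q. \<psi> (p - q))"
proof (induction k arbitrary: \<psi>)
  case 0
  then show ?case by (auto intro!: continuous_on_compose2[of UNIV \<psi>] continuous_intros)
next
  case (Suc k)
  then have d: "\<psi> differentiable (at q)" for q by simp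
  have "dd (\<lambda>q. \<psi> (p - q)) v = (\<lambda>q. - dd \<psi> v (p - q))" for v
    by (intro ext dd_eq[OF reflect_has_derivative[OF d]])
  moreover have "Ck k (\<lambda>q. - dd \<psi> v (p - q))" for v
    by (intro Ck_uminus Suc.IH Ck_dd Suc.prems)
  ultimately show ?case using differentiableI[OF reflect_has_derivative[OF d]] by simp
qed

lemma csupp_reflect: "csupp \<psi> \<Longrightarrow> csupp (\<lambda>q. \<psi> (p - q))"
proof -
  assume "csupp \<psi>"
  then obtain R where R: "\<And>p. R < norm p \<Longrightarrow> \<psi> p = 0" unfolding csupp_def by blast
  show ?thesis unfolding csupp_def
  proof (intro exI[of _ "R + norm p"] allI impI)
    fix q :: c2 assume "R + norm p < norm q"
    then have "R < norm (p - q)" using norm_triangle_ineq2[of q p] by (simp add: norm_minus_commute)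
    then show "\<psi> (p - q) = 0" by (rule R)
  qed
qed

lemma pdbar_reflect: "\<psi> differentiable (at (p - q)) \<Longrightarrow> pdbar v (\<lambda>q. \<psi> (p - q)) q = - pdbar v \<psi> (p - q)"
  by (simp add: pdbar_def dd_eq[OF reflect_has_derivative] field_simps)

section \<open>Convolution with smooth compactly supported kernels\<close>

definition locint :: "(c2 \<Rightarrow> complex) \<Rightarrow> bool" where
  "locint f \<longleftrightarrow> f \<in> borel_measurable borel \<and> (\<forall>R. integrable lborel (\<lambda>p. indicator (cball 0 R) p *\<^sub>R f p))"

definition conv :: "(c2 \<Rightarrow> complex) \<Rightarrow> (c2 \<Rightarrow> complex) \<Rightarrow> c2 \<Rightarrow> complex" where
  "conv f \<psi> p = (\<integral>q. f q * \<psi> (p - q) \<partial>lborel)"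

lemma integrable_mult_bounded:
  fixes f g :: "c2 \<Rightarrow> complex"
  assumes "integrable lborel f" "g \<in> borel_measurable borel" "\<And>p. norm (g p) \<le> B"
  shows "integrable lborel (\<lambda>p. f p * g p)"
proof (rule Bochner_Integration.integrable_bound)
  show "integrable lborel (\<lambda>p. B * norm (f p))" using assms(1) by simp
  show "(\<lambda>p. f p * g p) \<in> borel_measurable lborel" using assms by (auto intro: borel_measurable_integrable)
  have "norm (f p * g p) \<le> B * norm (f p)" for p
    using mult_right_mono[OF assms(3)[of p], of "norm (f p)"] by (simp add: norm_mult mult.commute)
  then show "AE p in lborel. norm (f p * g p) \<le> norm (B * norm (f p))"
    by (intro AE_I2) (metis order_trans real_norm_def abs_ge_self)
qed

lemma locint_mult_integrable:
  assumes f: "locint f" and g: "continuous_on UNIV g" "csupp g"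
  shows "integrable lborel (\<lambda>p. f p * g p)"
proof -
  obtain R where R: "\<And>p. R < norm p \<Longrightarrow> g p = 0" using g(2) unfolding csupp_def by blast
  obtain B where B: "\<And>p. norm (g p) \<le> B" using csupp_bounded[OF g] by blast
  have "integrable lborel (\<lambda>p. (indicator (cball 0 R) p *\<^sub>R f p) * g p)"
    using f g B by (intro integrable_mult_bounded) (auto simp: locint_def intro: borel_measurable_continuous_onI)
  also have "(\<lambda>p. (indicator (cball 0 R) p *\<^sub>R f p) * g p) = (\<lambda>p. f p * g p)"
  proof
    fix p show "(indicator (cball 0 R) p *\<^sub>R f p) * g p = f p * g p"
      using R[of p] by (cases "norm p \<le> R") (auto simp: indicator_def)
  qed
  finally show ?thesis .
qed

lemma integrable_conv:
  "locint f \<Longrightarrow> continuous_on UNIV \<psi> \<Longrightarrow> csupp \<psi> \<Longrightarrow> integrable lborel (\<lambda>q. f q * \<psi> (p - q))"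
  by (rule locint_mult_integrable) (auto intro!: csupp_reflect continuous_on_compose2[of UNIV \<psi>] continuous_intros)

text \<open>Each of the finitely many basis directions has a bounded derivative by compact support,
  and linearity extends this to all directions. Uniformity in the point as well makes the bound a
  global Lipschitz constant, usable for domination.\<close>

lemma dd_bounded:
  assumes \<psi>: "Ck (Suc 0) \<psi>" "csupp \<psi>"
  shows "\<exists>B\<ge>0. \<forall>v p. norm (dd \<psi> v p) \<le> B * norm v"
proof -
  have d: "\<psi> differentiable (at p)" for p using \<psi> by simp
  have "\<exists>B\<ge>0. \<forall>p. norm (dd \<psi> b p) \<le> B" for b
    by (rule csupp_bounded) (use \<psi> csupp_dd[OF \<psi>] in auto)
  then obtain B where B: "\<And>b. B b \<ge> 0" "\<And>b p. norm (dd \<psi> b p) \<le> B b" by metis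
  have "norm (dd \<psi> v p) \<le> (\<Sum>b\<in>Basis. B b) * norm v" for v p
  proof -
    have lin: "linear (\<lambda>v. dd \<psi> v p)" using linear_frechet_derivative[OF d] .
    have "dd \<psi> v p = dd \<psi> (\<Sum>b\<in>Basis. (v \<bullet> b) *\<^sub>R b) p" by (simp only: euclidean_representation)
    also have "\<dots> = (\<Sum>b\<in>Basis. (v \<bullet> b) *\<^sub>R dd \<psi> b p)" by (simp add: linear_sum[OF lin] linear_scale[OF lin])
    also have "norm \<dots> \<le> (\<Sum>b\<in>Basis. B b * norm v)"
    proof (intro order_trans[OF norm_sum] sum_mono)
      fix b :: c2 assume "b \<in> Basis"
      then have "\<bar>v \<bullet> b\<bar> \<le> norm v" by (rule Basis_le_norm)
      then show "norm ((v \<bullet> b) *\<^sub>R dd \<psi> b p) \<le> B b * norm v"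
        using mult_mono[OF _ B(2)[of p b], of "\<bar>v \<bullet> b\<bar>" "norm v"] by (simp add: mult.commute)
    qed
    finally show ?thesis by (simp add: sum_distrib_right)
  qed
  then show ?thesis using B(1) by (intro exI[of _ "\<Sum>b\<in>Basis. B b"]) (auto intro: sum_nonneg)
qed

text \<open>Differentiation under the integral by dominated convergence: the increment of
  \<open>\<psi>\<close> and its linear part each contribute at most \<open>B * norm x\<close>,
  whence the dominating function \<open>2 * B * norm (g q)\<close>. Sequences tending to 0 replace
  the full limit for that purpose.\<close>

lemma conv_has_derivative_integrable:
  assumes g: "integrable lborel g" and \<psi>: "Ck (Suc 0) \<psi>" "csupp \<psi>"
  shows "(conv g \<psi> has_derivative (\<lambda>v. conv g (dd \<psi> v) p)) (at p)"
proof -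
  have d: "\<psi> differentiable (at p)" for p using \<psi> by simp
  obtain B where B: "B \<ge> 0" "\<And>v p. norm (dd \<psi> v p) \<le> B * norm v" using dd_bounded[OF \<psi>] by blast
  have c\<psi>: "continuous_on UNIV \<psi>" by (rule Ck_imp_continuous[OF \<psi>(1)])
  obtain B0 where B0: "\<And>p. norm (\<psi> p) \<le> B0" using csupp_bounded[OF c\<psi> \<psi>(2)] by blast
  have cd: "continuous_on UNIV (dd \<psi> v)" for v using \<psi> by simp
  have meas: "(\<lambda>q. \<psi> (x - q)) \<in> borel_measurable borel" "(\<lambda>q. dd \<psi> v (x - q)) \<in> borel_measurable borel" for x v
    by (intro borel_measurable_continuous_onI continuous_on_compose2[OF c\<psi>] continuous_on_compose2[OF cd] continuous_intros; simp)+
  have i1: "integrable lborel (\<lambda>q. g q * \<psi> (x - q))" for x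
    by (rule integrable_mult_bounded[OF g meas(1)]) (rule B0)
  have i2: "integrable lborel (\<lambda>q. g q * dd \<psi> v (x - q))" for x v
    by (rule integrable_mult_bounded[OF g meas(2)]) (rule B)
  have lin: "linear (\<lambda>v. dd \<psi> v y)" for y using linear_frechet_derivative[OF d] .
  have "linear (\<lambda>v. conv g (dd \<psi> v) p)"
    unfolding conv_def
    by (rule linearI) (simp_all add: linear_add[OF lin] linear_scale[OF lin] distrib_left i2)
  then have bl: "bounded_linear (\<lambda>v. conv g (dd \<psi> v) p)" by (simp add: linear_conv_bounded_linear)
  have lip: "norm (\<psi> (y + x) - \<psi> y) \<le> B * norm x" for x y
  proof -
    have "norm (\<psi> (y + 1 *\<^sub>R x) - \<psi> (y + 0 *\<^sub>R x)) \<le> 1 * (B * norm x)"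
      by (rule vector_derivative_bound[OF _ line_has_vector_derivative[OF d]]) (use B in auto)
    then show ?thesis by simp
  qed
  have "((\<lambda>x. norm (conv g \<psi> (p + x) - conv g \<psi> p - conv g (dd \<psi> x) p) / norm x) \<longlongrightarrow> 0) (at 0)"
    unfolding tendsto_at_iff_sequentially
  proof (intro allI impI)
    fix X :: "nat \<Rightarrow> c2"
    assume X: "\<forall>i. X i \<in> UNIV - {0}" "X \<longlonglongrightarrow> 0"
    define D where "D i q = (g q * (\<psi> (p - q + X i) - \<psi> (p - q) - dd \<psi> (X i) (p - q))) /\<^sub>R norm (X i)" for i q
    have X0: "norm (X i) > 0" for i using X(1) by simp
    have "(\<lambda>i. \<integral>q. D i q \<partial>lborel) \<longlonglongrightarrow> (\<integral>q. 0 \<partial>(lborel :: c2 measure))"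
    proof (rule integral_dominated_convergence)
      show "integrable lborel (\<lambda>q. norm (g q) * (2 * B))" using g by simp
      show "AE q in lborel. (\<lambda>i. D i q) \<longlonglongrightarrow> 0"
      proof (rule AE_I2)
        fix q
        have "((\<lambda>x. norm (\<psi> (p - q + x) - \<psi> (p - q) - dd \<psi> x (p - q)) / norm x) \<longlongrightarrow> 0) (at 0)"
          using differentiable_has_dd[OF d, of "p - q"] by (simp add: has_derivative_at)
        then have "(\<lambda>i. norm (\<psi> (p - q + X i) - \<psi> (p - q) - dd \<psi> (X i) (p - q)) / norm (X i)) \<longlonglongrightarrow> 0"
          using X unfolding tendsto_at_iff_sequentially by (auto simp: o_def)
        then have "(\<lambda>i. norm (g q) * (norm (\<psi> (p - q + X i) - \<psi> (p - q) - dd \<psi> (X i) (p - q)) / norm (X i))) \<longlonglongrightarrow> norm (g q) * 0"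
          by (intro tendsto_intros)
        moreover have "norm (D i q) = norm (g q) * (norm (\<psi> (p - q + X i) - \<psi> (p - q) - dd \<psi> (X i) (p - q)) / norm (X i))" for i
          unfolding D_def norm_scaleR norm_mult by (simp add: divide_inverse)
        ultimately show "(\<lambda>i. D i q) \<longlonglongrightarrow> 0"
          by (intro tendsto_norm_zero_cancel[of "\<lambda>i. D i q"]) simp
      qed
      show "AE q in lborel. norm (D i q) \<le> norm (g q) * (2 * B)" for i
      proof (rule AE_I2)
        fix q
        have "norm (\<psi> (p - q + X i) - \<psi> (p - q) - dd \<psi> (X i) (p - q)) \<le> B * norm (X i) + B * norm (X i)"
          by (intro order_trans[OF norm_triangle_ineq4] add_mono lip B)
        then have "norm (g q) * norm (\<psi> (p - q + X i) - \<psi> (p - q) - dd \<psi> (X i) (p - q)) \<le> norm (g q) * (2 * B * norm (X i))"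
          by (intro mult_left_mono) auto
        then show "norm (D i q) \<le> norm (g q) * (2 * B)"
          unfolding D_def norm_scaleR norm_mult using X0[of i]
          by (simp add: divide_inverse[symmetric] mult.commute[of "inverse _"] pos_divide_le_eq mult.assoc)
      qed
      have m: "(\<lambda>q. \<psi> (p - q + X i)) \<in> borel_measurable borel" for i
        using meas(1)[of "p + X i"] by (simp add: algebra_simps)
      show "D i \<in> borel_measurable lborel" for i
        unfolding D_def using g[THEN borel_measurable_integrable] meas(1)[of p] meas(2)[of p "X i"] m[of i] by measurable
    qed simp
    then have "(\<lambda>i. norm (\<integral>q. D i q \<partial>lborel)) \<longlonglongrightarrow> 0" by (intro tendsto_norm_zero) simp
    moreover have "norm (\<integral>q. D i q \<partial>lborel) = norm (conv g \<psi> (p + X i) - conv g \<psi> p - conv g (dd \<psi> (X i)) p) / norm (X i)" for i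
    proof -
      have "(\<integral>q. D i q \<partial>lborel) = (\<integral>q. g q * \<psi> (p + X i - q) - g q * \<psi> (p - q) - g q * dd \<psi> (X i) (p - q) \<partial>lborel) /\<^sub>R norm (X i)"
        unfolding D_def Bochner_Integration.integral_scaleR_right[symmetric]
        by (intro Bochner_Integration.integral_cong refl arg_cong[where f = "\<lambda>z. z /\<^sub>R norm (X i)"]) (simp add: algebra_simps)
      also have "(\<integral>q. g q * \<psi> (p + X i - q) - g q * \<psi> (p - q) - g q * dd \<psi> (X i) (p - q) \<partial>lborel)
          = conv g \<psi> (p + X i) - conv g \<psi> p - conv g (dd \<psi> (X i)) p"
        unfolding conv_def by (simp add: i1 i2)
      finally show ?thesis by (simp add: norm_mult divide_inverse mult.commute)
    qed
    ultimately show "((\<lambda>x. norm (conv g \<psi> (p + x) - conv g \<psi> p - conv g (dd \<psi> x) p) / norm x) \<circ> X) \<longlonglongrightarrow> 0"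
      by (simp add: o_def)
  qed
  with bl show ?thesis by (simp add: has_derivative_at)
qed

lemma conv_restrict:
  assumes S: "\<And>p. S < norm p \<Longrightarrow> \<psi> p = 0" and R: "norm p + S \<le> R"
  shows "conv (\<lambda>q. indicator (cball 0 R) q *\<^sub>R f q) \<psi> p = conv f \<psi> p"
  unfolding conv_def
proof (intro Bochner_Integration.integral_cong refl)
  fix q :: c2
  show "indicator (cball 0 R) q *\<^sub>R f q * \<psi> (p - q) = f q * \<psi> (p - q)"
  proof (cases "norm q \<le> R")
    case False
    then have "S < norm (p - q)" using R norm_triangle_ineq2[of q p] by (simp add: norm_minus_commute)
    then show ?thesis by (simp add: S)
  qed (simp add: indicator_def)
qed

lemma conv_has_derivative:
  assumes f: "locint f" and \<psi>: "Ck (Suc 0) \<psi>" "csupp \<psi>"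
  shows "(conv f \<psi> has_derivative (\<lambda>v. conv f (dd \<psi> v) p)) (at p)"
proof -
  obtain S where S: "\<And>p. S < norm p \<Longrightarrow> \<psi> p = 0" using \<psi>(2) unfolding csupp_def by blast
  obtain S' where S': "\<And>v p. S' < norm p \<Longrightarrow> dd \<psi> v p = 0"
  proof
    fix v p :: c2 assume p: "max S 0 + 1 < norm p"
    have "((\<lambda>_. 0) has_derivative (\<lambda>_. 0)) (at p)" by simp
    then have "(\<psi> has_derivative (\<lambda>_. 0)) (at p)"
      by (rule has_derivative_transform_within_open[where s = "{p. S < norm p}"])
        (use p S in \<open>auto intro!: open_Collect_less continuous_intros\<close>)
    then show "dd \<psi> v p = 0" by (rule dd_eq)
  qed
  \<comment> \<open>Large enough that neither \<open>\<psi>\<close> nor its derivatives, evaluated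
    at \<open>x - q\<close> for \<open>x\<close> in the unit ball around \<open>p\<close>, see the
    truncation of \<open>f\<close>.\<close>
  define R where "R = norm p + 1 + \<bar>S\<bar> + \<bar>S'\<bar>"
  define g where "g = (\<lambda>q. indicator (cball 0 R) q *\<^sub>R f q)"
  have "integrable lborel g" using f unfolding locint_def g_def by blast
  from conv_has_derivative_integrable[OF this \<psi>]
  have "(conv g \<psi> has_derivative (\<lambda>v. conv g (dd \<psi> v) p)) (at p)" .
  moreover have "conv g (dd \<psi> v) p = conv f (dd \<psi> v) p" for v
    unfolding g_def by (rule conv_restrict[OF S']) (auto simp: R_def)
  ultimately have "(conv g \<psi> has_derivative (\<lambda>v. conv f (dd \<psi> v) p)) (at p)" by simp
  then show ?thesis
  proof (rule has_derivative_transform_within_open[where s = "ball p 1"])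
    fix x assume "x \<in> ball p 1"
    then have "norm x \<le> norm p + 1" using norm_triangle_ineq2[of x p] by (simp add: dist_norm norm_minus_commute)
    then show "conv g \<psi> x = conv f \<psi> x" unfolding g_def by (intro conv_restrict[OF S]) (auto simp: R_def)
  qed auto
qed

text \<open>Each derivative falls on the kernel, so the induction changes \<open>\<psi>\<close>;
  this is why its smoothness is assumed at all orders at once.\<close>

lemma Ck_conv:
  assumes f: "locint f"
  shows "(\<And>j. Ck j \<psi>) \<Longrightarrow> csupp \<psi> \<Longrightarrow> Ck k (conv f \<psi>)"
proof (induction k arbitrary: \<psi>)
  case 0
  then show ?case
    using conv_has_derivative[OF f] by (simp del: Ck.simps(2)) (blast intro: continuous_at_imp_continuous_on has_derivative_continuous)
next
  case (Suc k)
  have 1: "Ck (Suc 0) \<psi>" by (rule Suc.prems)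
  have "dd (conv f \<psi>) v = conv f (dd \<psi> v)" for v
    by (intro ext dd_eq[OF conv_has_derivative[OF f 1 Suc.prems(2)]])
  moreover have "Ck k (conv f (dd \<psi> v))" for v
    by (intro Suc.IH Ck_dd csupp_dd Suc.prems)
  ultimately show ?case
    using differentiableI[OF conv_has_derivative[OF f 1 Suc.prems(2)]] by simp
qed

lemma conv_pdbar:
  assumes f: "locint f" and \<psi>: "Ck (Suc 0) \<psi>" "csupp \<psi>"
  shows "pdbar v (conv f \<psi>) p = (\<integral>q. f q * pdbar v \<psi> (p - q) \<partial>lborel)"
    and "pd v (conv f \<psi>) p = (\<integral>q. f q * pd v \<psi> (p - q) \<partial>lborel)"
proof -
  have i: "integrable lborel (\<lambda>q. f q * dd \<psi> v (p - q))" for v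
    by (rule integrable_conv[OF f]) (use \<psi> csupp_dd[OF \<psi>] in auto)
  have dd: "dd (conv f \<psi>) v p = (\<integral>q. f q * dd \<psi> v (p - q) \<partial>lborel)" for v
    using dd_eq[OF conv_has_derivative[OF f \<psi>]] by (simp add: conv_def)
  have "pdbar v (conv f \<psi>) p = (\<integral>q. (f q * dd \<psi> v (p - q) + \<i> * (f q * dd \<psi> (imul v) (p - q))) / 2 \<partial>lborel)"
    unfolding pdbar_def dd using i by simp
  then show "pdbar v (conv f \<psi>) p = (\<integral>q. f q * pdbar v \<psi> (p - q) \<partial>lborel)"
    by (simp add: pdbar_def algebra_simps)
  have "pd v (conv f \<psi>) p = (\<integral>q. (f q * dd \<psi> v (p - q) - \<i> * (f q * dd \<psi> (imul v) (p - q))) / 2 \<partial>lborel)"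
    unfolding pd_def dd using i by simp
  then show "pd v (conv f \<psi>) p = (\<integral>q. f q * pd v \<psi> (p - q) \<partial>lborel)"
    by (simp add: pd_def algebra_simps)
qed

section \<open>Convergence of mollifications\<close>

definition sqnorm_on :: "c2 set \<Rightarrow> (c2 \<Rightarrow> complex) \<Rightarrow> ennreal" where
  "sqnorm_on S f = (\<integral>\<^sup>+p. indicator S p * ennreal ((cmod (f p))\<^sup>2) \<partial>lborel)"

lemma cball_sets [measurable]: "cball (x :: c2) r \<in> sets borel"
  by simp

lemma sqnorm_on_mono_set: "S \<subseteq> T \<Longrightarrow> sqnorm_on S f \<le> sqnorm_on T f"
  unfolding sqnorm_on_def by (intro nn_integral_mono mult_right_mono) (auto simp: indicator_def)

lemma sqnorm_on_cong: "(\<And>p. p \<in> S \<Longrightarrow> f p = g p) \<Longrightarrow> sqnorm_on S f = sqnorm_on S g"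
  unfolding sqnorm_on_def by (intro nn_integral_cong) (auto simp: indicator_def)

lemma two_ennreal: "0 \<le> x \<Longrightarrow> 2 * ennreal x = ennreal (2 * x)"
  by (simp add: ennreal_mult)

lemma square_add_le: "(cmod (a + b))\<^sup>2 \<le> 2 * (cmod a)\<^sup>2 + 2 * (cmod b)\<^sup>2"
proof -
  have "(cmod (a + b))\<^sup>2 \<le> (cmod a + cmod b)\<^sup>2" by (intro power_mono norm_triangle_ineq) auto
  also have "\<dots> \<le> 2 * (cmod a)\<^sup>2 + 2 * (cmod b)\<^sup>2"
    using zero_le_power2[of "cmod a - cmod b"] by (simp add: power2_eq_square algebra_simps)
  finally show ?thesis .
qed

lemma sqnorm_on_add:
  assumes [measurable]: "f \<in> borel_measurable borel" "g \<in> borel_measurable borel" "S \<in> sets borel"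
  shows "sqnorm_on S (\<lambda>p. f p + g p) \<le> 2 * sqnorm_on S f + 2 * sqnorm_on S g"
proof -
  have "sqnorm_on S (\<lambda>p. f p + g p) \<le> (\<integral>\<^sup>+p. 2 * (indicator S p * ennreal ((cmod (f p))\<^sup>2)) + 2 * (indicator S p * ennreal ((cmod (g p))\<^sup>2)) \<partial>lborel)"
    unfolding sqnorm_on_def
  proof (rule nn_integral_mono)
    fix p
    have "ennreal ((cmod (f p + g p))\<^sup>2) \<le> ennreal (2 * (cmod (f p))\<^sup>2 + 2 * (cmod (g p))\<^sup>2)"
      by (intro ennreal_leI square_add_le)
    also have "\<dots> = 2 * ennreal ((cmod (f p))\<^sup>2) + 2 * ennreal ((cmod (g p))\<^sup>2)"
      by (simp add: two_ennreal)
    finally show "indicator S p * ennreal ((cmod (f p + g p))\<^sup>2) \<le>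
        2 * (indicator S p * ennreal ((cmod (f p))\<^sup>2)) + 2 * (indicator S p * ennreal ((cmod (g p))\<^sup>2))"
      by (cases "p \<in> S") auto
  qed
  also have "\<dots> = 2 * sqnorm_on S f + 2 * sqnorm_on S g"
    unfolding sqnorm_on_def by (simp add: nn_integral_add nn_integral_cmult)
  finally show ?thesis .
qed

lemma sqnorm_on_mult_bounded:
  assumes [measurable]: "f \<in> borel_measurable borel" "S \<in> sets borel" and B: "\<And>p. p \<in> S \<Longrightarrow> cmod (A p) \<le> B"
  shows "sqnorm_on S (\<lambda>p. A p * f p) \<le> ennreal (B\<^sup>2) * sqnorm_on S f"
proof -
  have "sqnorm_on S (\<lambda>p. A p * f p) \<le> (\<integral>\<^sup>+p. ennreal (B\<^sup>2) * (indicator S p * ennreal ((cmod (f p))\<^sup>2)) \<partial>lborel)"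
    unfolding sqnorm_on_def
  proof (rule nn_integral_mono)
    fix p
    show "indicator S p * ennreal ((cmod (A p * f p))\<^sup>2) \<le> ennreal (B\<^sup>2) * (indicator S p * ennreal ((cmod (f p))\<^sup>2))"
    proof (cases "p \<in> S")
      case True
      then have "(cmod (A p))\<^sup>2 * (cmod (f p))\<^sup>2 \<le> B\<^sup>2 * (cmod (f p))\<^sup>2"
        by (intro mult_right_mono power_mono B) auto
      then have "ennreal ((cmod (A p * f p))\<^sup>2) \<le> ennreal (B\<^sup>2 * (cmod (f p))\<^sup>2)"
        by (intro ennreal_leI) (simp add: norm_mult power_mult_distrib)
      then show ?thesis using True by (simp add: ennreal_mult)
    qed simp
  qed
  also have "\<dots> = ennreal (B\<^sup>2) * sqnorm_on S f"
    unfolding sqnorm_on_def by (intro nn_integral_cmult) measurable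
  finally show ?thesis .
qed

definition L2loc :: "(c2 \<Rightarrow> complex) \<Rightarrow> bool" where
  "L2loc f \<longleftrightarrow> f \<in> borel_measurable borel \<and> (\<forall>R. sqnorm_on (cball 0 R) f < \<infinity>)"

lemma L2loc_add: "L2loc f \<Longrightarrow> L2loc g \<Longrightarrow> L2loc (\<lambda>p. f p + g p)"
  unfolding L2loc_def
  by (auto intro!: le_less_trans[OF sqnorm_on_add] simp: ennreal_mult_less_top ennreal_add_less_top)

lemma L2loc_mult:
  assumes A: "continuous_on UNIV A" and f: "L2loc f"
  shows "L2loc (\<lambda>p. A p * f p)"
  unfolding L2loc_def
proof (intro conjI allI)
  have [measurable]: "f \<in> borel_measurable borel" "A \<in> borel_measurable borel"
    using f A unfolding L2loc_def by (auto intro: borel_measurable_continuous_onI)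
  show "(\<lambda>p. A p * f p) \<in> borel_measurable borel" by measurable
  fix R
  have "compact (A ` cball 0 R)"
    by (intro compact_continuous_image) (use A continuous_on_subset in auto)
  then obtain B where "\<And>p. p \<in> cball 0 R \<Longrightarrow> cmod (A p) \<le> B"
    by (meson bounded_iff compact_imp_bounded imageI)
  then have "sqnorm_on (cball 0 R) (\<lambda>p. A p * f p) \<le> ennreal (B\<^sup>2) * sqnorm_on (cball 0 R) f"
    by (intro sqnorm_on_mult_bounded) auto
  also have "\<dots> < \<infinity>" using f unfolding L2loc_def by (auto simp: ennreal_mult_less_top)
  finally show "sqnorm_on (cball 0 R) (\<lambda>p. A p * f p) < \<infinity>" .
qed

lemma L2loc_diff: "L2loc f \<Longrightarrow> L2loc g \<Longrightarrow> L2loc (\<lambda>p. f p - g p)"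
  using L2loc_add[of f "\<lambda>p. -1 * g p"] L2loc_mult[of "\<lambda>_. -1" g] by simp

lemma L2loc_continuous: "continuous_on UNIV f \<Longrightarrow> L2loc f"
proof -
  assume f: "continuous_on UNIV f"
  have "L2loc (\<lambda>_. 1)"
    unfolding L2loc_def sqnorm_on_def using emeasure_lborel_cball_finite[of "0 :: c2"] by simp
  from L2loc_mult[OF f this] show ?thesis by simp
qed

lemma L2loc_imp_locint: "L2loc f \<Longrightarrow> locint f"
  unfolding locint_def
proof (intro conjI allI)
  assume f: "L2loc f"
  then show m[measurable]: "f \<in> borel_measurable borel" unfolding L2loc_def by blast
  fix R
  show "integrable lborel (\<lambda>p. indicator (cball 0 R) p *\<^sub>R f p)"
  proof (rule integrableI_bounded)
    have "(\<integral>\<^sup>+p. ennreal (norm (indicator (cball 0 R) p *\<^sub>R f p)) \<partial>lborel)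
      \<le> (\<integral>\<^sup>+p. indicator (cball 0 R) p + indicator (cball 0 R) p * ennreal ((cmod (f p))\<^sup>2) \<partial>lborel)"
    proof (rule nn_integral_mono)
      fix p
      have "cmod (f p) \<le> 1 + (cmod (f p))\<^sup>2"
        using zero_le_power2[of "cmod (f p) - 1/2"] by (simp add: power2_eq_square algebra_simps)
      then have "ennreal (cmod (f p)) \<le> 1 + ennreal ((cmod (f p))\<^sup>2)"
        by (metis ennreal_1 ennreal_leI ennreal_plus zero_le_one zero_le_power2)
      then show "ennreal (norm (indicator (cball 0 R) p *\<^sub>R f p)) \<le> indicator (cball 0 R) p + indicator (cball 0 R) p * ennreal ((cmod (f p))\<^sup>2)"
        by (cases "p \<in> cball 0 R") auto
    qed
    also have "\<dots> = emeasure lborel (cball 0 R :: c2 set) + sqnorm_on (cball 0 R) f"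
    proof -
      have "(\<lambda>p. indicator (cball 0 R) p * ennreal ((cmod (f p))\<^sup>2)) \<in> borel_measurable lborel" by measurable
      then show ?thesis unfolding sqnorm_on_def by (subst nn_integral_add) (auto intro: borel_measurable_indicator)
    qed
    also have "\<dots> < \<infinity>"
      using f emeasure_lborel_cball_finite unfolding L2loc_def by (auto simp: ennreal_add_less_top)
    finally show "(\<integral>\<^sup>+p. ennreal (norm (indicator (cball 0 R) p *\<^sub>R f p)) \<partial>lborel) < \<infinity>" .
  qed measurable
qed

lemma nn_integral_reflect:
  fixes f :: "c2 \<Rightarrow> ennreal"
  assumes [measurable]: "f \<in> borel_measurable borel"
  shows "(\<integral>\<^sup>+q. f (p - q) \<partial>lborel) = (\<integral>\<^sup>+q. f q \<partial>lborel)"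
proof -
  have "(lborel :: c2 measure) = distr lborel borel (\<lambda>q. p - q)"
    using lborel_affine[of "-1" p] by (simp add: density_1)
  then have "(\<integral>\<^sup>+q. f q \<partial>lborel) = (\<integral>\<^sup>+q. f q \<partial>distr lborel borel (\<lambda>q. p - q))" by simp
  also have "\<dots> = (\<integral>\<^sup>+q. f (p - q) \<partial>lborel)" by (intro nn_integral_distr) auto
  finally show ?thesis by simp
qed

lemma nn_integral_translate:
  fixes f :: "c2 \<Rightarrow> ennreal"
  assumes [measurable]: "f \<in> borel_measurable borel"
  shows "(\<integral>\<^sup>+p. f (p - q) \<partial>lborel) = (\<integral>\<^sup>+p. f p \<partial>lborel)"
proof -
  have "(\<integral>\<^sup>+p. f p \<partial>lborel) = (\<integral>\<^sup>+p. f p \<partial>distr lborel borel ((+) (- q)))" by (simp add: lborel_distr_plus)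
  also have "\<dots> = (\<integral>\<^sup>+p. f (- q + p) \<partial>lborel)" by (intro nn_integral_distr) auto
  finally show ?thesis by simp
qed

lemma rho_measurable [measurable]: "rho n \<in> borel_measurable borel"
  by (rule borel_measurable_continuous_onI[OF continuous_rho])

lemma nn_integral_rho: "(\<integral>\<^sup>+q. ennreal (rho n q) \<partial>lborel) = 1"
proof -
  have "integrable lborel (rho n)" by (rule integrable_csupp_real[OF continuous_rho csupp_rho])
  then show ?thesis
    by (subst nn_integral_eq_integral) (auto simp: rho_nonneg integral_rho)
qed

definition mollify :: "(c2 \<Rightarrow> complex) \<Rightarrow> nat \<Rightarrow> c2 \<Rightarrow> complex" where
  "mollify f n = conv f (\<lambda>p. complex_of_real (rho n p))"

lemma Ck_mollify: "locint f \<Longrightarrow> Ck k (mollify f n)"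
  unfolding mollify_def by (rule Ck_conv[OF _ Ck_rho csupp_rho])

text \<open>Cauchy-Schwarz with the kernel split into two square roots, one of which integrates to
  the total mass 1.\<close>

lemma mollify_pointwise:
  assumes [measurable]: "h \<in> borel_measurable borel"
  shows "ennreal ((cmod (mollify h n p))\<^sup>2) \<le> (\<integral>\<^sup>+q. ennreal ((cmod (h q))\<^sup>2) * ennreal (rho n (p - q)) \<partial>lborel)"
proof -
  have 1: "ennreal (cmod (mollify h n p)) \<le> (\<integral>\<^sup>+q. ennreal (cmod (h q) * sqrt (rho n (p - q))) * ennreal (sqrt (rho n (p - q))) \<partial>lborel)"
  proof (cases "integrable lborel (\<lambda>q. h q * complex_of_real (rho n (p - q)))")
    case True
    have "ennreal (cmod (mollify h n p)) \<le> (\<integral>\<^sup>+q. ennreal (norm (h q * complex_of_real (rho n (p - q)))) \<partial>lborel)"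
      unfolding mollify_def conv_def by (rule integral_norm_bound_ennreal[OF True])
    also have "\<dots> = (\<integral>\<^sup>+q. ennreal (cmod (h q) * sqrt (rho n (p - q))) * ennreal (sqrt (rho n (p - q))) \<partial>lborel)"
      by (intro nn_integral_cong) (simp add: norm_mult rho_nonneg ennreal_mult[symmetric] mult.assoc)
    finally show ?thesis .
  next
    case False
    \<comment> \<open>A Bochner integral of a non-integrable function is 0 by convention, so the
      bound is trivial here.\<close>
    then show ?thesis unfolding mollify_def conv_def by (simp add: not_integrable_integral_eq)
  qed
  have "ennreal ((cmod (mollify h n p))\<^sup>2) = (ennreal (cmod (mollify h n p)))\<^sup>2" by (simp add: ennreal_power)
  also have "\<dots> \<le> (\<integral>\<^sup>+q. ennreal (cmod (h q) * sqrt (rho n (p - q))) * ennreal (sqrt (rho n (p - q))) \<partial>lborel)\<^sup>2"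
    by (intro power_mono 1) auto
  also have "\<dots> \<le> (\<integral>\<^sup>+q. (ennreal (cmod (h q) * sqrt (rho n (p - q))))\<^sup>2 \<partial>lborel) * (\<integral>\<^sup>+q. (ennreal (sqrt (rho n (p - q))))\<^sup>2 \<partial>lborel)"
    by (rule Cauchy_Schwarz_nn_integral) measurable
  also have "(\<integral>\<^sup>+q. (ennreal (sqrt (rho n (p - q))))\<^sup>2 \<partial>lborel) = (\<integral>\<^sup>+q. ennreal (rho n (p - q)) \<partial>lborel)"
    by (intro nn_integral_cong) (simp add: ennreal_power rho_nonneg)
  also have "\<dots> = 1"
    using nn_integral_reflect[of "\<lambda>q. ennreal (rho n q)" p] by (simp add: nn_integral_rho)
  also have "(\<integral>\<^sup>+q. (ennreal (cmod (h q) * sqrt (rho n (p - q))))\<^sup>2 \<partial>lborel)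
      = (\<integral>\<^sup>+q. ennreal ((cmod (h q))\<^sup>2) * ennreal (rho n (p - q)) \<partial>lborel)"
    by (intro nn_integral_cong) (simp add: ennreal_power rho_nonneg power_mult_distrib ennreal_mult[symmetric])
  finally show ?thesis by simp
qed

lemma mollify_contraction:
  assumes h[measurable]: "h \<in> borel_measurable borel"
  shows "sqnorm_on UNIV (mollify h n) \<le> sqnorm_on UNIV h"
proof -
  have "sqnorm_on UNIV (mollify h n) \<le> (\<integral>\<^sup>+p. \<integral>\<^sup>+q. ennreal ((cmod (h q))\<^sup>2) * ennreal (rho n (p - q)) \<partial>lborel \<partial>lborel)"
    unfolding sqnorm_on_def using mollify_pointwise[OF h] by (intro nn_integral_mono) simp
  also have "\<dots> = (\<integral>\<^sup>+q. \<integral>\<^sup>+p. ennreal ((cmod (h q))\<^sup>2) * ennreal (rho n (p - q)) \<partial>lborel \<partial>lborel)"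
    by (rule lborel_pair.Fubini') measurable
  also have "\<dots> = (\<integral>\<^sup>+q. ennreal ((cmod (h q))\<^sup>2) * (\<integral>\<^sup>+p. ennreal (rho n (p - q)) \<partial>lborel) \<partial>lborel)"
    by (intro nn_integral_cong nn_integral_cmult) measurable
  also have "\<dots> = sqnorm_on UNIV h"
    unfolding sqnorm_on_def using nn_integral_translate[of "\<lambda>q. ennreal (rho n q)"] by (simp add: nn_integral_rho)
  finally show ?thesis .
qed

section \<open>Approximation in the mean by continuous functions\<close>

lemma truncation_approx:
  assumes [measurable]: "g \<in> borel_measurable borel" and g: "sqnorm_on UNIV g < \<infinity>" and "0 < e"
  shows "\<exists>N::nat. 0 < N \<and> sqnorm_on UNIV (\<lambda>p. g p - (if norm (g p) \<le> real N then g p else 0)) < ennreal e"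
proof -
  have "(\<lambda>N. sqnorm_on UNIV (\<lambda>p. g p - (if norm (g p) \<le> real N then g p else 0))) \<longlonglongrightarrow> (\<integral>\<^sup>+p. (0::ennreal) \<partial>(lborel :: c2 measure))"
    unfolding sqnorm_on_def
  proof (rule nn_integral_dominated_convergence[where w = "\<lambda>p. ennreal ((cmod (g p))\<^sup>2)"])
    show "(\<integral>\<^sup>+p. ennreal ((cmod (g p))\<^sup>2) \<partial>lborel) < \<infinity>" using g by (simp add: sqnorm_on_def)
    show "AE p in lborel. indicator UNIV p * ennreal ((cmod (g p - (if norm (g p) \<le> real N then g p else 0)))\<^sup>2) \<le> ennreal ((cmod (g p))\<^sup>2)" for N
      by (intro AE_I2) auto
    show "AE p in lborel. (\<lambda>N. indicator UNIV p * ennreal ((cmod (g p - (if norm (g p) \<le> real N then g p else 0)))\<^sup>2)) \<longlonglongrightarrow> 0"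
    proof (intro AE_I2 tendsto_eventually)
      fix p
      obtain N0 where "cmod (g p) \<le> real N0" using real_arch_simple by blast
      then show "\<forall>\<^sub>F N in sequentially. indicator UNIV p * ennreal ((cmod (g p - (if norm (g p) \<le> real N then g p else 0)))\<^sup>2) = 0"
        by (intro eventually_sequentiallyI[of N0]) auto
    qed
  qed measurable
  then have "(\<lambda>N. sqnorm_on UNIV (\<lambda>p. g p - (if norm (g p) \<le> real N then g p else 0))) \<longlonglongrightarrow> 0" by simp
  then have "\<forall>\<^sub>F N in sequentially. sqnorm_on UNIV (\<lambda>p. g p - (if norm (g p) \<le> real N then g p else 0)) < ennreal e"
    by (rule order_tendstoD(2)) (use \<open>0 < e\<close> in simp)
  then have "\<forall>\<^sub>F N in sequentially. 0 < N \<and> sqnorm_on UNIV (\<lambda>p. g p - (if norm (g p) \<le> real N then g p else 0)) < ennreal e"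
    using eventually_gt_at_top[of 0] by eventually_elim simp
  then show ?thesis by (auto simp: eventually_sequentially)
qed

text \<open>Lebesgue measurability supplies continuous functions converging almost everywhere, but
  with no control of size or support. Clipping their values at \<open>N\<close> and cutting them off
  in space provides a dominating function without changing the limit.\<close>

lemma bounded_approx_continuous:
  assumes g[measurable]: "g \<in> borel_measurable borel" and S: "\<And>p. S < norm p \<Longrightarrow> g p = 0"
    and N: "0 < N" "\<And>p. norm (g p) \<le> N" and "0 < e"
  shows "\<exists>k. continuous_on UNIV k \<and> csupp k \<and> sqnorm_on UNIV (\<lambda>p. g p - k p) < ennreal e"
proof -
  have "g \<in> borel_measurable lebesgue" by (simp add: measurable_completion)
  then have "g measurable_on UNIV" by (intro lebesgue_measurable_imp_measurable_on) auto
  then obtain Z k where Z: "negligible Z" and k: "\<And>n. continuous_on UNIV (k n)" "\<And>p. p \<notin> Z \<Longrightarrow> (\<lambda>n. k n p) \<longlonglongrightarrow> g p"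
    unfolding measurable_on_def by auto
  \<comment> \<open>Radial retraction onto the disc of radius \<open>N\<close>; the maximum makes it
    the identity inside and keeps the denominator positive.\<close>
  define clip where "clip z = (N / max N (norm z)) *\<^sub>R z" for z :: complex
  define \<eta> where "\<eta> p = max 0 (min 1 (S + 1 - norm p))" for p :: c2
  define K where "K n p = \<eta> p *\<^sub>R clip (k n p)" for n p
  have clip_cont: "continuous_on UNIV clip"
    unfolding clip_def by (intro continuous_intros) (use N in auto)
  have clip_le: "norm (clip z) \<le> N" for z
  proof -
    have "norm (clip z) = N * norm z / max N (norm z)" using N by (simp add: clip_def)
    also have "\<dots> \<le> N" using N by (subst pos_divide_le_eq) auto
    finally show ?thesis .
  qed
  have clip_id: "norm z \<le> N \<Longrightarrow> clip z = z" for z using N by (simp add: clip_def max_def)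
  have \<eta>: "0 \<le> \<eta> p" "\<eta> p \<le> 1" "norm p \<le> S \<Longrightarrow> \<eta> p = 1" "S + 1 < norm p \<Longrightarrow> \<eta> p = 0" for p
    by (auto simp: \<eta>_def)
  have Kc: "continuous_on UNIV (K n)" for n
    unfolding K_def \<eta>_def by (intro continuous_intros continuous_on_compose2[OF clip_cont] k) auto
  have Ks: "csupp (K n)" for n
    unfolding csupp_def K_def using \<eta>(4) by (intro exI[of _ "S + 1"]) auto
  have Kg: "\<eta> p *\<^sub>R clip (g p) = g p" for p
    using \<eta>(3)[of p] S[of p] N(2)[of p] by (cases "norm p \<le> S") (auto simp: clip_id clip_def)
  have Kle: "norm (K n p) \<le> N" for n p
    unfolding K_def norm_scaleR using mult_mono[OF \<eta>(2)[of p] clip_le[of "k n p"]] \<eta>(1)[of p] N by simp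
  have [measurable]: "K n \<in> borel_measurable borel" for n by (rule borel_measurable_continuous_onI[OF Kc])
  have AE0: "AE p in lborel. p \<notin> Z"
  proof -
    have "AE p in completion lborel. p \<notin> Z"
      using Z by (simp add: negligible_iff_null_sets AE_not_in)
    then show ?thesis by (simp only: AE_completion_iff)
  qed
  have "(\<lambda>n. sqnorm_on UNIV (\<lambda>p. g p - K n p)) \<longlonglongrightarrow> (\<integral>\<^sup>+p. (0::ennreal) \<partial>(lborel :: c2 measure))"
    unfolding sqnorm_on_def
  proof (rule nn_integral_dominated_convergence[where w = "\<lambda>p. ennreal ((2 * N)\<^sup>2) * indicator (cball 0 (S + 1)) p"])
    show "(\<integral>\<^sup>+p. ennreal ((2 * N)\<^sup>2) * indicator (cball 0 (S + 1)) p \<partial>(lborel :: c2 measure)) < \<infinity>"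
      using emeasure_lborel_cball_finite[of "0 :: c2" "S + 1"] by (simp add: nn_integral_cmult_indicator ennreal_mult_less_top)
    show "AE p in lborel. indicator UNIV p * ennreal ((cmod (g p - K n p))\<^sup>2) \<le> ennreal ((2 * N)\<^sup>2) * indicator (cball 0 (S + 1)) p" for n
    proof (rule AE_I2)
      fix p
      show "indicator UNIV p * ennreal ((cmod (g p - K n p))\<^sup>2) \<le> ennreal ((2 * N)\<^sup>2) * indicator (cball 0 (S + 1)) p"
      proof (cases "norm p \<le> S + 1")
        case True
        have "cmod (g p - K n p) \<le> N + N" by (intro order_trans[OF norm_triangle_ineq4] add_mono N Kle)
        then have "(cmod (g p - K n p))\<^sup>2 \<le> (2 * N)\<^sup>2" by (intro power_mono) auto
        then show ?thesis using True by (auto intro: ennreal_leI simp: indicator_def)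
      next
        case False
        then show ?thesis using S[of p] \<eta>(4)[of p] by (simp add: K_def)
      qed
    qed
    show "AE p in lborel. (\<lambda>n. indicator UNIV p * ennreal ((cmod (g p - K n p))\<^sup>2)) \<longlonglongrightarrow> 0"
      using AE0
    proof eventually_elim
      case (elim p)
      have "isCont clip (g p)" using clip_cont by (simp add: continuous_on_eq_continuous_at)
      then have "(\<lambda>n. clip (k n p)) \<longlonglongrightarrow> clip (g p)" by (rule isCont_tendsto_compose[OF _ k(2)[OF elim]])
      then have "(\<lambda>n. K n p) \<longlonglongrightarrow> g p"
        unfolding K_def by (subst Kg[symmetric]) (intro tendsto_scaleR tendsto_const)
      then have "(\<lambda>n. (cmod (g p - K n p))\<^sup>2) \<longlonglongrightarrow> (cmod (g p - g p))\<^sup>2" by (intro tendsto_intros)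
      then have "(\<lambda>n. ennreal ((cmod (g p - K n p))\<^sup>2)) \<longlonglongrightarrow> ennreal 0" by (intro tendsto_ennrealI) simp
      then show ?case by simp
    qed
  qed measurable
  then have "(\<lambda>n. sqnorm_on UNIV (\<lambda>p. g p - K n p)) \<longlonglongrightarrow> 0" by simp
  then have "\<forall>\<^sub>F n in sequentially. sqnorm_on UNIV (\<lambda>p. g p - K n p) < ennreal e"
    by (rule order_tendstoD(2)) (use \<open>0 < e\<close> in simp)
  then obtain n where "sqnorm_on UNIV (\<lambda>p. g p - K n p) < ennreal e" by (auto simp: eventually_sequentially)
  then show ?thesis using Kc Ks by blast
qed

lemma approx_continuous:
  assumes g[measurable]: "g \<in> borel_measurable borel" and fin: "sqnorm_on UNIV g < \<infinity>"
    and S: "\<And>p. S < norm p \<Longrightarrow> g p = 0" and "0 < e"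
  shows "\<exists>k. continuous_on UNIV k \<and> csupp k \<and> sqnorm_on UNIV (\<lambda>p. g p - k p) \<le> ennreal e"
proof -
  have e4: "0 < e / 4" using \<open>0 < e\<close> by simp
  from truncation_approx[OF g fin e4] obtain N :: nat where N: "0 < N"
    and 1: "sqnorm_on UNIV (\<lambda>p. g p - (if norm (g p) \<le> real N then g p else 0)) < ennreal (e / 4)" by blast
  define g' where "g' p = (if norm (g p) \<le> real N then g p else 0)" for p
  have g'[measurable]: "g' \<in> borel_measurable borel" unfolding g'_def by measurable
  have "\<And>p. S < norm p \<Longrightarrow> g' p = 0" "0 < real N" "\<And>p. norm (g' p) \<le> real N"
    using N S by (auto simp: g'_def)
  from bounded_approx_continuous[OF g' this e4] obtain k
    where k: "continuous_on UNIV k" "csupp k" "sqnorm_on UNIV (\<lambda>p. g' p - k p) < ennreal (e / 4)" by blast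
  have [measurable]: "k \<in> borel_measurable borel" by (rule borel_measurable_continuous_onI[OF k(1)])
  have "sqnorm_on UNIV (\<lambda>p. g p - k p) = sqnorm_on UNIV (\<lambda>p. (g p - g' p) + (g' p - k p))" by simp
  also have "\<dots> \<le> 2 * sqnorm_on UNIV (\<lambda>p. g p - g' p) + 2 * sqnorm_on UNIV (\<lambda>p. g' p - k p)"
    by (intro sqnorm_on_add) auto
  also have "\<dots> \<le> 2 * ennreal (e / 4) + 2 * ennreal (e / 4)"
    using 1 k(3) unfolding g'_def by (intro add_mono mult_left_mono less_imp_le) auto
  also have "\<dots> = ennreal e"
    using \<open>0 < e\<close> by (simp add: two_ennreal ennreal_plus[symmetric] del: ennreal_plus)
  finally show ?thesis using k by blast
qed

lemma integrable_rho_reflect: "integrable lborel (\<lambda>q. complex_of_real (rho n (p - q)))"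
  by (intro integrable_csupp csupp_reflect[OF csupp_rho] continuous_intros continuous_on_compose2[OF continuous_rho]) auto

lemma integral_rho_reflect: "(\<integral>q. rho n (p - q) \<partial>lborel) = 1"
proof -
  have "(\<integral>q. rho n (p - q) \<partial>lborel) = enn2real (\<integral>\<^sup>+q. ennreal (rho n (p - q)) \<partial>lborel)"
    by (intro integral_eq_nn_integral) (auto simp: rho_nonneg)
  also have "\<dots> = 1"
    using nn_integral_reflect[of "\<lambda>q. ennreal (rho n q)" p] by (simp add: nn_integral_rho)
  finally show ?thesis .
qed

lemma mollify_continuous_approx:
  assumes k: "continuous_on UNIV k" "csupp k" and d: "0 \<le> d"
    and close: "\<And>q. norm (p - q) < 1 / (real n + 1) \<Longrightarrow> norm (k q - k p) \<le> d"
  shows "norm (mollify k n p - k p) \<le> d"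
proof -
  have lk: "locint k" by (rule L2loc_imp_locint[OF L2loc_continuous[OF k(1)]])
  have rr: "integrable lborel (\<lambda>q. rho n (p - q))"
    using integrable_rho_reflect[of n p] complex_of_real_integrable_eq by blast
  have i1: "integrable lborel (\<lambda>q. k q * complex_of_real (rho n (p - q)))"
    by (rule integrable_conv[OF lk Ck_imp_continuous[OF Ck_rho] csupp_rho])
  have i2: "integrable lborel (\<lambda>q. (k q - k p) * complex_of_real (rho n (p - q)))"
    using i1 integrable_rho_reflect[of n p] by (simp add: left_diff_distrib)
  have "mollify k n p - k p = (\<integral>q. (k q - k p) * complex_of_real (rho n (p - q)) \<partial>lborel)"
    using i1 integrable_rho_reflect[of n p] by (simp add: left_diff_distrib mollify_def conv_def integral_rho_reflect)
  also have "norm \<dots> \<le> (\<integral>q. norm ((k q - k p) * complex_of_real (rho n (p - q))) \<partial>lborel)"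
    by (rule integral_norm_bound)
  also have "\<dots> \<le> (\<integral>q. d * rho n (p - q) \<partial>lborel)"
  proof (intro integral_mono integrable_norm i2 integrable_mult_right rr)
    fix q
    show "norm ((k q - k p) * complex_of_real (rho n (p - q))) \<le> d * rho n (p - q)"
    proof (cases "norm (p - q) < 1 / (real n + 1)")
      case True
      then show ?thesis using close[of q] rho_nonneg[of n "p - q"] by (auto simp: norm_mult intro: mult_right_mono)
    qed (simp add: rho_eq_0)
  qed
  also have "\<dots> = d" by (simp add: integral_rho_reflect)
  finally show ?thesis .
qed

text \<open>Density argument: a continuous \<open>k\<close> near the truncation \<open>g\<close> of
  \<open>f\<close> is moved little by mollification, and \<open>g - k\<close> stays small because
  mollification is a contraction. Two applications of \<open>sqnorm_on_add\<close> give 2 + 2 * (2 +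
  2) = 10.\<close>

lemma mollify_tendsto_eps:
  assumes f: "L2loc f" and "0 < e"
  shows "\<forall>\<^sub>F n in sequentially. sqnorm_on (cball 0 R) (\<lambda>p. mollify f n p - f p) \<le> ennreal (10 * e)"
proof -
  have [measurable]: "f \<in> borel_measurable borel" using f unfolding L2loc_def by blast
  \<comment> \<open>The kernels are supported in the unit ball, so on \<open>cball 0 R\<close> the
    mollifications see only the values of \<open>f\<close> on
    \<open>cball 0 (R + 1)\<close>.\<close>
  define g where "g = (\<lambda>q. indicator (cball 0 (R + 1)) q *\<^sub>R f q)"
  have mono_fun[measurable]: "g \<in> borel_measurable borel" unfolding g_def by measurable
  have "sqnorm_on UNIV g = sqnorm_on (cball 0 (R + 1)) f"
    unfolding sqnorm_on_def g_def by (intro nn_integral_cong) (auto simp: indicator_def)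
  then have fin: "sqnorm_on UNIV g < \<infinity>" using f unfolding L2loc_def by simp
  have g0: "g p = 0" if "R + 1 < norm p" for p using that by (simp add: g_def)
  from approx_continuous[OF mono_fun fin g0 \<open>0 < e\<close>] obtain k
    where k: "continuous_on UNIV k" "csupp k" "sqnorm_on UNIV (\<lambda>p. g p - k p) \<le> ennreal e" by blast
  have [measurable]: "k \<in> borel_measurable borel" by (rule borel_measurable_continuous_onI[OF k(1)])
  have lk: "locint k" by (rule L2loc_imp_locint[OF L2loc_continuous[OF k(1)]])
  have lg: "locint g"
    using L2loc_imp_locint[of g] fin unfolding L2loc_def
    by (auto intro: le_less_trans[OF sqnorm_on_mono_set[of _ UNIV]])
  define m where "m = measure lborel (cball (0::c2) R)"
  \<comment> \<open>A uniform error \<open>d\<close> contributes at most \<open>d^2 * m\<close> to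
    the squared norm; \<open>m + 1\<close> in the denominator allows for
    \<open>m = 0\<close>.\<close>
  obtain d where d: "0 < d" "d\<^sup>2 * m \<le> e"
  proof
    show "0 < sqrt (e / (m + 1))" using \<open>0 < e\<close> by (simp add: m_def add_nonneg_pos)
    have m1: "0 \<le> m" by (simp add: m_def)
    have "(sqrt (e / (m + 1)))\<^sup>2 * m = e * (m / (m + 1))" using m1 \<open>0 < e\<close> by simp
    also have "\<dots> \<le> e * 1" using m1 \<open>0 < e\<close> by (intro mult_left_mono) (auto simp: divide_le_eq)
    finally show "(sqrt (e / (m + 1)))\<^sup>2 * m \<le> e" by simp
  qed
  have "uniformly_continuous_on (cball 0 (R + 1)) k"
    by (intro compact_uniformly_continuous) (use k continuous_on_subset in auto)
  then obtain s where s: "s > 0" "\<And>p q. p \<in> cball 0 (R + 1) \<Longrightarrow> q \<in> cball 0 (R + 1) \<Longrightarrow> dist q p < s \<Longrightarrow> dist (k q) (k p) < d"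
    unfolding uniformly_continuous_on_def using d(1) by meson
  have "\<forall>\<^sub>F n in sequentially. 1 / (real n + 1) < s"
  proof -
    have "(\<lambda>n. 1 / (real n + 1)) \<longlonglongrightarrow> 0"
      using LIMSEQ_inverse_real_of_nat by (simp add: inverse_eq_divide add.commute)
    then show ?thesis by (rule order_tendstoD(2)) (rule s)
  qed
  then show ?thesis
  proof eventually_elim
    case (elim n)
    have n1: "1 / (real n + 1) \<le> 1" by simp
    have mc[measurable]: "mollify (\<lambda>p. g p - k p) n \<in> borel_measurable borel" "mollify k n \<in> borel_measurable borel"
    proof -
      have "locint (\<lambda>p. g p - k p)" using lg lk unfolding locint_def by (auto simp: scaleR_diff_right)
      then show "mollify (\<lambda>p. g p - k p) n \<in> borel_measurable borel"
        by (intro borel_measurable_continuous_onI) (rule Ck_imp_continuous[OF Ck_mollify])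
      show "mollify k n \<in> borel_measurable borel"
        by (intro borel_measurable_continuous_onI) (rule Ck_imp_continuous[OF Ck_mollify[OF lk]])
    qed
    have split: "mollify f n p - f p = mollify (\<lambda>p. g p - k p) n p + ((mollify k n p - k p) + (k p - g p))" if p: "p \<in> cball 0 R" for p
    proof -
      have "conv g (\<lambda>p. complex_of_real (rho n p)) p = conv f (\<lambda>p. complex_of_real (rho n p)) p"
        unfolding g_def by (rule conv_restrict[of "1 / (real n + 1)"]) (use p n1 in \<open>auto simp: rho_eq_0 less_imp_le simp del: divide_le_eq_1_pos intro: add_mono\<close>)
      then have "mollify f n p = mollify g n p" by (simp add: mollify_def)
      moreover have "g p = f p" using p by (simp add: g_def)
      moreover have "mollify (\<lambda>p. g p - k p) n p = mollify g n p - mollify k n p"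
        unfolding mollify_def conv_def left_diff_distrib
        by (intro Bochner_Integration.integral_diff integrable_conv lg lk Ck_imp_continuous[OF Ck_rho] csupp_rho)
      ultimately show ?thesis by simp
    qed
    have kk: "sqnorm_on (cball 0 R) (\<lambda>p. mollify k n p - k p) \<le> ennreal e"
    proof -
      have *: "cmod (mollify k n p - k p) \<le> d" if p: "p \<in> cball 0 R" for p
      proof (rule mollify_continuous_approx[OF k(1,2)])
        fix q assume q: "norm (p - q) < 1 / (real n + 1)"
        have "norm q \<le> norm p + norm (p - q)" using norm_triangle_ineq2[of q p] by (simp add: norm_minus_commute)
        moreover have "norm p \<le> R" using p by simp
        ultimately have "norm q \<le> R + 1" using q n1 by linarith
        then have "q \<in> cball 0 (R + 1)" by simp
        moreover have "p \<in> cball 0 (R + 1)" using p by simp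
        moreover have "dist q p < s" using q elim by (simp add: dist_norm norm_minus_commute)
        ultimately show "norm (k q - k p) \<le> d" using s(2)[of p q] by (simp add: dist_norm less_imp_le)
      qed (use d in simp)
      have "sqnorm_on (cball 0 R) (\<lambda>p. mollify k n p - k p) \<le> (\<integral>\<^sup>+p. ennreal (d\<^sup>2) * indicator (cball 0 R) p \<partial>(lborel :: c2 measure))"
        unfolding sqnorm_on_def
      proof (rule nn_integral_mono)
        fix p
        show "indicator (cball 0 R) p * ennreal ((cmod (mollify k n p - k p))\<^sup>2) \<le> ennreal (d\<^sup>2) * indicator (cball 0 R) p"
          using *[of p] by (cases "p \<in> cball 0 R") (auto intro!: ennreal_leI power_mono)
      qed
      also have "\<dots> = ennreal (d\<^sup>2) * ennreal m"
        unfolding m_def using emeasure_lborel_cball_finite[of "0 :: c2" R]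
        by (simp add: nn_integral_cmult_indicator emeasure_eq_ennreal_measure)
      also have "\<dots> = ennreal (d\<^sup>2 * m)" by (simp add: ennreal_mult m_def)
      also have "\<dots> \<le> ennreal e" by (rule ennreal_leI[OF d(2)])
      finally show ?thesis .
    qed
    have kg: "sqnorm_on (cball 0 R) (\<lambda>p. k p - g p) \<le> ennreal e"
    proof -
      have "sqnorm_on (cball 0 R) (\<lambda>p. k p - g p) \<le> sqnorm_on UNIV (\<lambda>p. g p - k p)"
        unfolding sqnorm_on_def by (intro nn_integral_mono) (auto simp: indicator_def norm_minus_commute)
      then show ?thesis using k(3) by simp
    qed
    have mm: "sqnorm_on (cball 0 R) (mollify (\<lambda>p. g p - k p) n) \<le> ennreal e"
      using order_trans[OF sqnorm_on_mono_set[of "cball 0 R" UNIV] mollify_contraction[of "\<lambda>p. g p - k p" n]] k(3) by auto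
    have "sqnorm_on (cball 0 R) (\<lambda>p. mollify f n p - f p)
      = sqnorm_on (cball 0 R) (\<lambda>p. mollify (\<lambda>p. g p - k p) n p + ((mollify k n p - k p) + (k p - g p)))"
      by (rule sqnorm_on_cong[OF split])
    also have "\<dots> \<le> 2 * sqnorm_on (cball 0 R) (mollify (\<lambda>p. g p - k p) n) + 2 * sqnorm_on (cball 0 R) (\<lambda>p. (mollify k n p - k p) + (k p - g p))"
      by (intro sqnorm_on_add) auto
    also have "\<dots> \<le> 2 * sqnorm_on (cball 0 R) (mollify (\<lambda>p. g p - k p) n) + 2 * (2 * sqnorm_on (cball 0 R) (\<lambda>p. mollify k n p - k p) + 2 * sqnorm_on (cball 0 R) (\<lambda>p. k p - g p))"
      by (intro add_left_mono mult_left_mono sqnorm_on_add) auto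
    also have "\<dots> \<le> 2 * ennreal e + 2 * (2 * ennreal e + 2 * ennreal e)"
      by (intro add_mono mult_left_mono mm kk kg) auto
    also have "\<dots> = ennreal (10 * e)"
      using \<open>0 < e\<close> by (simp add: two_ennreal ennreal_plus[symmetric] del: ennreal_plus)
    finally show ?case .
  qed
qed

lemma mollify_tendsto:
  assumes f: "L2loc f"
  shows "(\<lambda>n. sqnorm_on (cball 0 R) (\<lambda>p. mollify f n p - f p)) \<longlonglongrightarrow> 0"
proof (rule order_tendstoI)
  fix a :: ennreal assume "0 < a"
  \<comment> \<open>The bound \<open>a\<close> may be infinite, so a finite value is placed strictly
    below it.\<close>
  then obtain e where e: "0 < e" "ennreal e < a"
    by (metis dense ennreal_less_zero_iff le_less_trans less_top_ennreal not_less_zero order_less_imp_le top_greatest ennreal_cases less_ennreal.rep_eq)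
  have "0 < e / 10" using e by simp
  from mollify_tendsto_eps[OF f this, of R] show "\<forall>\<^sub>F n in sequentially. sqnorm_on (cball 0 R) (\<lambda>p. mollify f n p - f p) < a"
    by eventually_elim (use e in \<open>auto intro: le_less_trans\<close>)
qed simp

section \<open>Weak derivatives and adjoints\<close>

lemma wnorm2_eq: "wnorm2 (monomial_weight \<Gamma>) f = (\<integral>\<^sup>+p. ennreal ((cmod (f p))\<^sup>2 * wexp \<Gamma> p) \<partial>lborel)"
  by (simp add: wnorm2_def wexp_def)

lemma winner_eq_wip: "winner (monomial_weight \<Gamma>) f g = wip \<Gamma> f g"
  by (simp add: winner_def wip_def cwexp_def wexp_def)

lemma wexp_le_1: "wexp \<Gamma> p \<le> 1"
proof -
  have "0 \<le> monomial_weight \<Gamma> p" by (auto simp: monomial_weight_def split_beta intro: sum_nonneg)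
  then show ?thesis by (simp add: wexp_def)
qed

lemma wexp_measurable [measurable]: "wexp \<Gamma> \<in> borel_measurable borel"
  by (rule borel_measurable_continuous_onI[OF continuous_wexp])

text \<open>On a ball the continuous positive weight attains a positive minimum, whose reciprocal
  compares the two norms.\<close>

lemma L2_imp_L2loc:
  assumes f: "f \<in> L2 (monomial_weight \<Gamma>)"
  shows "L2loc f"
  unfolding L2loc_def
proof (intro conjI allI)
  show m[measurable]: "f \<in> borel_measurable borel" using f by (simp add: L2_def)
  fix R
  show "sqnorm_on (cball 0 R) f < \<infinity>"
  proof (cases "cball (0 :: c2) R = {}")
    case True
    then show ?thesis by (simp add: sqnorm_on_def)
  next
    case False
    have "continuous_on (cball 0 R) (wexp \<Gamma>)" using continuous_wexp continuous_on_subset by blast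
    from continuous_attains_inf[OF compact_cball False this]
    obtain q where q: "\<And>p. p \<in> cball 0 R \<Longrightarrow> wexp \<Gamma> q \<le> wexp \<Gamma> p" by blast
    have q0: "0 < wexp \<Gamma> q" by (rule wexp_pos)
    have "sqnorm_on (cball 0 R) f \<le> (\<integral>\<^sup>+p. ennreal (1 / wexp \<Gamma> q) * ennreal ((cmod (f p))\<^sup>2 * wexp \<Gamma> p) \<partial>lborel)"
      unfolding sqnorm_on_def
    proof (rule nn_integral_mono)
      fix p
      show "indicator (cball 0 R) p * ennreal ((cmod (f p))\<^sup>2) \<le> ennreal (1 / wexp \<Gamma> q) * ennreal ((cmod (f p))\<^sup>2 * wexp \<Gamma> p)"
      proof (cases "p \<in> cball 0 R")
        case True
        have "(cmod (f p))\<^sup>2 * wexp \<Gamma> q \<le> (cmod (f p))\<^sup>2 * wexp \<Gamma> p" by (intro mult_left_mono q True) auto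
        then have "(cmod (f p))\<^sup>2 \<le> 1 / wexp \<Gamma> q * ((cmod (f p))\<^sup>2 * wexp \<Gamma> p)" using q0 by (simp add: pos_le_divide_eq)
        then have "ennreal ((cmod (f p))\<^sup>2) \<le> ennreal (1 / wexp \<Gamma> q * ((cmod (f p))\<^sup>2 * wexp \<Gamma> p))" by (rule ennreal_leI)
        also have "\<dots> = ennreal (1 / wexp \<Gamma> q) * ennreal ((cmod (f p))\<^sup>2 * wexp \<Gamma> p)"
          using q0 wexp_pos[of \<Gamma> p] by (intro ennreal_mult) auto
        finally show ?thesis using True by simp
      qed simp
    qed
    also have "\<dots> = ennreal (1 / wexp \<Gamma> q) * wnorm2 (monomial_weight \<Gamma>) f"
      unfolding wnorm2_eq by (intro nn_integral_cmult) measurable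
    also have "\<dots> < \<infinity>" using f by (simp add: L2_def ennreal_mult_less_top)
    finally show ?thesis .
  qed
qed

lemma ennreal_wsq:
  assumes "continuous_on UNIV f" "csupp f"
  shows "wnorm2 (monomial_weight \<Gamma>) f = ennreal (wsq \<Gamma> f)"
  unfolding wnorm2_eq wsq_def using integrable_weighted_square[OF assms, of "\<lambda>_. 1" \<Gamma>]
  by (intro nn_integral_eq_integral) (auto intro!: AE_I2 mult_nonneg_nonneg less_imp_le[OF wexp_pos])

lemma continuous_csupp_in_L2:
  assumes "continuous_on UNIV f" "csupp f"
  shows "f \<in> L2 (monomial_weight \<Gamma>)"
  using assms by (auto simp: L2_def ennreal_wsq intro: borel_measurable_continuous_onI)

lemma test_function_Ck: "test_function \<psi> \<Longrightarrow> Ck k \<psi>"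
  by (simp add: test_function_def)

lemma pdbar_represents:
  assumes f: "Ck (Suc 0) f" and \<psi>: "test_function \<psi>"
  shows "(\<integral>p. pdbar v f p * \<psi> p \<partial>lborel) = - (\<integral>p. f p * pdbar v \<psi> p \<partial>lborel)"
proof -
  have P: "Ck (Suc 0) \<psi>" "csupp \<psi>" using \<psi> test_function_Ck test_function_csupp by blast+
  have d: "f differentiable (at p)" "\<psi> differentiable (at p)" for p using f P by auto
  have "(\<integral>p. pdbar v (\<lambda>p. f p * \<psi> p) p \<partial>lborel) = 0"
    by (intro integral_pdbar Ck_mult f P csupp_mult_right)
  moreover have "integrable lborel (\<lambda>p. pdbar v f p * \<psi> p)" "integrable lborel (\<lambda>p. f p * pdbar v \<psi> p)"
    by (intro integrable_csupp csupp_mult_right P csupp_pdbar continuous_intros Ck_imp_continuous[OF Ck_pdbar[OF f]]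
      Ck_imp_continuous[OF Ck_pdbar[OF P(1)]] Ck_imp_continuous[OF f] Ck_imp_continuous[OF P(1)])+
  ultimately show ?thesis by (simp add: pdbar_mult d add_eq_0_iff2)
qed

lemma test_function_rho: "test_function (\<lambda>q. complex_of_real (rho n (p - q)))"
  by (intro test_functionI Ck_reflect[OF Ck_rho] csupp_reflect[OF csupp_rho])

text \<open>The values of a mollification are pairings with reflected kernels, which are test
  functions; so all mollifications of \<open>d\<close> vanish, while they converge to
  \<open>d\<close> in the mean on every ball.\<close>

lemma AE_zero_if_annihilates_test_functions:
  assumes d: "L2loc d" and ann: "\<And>\<psi>. test_function \<psi> \<Longrightarrow> (\<integral>p. d p * \<psi> p \<partial>lborel) = 0"
  shows "AE p in lborel. d p = 0"
proof -
  have [measurable]: "d \<in> borel_measurable borel" using d by (simp add: L2loc_def)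
  have "mollify d n p = 0" for n p
    unfolding mollify_def conv_def by (rule ann[OF test_function_rho])
  then have "sqnorm_on (cball 0 R) (\<lambda>p. 0 - d p) = 0" for R
    using mollify_tendsto[OF d, of R] by (simp add: LIMSEQ_const_iff)
  then have "AE p in lborel. indicator (cball 0 R) p * ennreal ((cmod (d p))\<^sup>2) = 0" for R
    unfolding sqnorm_on_def by (subst (asm) nn_integral_0_iff_AE) auto
  then have "AE p in lborel. \<forall>N::nat. indicator (cball 0 (real N)) p * ennreal ((cmod (d p))\<^sup>2) = 0"
    by (subst AE_all_countable) blast
  then show ?thesis
  proof eventually_elim
    case (elim p)
    obtain N :: nat where "norm p \<le> real N" using real_arch_simple by blast
    then show ?case using elim[rule_format, of N] by simp
  qed
qed

text \<open>\<open>dbar0\<close> chooses some representative, so agreement with the classical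
  derivatives can hold only almost everywhere; the fundamental lemma just above identifies any two
  representatives.\<close>

lemma dbar0_smooth:
  assumes f: "Ck (Suc 0) f" "csupp f"
  shows "f \<in> dom_dbar0 (monomial_weight \<Gamma>)"
    and "AE p in lborel. fst (dbar0 (monomial_weight \<Gamma>) f) p = pdbar (1,0) f p"
    and "AE p in lborel. snd (dbar0 (monomial_weight \<Gamma>) f) p = pdbar (0,1) f p"
    and "dbar0 (monomial_weight \<Gamma>) f \<in> L2_01 (monomial_weight \<Gamma>)"
proof -
  let ?\<phi> = "monomial_weight \<Gamma>"
  let ?g = "(pdbar (1,0) f, pdbar (0,1) f)"
  have nice: "pdbar v f \<in> L2 ?\<phi>" for v
    using nice_pdbar[OF f] unfolding nice_def by (intro continuous_csupp_in_L2) auto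
  have g: "?g \<in> L2_01 ?\<phi>" "is_dbar0 f ?g"
    by (simp_all add: L2_01_def nice is_dbar0_def represents_def dist_dzbar1_def dist_dzbar2_def dzbar1_eq dzbar2_eq pdbar_represents[OF f(1)])
  moreover have "f \<in> L2 ?\<phi>" by (intro continuous_csupp_in_L2 f Ck_imp_continuous[OF f(1)])
  ultimately show "f \<in> dom_dbar0 ?\<phi>" unfolding dom_dbar0_def by blast
  have D: "dbar0 ?\<phi> f \<in> L2_01 ?\<phi> \<and> is_dbar0 f (dbar0 ?\<phi> f)"
    unfolding dbar0_def using g by (intro someI[of "\<lambda>g. g \<in> L2_01 ?\<phi> \<and> is_dbar0 f g"]) simp
  then show L: "dbar0 ?\<phi> f \<in> L2_01 ?\<phi>" by blast
  have unique: "AE p in lborel. h p = k p" if h: "h \<in> L2 ?\<phi>" "k \<in> L2 ?\<phi>" and T: "represents h T" "represents k T" for h k T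
  proof -
    have hk: "L2loc h" "L2loc k" using h L2_imp_L2loc by blast+
    have "AE p in lborel. h p - k p = 0"
    proof (rule AE_zero_if_annihilates_test_functions[OF L2loc_diff[OF hk]])
      fix \<psi> assume \<psi>: "test_function \<psi>"
      have "integrable lborel (\<lambda>p. h p * \<psi> p)" "integrable lborel (\<lambda>p. k p * \<psi> p)"
        by (intro locint_mult_integrable L2loc_imp_locint hk Ck_imp_continuous[OF test_function_Ck[OF \<psi>]] test_function_csupp[OF \<psi>])+
      then show "(\<integral>p. (h p - k p) * \<psi> p \<partial>lborel) = 0"
        using T \<psi> by (simp add: left_diff_distrib represents_def)
    qed
    then show ?thesis by simp
  qed
  show "AE p in lborel. fst (dbar0 ?\<phi> f) p = pdbar (1,0) f p"
    by (rule unique[where T = "dist_dzbar1 f"]) (use L D g nice in \<open>auto simp: L2_01_def is_dbar0_def\<close>)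
  show "AE p in lborel. snd (dbar0 ?\<phi> f) p = pdbar (0,1) f p"
    by (rule unique[where T = "dist_dzbar2 f"]) (use L D g nice in \<open>auto simp: L2_01_def is_dbar0_def\<close>)
qed

lemma pd_reflect: "\<psi> differentiable (at (p - q)) \<Longrightarrow> pd v (\<lambda>q. \<psi> (p - q)) q = - pd v \<psi> (p - q)"
  by (simp add: pd_def dd_eq[OF reflect_has_derivative] field_simps)

text \<open>The operator has constant coefficients and hence commutes with convolution. Testing
  against the reflected kernel shows this, the sign from the reflection cancelling the sign in the
  distributional derivative.\<close>

lemma dbar1_mollify:
  assumes u: "L2loc u1" "L2loc u2" and h: "is_dbar1 (u1, u2) h"
  shows "pdbar (1,0) (mollify u2 n) p - pdbar (0,1) (mollify u1 n) p = mollify h n p"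
proof -
  let ?r = "\<lambda>p. complex_of_real (rho n p)"
  have r: "?r differentiable (at p)" for p by (rule Ck_imp_differentiable[OF Ck_rho])
  have lu: "locint u1" "locint u2" using u L2loc_imp_locint by blast+
  have "mollify h n p = dist_dzbar1 u2 (\<lambda>q. ?r (p - q)) - dist_dzbar2 u1 (\<lambda>q. ?r (p - q))"
    using h test_function_rho unfolding is_dbar1_def represents_def mollify_def conv_def by simp
  also have "\<dots> = (\<integral>q. u2 q * pdbar (1,0) ?r (p - q) \<partial>lborel) - (\<integral>q. u1 q * pdbar (0,1) ?r (p - q) \<partial>lborel)"
    unfolding dist_dzbar1_def dist_dzbar2_def dzbar1_eq dzbar2_eq by (simp add: pdbar_reflect[of ?r, OF r])
  also have "\<dots> = pdbar (1,0) (mollify u2 n) p - pdbar (0,1) (mollify u1 n) p"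
    unfolding mollify_def by (simp add: conv_pdbar[OF lu(1) Ck_rho csupp_rho] conv_pdbar[OF lu(2) Ck_rho csupp_rho])
  finally show ?thesis by simp
qed

text \<open>Turns the abstract duality into integrals with classical derivatives. It is stated for
  C^1 functions because the test functions of \<open>adjoint_mollify\<close>, a kernel times the
  inverse weight, are provided at that order.\<close>

lemma adjoint_on_smooth:
  assumes u: "(u1, u2) \<in> L2_01 (monomial_weight \<Gamma>)" and adj: "is_dbar_adj (monomial_weight \<Gamma>) (u1, u2) v"
    and f: "Ck (Suc 0) f" "csupp f"
  shows "wip \<Gamma> (pdbar (1,0) f) u1 + wip \<Gamma> (pdbar (0,1) f) u2 = wip \<Gamma> f v"
proof -
  let ?\<phi> = "monomial_weight \<Gamma>"
  note D = dbar0_smooth[OF f, of \<Gamma>]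
  have [measurable]: "cwexp \<Gamma> \<in> borel_measurable borel" "u1 \<in> borel_measurable borel" "u2 \<in> borel_measurable borel"
    "fst (dbar0 ?\<phi> f) \<in> borel_measurable borel" "snd (dbar0 ?\<phi> f) \<in> borel_measurable borel"
    using u D(4) by (auto simp: L2_01_def L2_def mem_Times_iff intro: borel_measurable_continuous_onI[OF continuous_cwexp])
  have m: "(\<lambda>p. g p * cnj (k p) * cwexp \<Gamma> p) \<in> borel_measurable lborel"
    if [measurable]: "g \<in> borel_measurable borel" "k \<in> borel_measurable borel" for g k
  proof -
    have [measurable]: "(\<lambda>p. cnj (k p)) \<in> borel_measurable borel"
      by (rule borel_measurable_continuous_on[of cnj]) (auto intro: continuous_intros)
    show ?thesis by measurable
  qed
  have pm[measurable]: "pdbar v f \<in> borel_measurable borel" for v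
    by (rule borel_measurable_continuous_onI[OF Ck_imp_continuous[OF Ck_pdbar[OF f(1)]]])
  have "winner_01 ?\<phi> (dbar0 ?\<phi> f) (u1, u2) = winner ?\<phi> f v"
    using adj D(1) unfolding is_dbar_adj_def by blast
  moreover have "wip \<Gamma> (fst (dbar0 ?\<phi> f)) u1 = wip \<Gamma> (pdbar (1,0) f) u1"
    unfolding wip_def using D(2) by (intro integral_cong_AE m) auto
  moreover have "wip \<Gamma> (snd (dbar0 ?\<phi> f)) u2 = wip \<Gamma> (pdbar (0,1) f) u2"
    unfolding wip_def using D(3) by (intro integral_cong_AE m) auto
  ultimately show ?thesis by (simp add: winner_01_def winner_eq_wip)
qed

text \<open>The first-order part of the adjoint has constant coefficients and passes to the
  mollification of the form. The zeroth-order part does not, and so enters as the mollification of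
  the whole product of \<open>2 * pd_phi\<close> with the form; the discrepancy is estimated on
  balls later.\<close>

lemma adjoint_mollify:
  assumes u: "(u1, u2) \<in> L2_01 (monomial_weight \<Gamma>)" and v: "v \<in> L2 (monomial_weight \<Gamma>)"
    and adj: "is_dbar_adj (monomial_weight \<Gamma>) (u1, u2) v"
  shows "pd (1,0) (mollify u1 n) p + pd (0,1) (mollify u2 n) p
    = mollify (\<lambda>q. 2 * pd_phi \<Gamma> (1,0) q * u1 q + 2 * pd_phi \<Gamma> (0,1) q * u2 q) n p - mollify v n p"
proof -
  let ?r = "\<lambda>p. complex_of_real (rho n p)"
  define \<theta> where "\<theta> = (\<lambda>q. ?r (p - q))"
  \<comment> \<open>Testing the adjoint relation with \<open>\<theta> exp(2\<phi>)\<close> removes the weight.\<close>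
  define E where "E = (\<lambda>p. exp (2 * (\<Sum>\<gamma>\<in>\<Gamma>. mono_fun \<gamma> p * cnj (mono_fun \<gamma> p))))"
  have r: "?r differentiable (at p)" for p by (rule Ck_imp_differentiable[OF Ck_rho])
  have \<theta>: "Ck k \<theta>" "csupp \<theta>" for k
    unfolding \<theta>_def by (intro Ck_reflect[OF Ck_rho] csupp_reflect[OF csupp_rho])+
  have E: "Ck (Suc 0) E" unfolding E_def by (intro Ck_exp Ck_intros Ck_mono_fun)
  have d: "\<theta> differentiable (at q)" "E differentiable (at q)" for q
    by (rule Ck_imp_differentiable[OF \<theta>(1)], rule Ck_imp_differentiable[OF E])
  have EW: "E q * cwexp \<Gamma> q = 1" for q
    unfolding E_def cwexp_eq by (simp add: exp_add[symmetric])
  have u12: "L2loc u1" "L2loc u2" using u L2_imp_L2loc by (auto simp: L2_01_def)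
  have lu: "locint u1" "locint u2" "locint v" using u12 L2_imp_L2loc[OF v] L2loc_imp_locint by blast+
  have c\<theta>: "cnj (\<theta> q) = \<theta> q" for q by (simp add: \<theta>_def)
  have pd\<theta>: "cnj (pdbar e \<theta> q) = pd e \<theta> q" for e q
    using pd_cnj[OF d(1), of e q] by (simp add: c\<theta>)
  have pdr: "pd e \<theta> q = - pd e ?r (p - q)" for e q
    unfolding \<theta>_def by (rule pd_reflect[of ?r, OF r])
  have main: "wip \<Gamma> (pdbar (1,0) (\<lambda>q. \<theta> q * E q)) u1 + wip \<Gamma> (pdbar (0,1) (\<lambda>q. \<theta> q * E q)) u2 = wip \<Gamma> (\<lambda>q. \<theta> q * E q) v"
    by (intro adjoint_on_smooth[OF u adj] Ck_mult \<theta> E csupp_mult_left)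
  have R: "wip \<Gamma> (\<lambda>q. \<theta> q * E q) v = cnj (mollify v n p)"
  proof -
    have "wip \<Gamma> (\<lambda>q. \<theta> q * E q) v = (\<integral>q. cnj (v q * \<theta> q) \<partial>lborel)"
      unfolding wip_def
    proof (intro Bochner_Integration.integral_cong refl)
      fix q
      have "\<theta> q * E q * cnj (v q) * cwexp \<Gamma> q = \<theta> q * cnj (v q) * (E q * cwexp \<Gamma> q)" by (simp only: mult_ac)
      then show "\<theta> q * E q * cnj (v q) * cwexp \<Gamma> q = cnj (v q * \<theta> q)" by (simp add: EW c\<theta>)
    qed
    also have "\<dots> = cnj (mollify v n p)"
      unfolding mollify_def conv_def \<theta>_def by (rule Bochner_Integration.integral_cnj)
    finally show ?thesis .
  qed
  have i1: "integrable lborel (\<lambda>q. k q * pd e ?r (p - q))" if "locint k" for k e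
    by (rule integrable_conv[OF that Ck_imp_continuous[OF Ck_pd[OF Ck_rho]] csupp_pd[OF Ck_rho csupp_rho]])
  have i2: "integrable lborel (\<lambda>q. (2 * pd_phi \<Gamma> e q * k q) * ?r (p - q))" if "L2loc k" for k e
    by (intro integrable_conv L2loc_imp_locint L2loc_mult that continuous_intros Ck_imp_continuous[OF Ck_pd_phi] Ck_imp_continuous[OF Ck_rho] csupp_rho)
  have L: "wip \<Gamma> (pdbar e (\<lambda>q. \<theta> q * E q)) k = cnj (mollify (\<lambda>q. 2 * pd_phi \<Gamma> e q * k q) n p - pd e (mollify k n) p)" if k: "L2loc k" for k e
  proof -
    have "wip \<Gamma> (pdbar e (\<lambda>q. \<theta> q * E q)) k = (\<integral>q. cnj ((2 * pd_phi \<Gamma> e q * k q) * ?r (p - q) - k q * pd e ?r (p - q)) \<partial>lborel)"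
      unfolding wip_def
    proof (intro Bochner_Integration.integral_cong refl)
      fix q
      have "pdbar e (\<lambda>q. \<theta> q * E q) q = (pdbar e \<theta> q + \<theta> q * (2 * cnj (pd_phi \<Gamma> e q))) * E q"
        unfolding pdbar_mult[OF d] unfolding E_def pdbar_exp_weight by (simp add: algebra_simps)
      then have "pdbar e (\<lambda>q. \<theta> q * E q) q * cnj (k q) * cwexp \<Gamma> q
        = (pdbar e \<theta> q + \<theta> q * (2 * cnj (pd_phi \<Gamma> e q))) * cnj (k q) * (E q * cwexp \<Gamma> q)"
        by (simp only: mult_ac)
      also have "\<dots> = cnj ((cnj (pdbar e \<theta> q) + cnj (\<theta> q) * (2 * pd_phi \<Gamma> e q)) * k q)"
        by (simp add: EW)
      also have "(cnj (pdbar e \<theta> q) + cnj (\<theta> q) * (2 * pd_phi \<Gamma> e q)) * k q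
          = (2 * pd_phi \<Gamma> e q * k q) * ?r (p - q) - k q * pd e ?r (p - q)"
        unfolding pd\<theta> c\<theta> pdr by (simp add: \<theta>_def algebra_simps)
      finally show "pdbar e (\<lambda>q. \<theta> q * E q) q * cnj (k q) * cwexp \<Gamma> q
          = cnj ((2 * pd_phi \<Gamma> e q * k q) * ?r (p - q) - k q * pd e ?r (p - q))" .
    qed
    also have "\<dots> = cnj ((\<integral>q. (2 * pd_phi \<Gamma> e q * k q) * ?r (p - q) \<partial>lborel) - (\<integral>q. k q * pd e ?r (p - q) \<partial>lborel))"
      unfolding Bochner_Integration.integral_cnj
      by (subst Bochner_Integration.integral_diff[OF i2[OF k] i1[OF L2loc_imp_locint[OF k]]]) simp
    also have "(\<integral>q. k q * pd e ?r (p - q) \<partial>lborel) = pd e (mollify k n) p"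
      unfolding mollify_def by (rule conv_pdbar(2)[OF L2loc_imp_locint[OF k] Ck_rho csupp_rho, symmetric])
    finally show ?thesis by (simp add: mollify_def conv_def)
  qed
  have "mollify (\<lambda>q. 2 * pd_phi \<Gamma> (1,0) q * u1 q + 2 * pd_phi \<Gamma> (0,1) q * u2 q) n p
      = mollify (\<lambda>q. 2 * pd_phi \<Gamma> (1,0) q * u1 q) n p + mollify (\<lambda>q. 2 * pd_phi \<Gamma> (0,1) q * u2 q) n p"
    unfolding mollify_def conv_def distrib_right
    by (rule Bochner_Integration.integral_add[OF i2[OF u12(1)] i2[OF u12(2)]])
  moreover have "(mollify (\<lambda>q. 2 * pd_phi \<Gamma> (1,0) q * u1 q) n p - pd (1,0) (mollify u1 n) p)
      + (mollify (\<lambda>q. 2 * pd_phi \<Gamma> (0,1) q * u2 q) n p - pd (0,1) (mollify u2 n) p) = mollify v n p"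
    using main unfolding L[OF u12(1)] L[OF u12(2)] R
    by (simp only: complex_cnj_add[symmetric] complex_cnj_cancel_iff)
  ultimately show ?thesis by (simp add: algebra_simps)
qed

section \<open>Localization\<close>

text \<open>The factor \<open>exp 1\<close> normalises the value at the origin to 1, since
  \<open>flat 0 1 = exp (-1)\<close>.\<close>

definition cutoff :: "real \<Rightarrow> c2 \<Rightarrow> complex" where
  "cutoff R p = complex_of_real (exp 1) * complex_of_real (bump 0 (1 / R\<^sup>2) p)"

lemma Ck_cutoff: "Ck k (cutoff R)"
  unfolding cutoff_def[abs_def] by (intro Ck_cmult Ck_bump)

text \<open>For the derivative bound: \<open>flat 0\<close> has derivative \<open>flat 2\<close>,
  which on arguments up to 1 is at most 4^4 = 256 by \<open>flat_le_square\<close>, and the inner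
  derivative is at most \<open>2 / R\<close> on the support. The decay in \<open>R\<close> is what
  removes the cutoff error at the end.\<close>

lemma cutoff_bounds:
  assumes R: "1 \<le> R"
  shows "cmod (cutoff R p) \<le> 1"
    and "norm p \<le> R / 2 \<Longrightarrow> 1 / 2 \<le> cmod (cutoff R p)"
    and "R < norm p \<Longrightarrow> cutoff R p = 0"
    and "norm v = 1 \<Longrightarrow> cmod (dd (cutoff R) v p) \<le> 512 * exp 1 / R"
    and "R < norm p \<Longrightarrow> dd (cutoff R) v p = 0"
proof -
  let ?k = "1 / R\<^sup>2"
  have x1: "1 - ?k * (norm p)\<^sup>2 \<le> 1" by simp
  have "flat 0 x \<le> exp (- 1)" if "x \<le> 1" for x using that by (auto simp: flat_def)
  then have "exp 1 * bump 0 ?k p \<le> exp 1 * exp (- 1)"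
    unfolding bump_def using x1 by (intro mult_left_mono) auto
  then show "cmod (cutoff R p) \<le> 1"
    unfolding cutoff_def by (simp add: norm_mult bump_nonneg exp_minus)
  show "1 / 2 \<le> cmod (cutoff R p)" if "norm p \<le> R / 2"
  proof -
    have "(norm p)\<^sup>2 \<le> (R / 2)\<^sup>2" using that by (intro power_mono) auto
    then have "?k * (norm p)\<^sup>2 \<le> ?k * (R / 2)\<^sup>2" by (rule mult_left_mono) simp
    also have "\<dots> = 1 / 4" using R by (simp add: power_divide)
    finally have x: "3 / 4 \<le> 1 - ?k * (norm p)\<^sup>2" by linarith
    \<comment> \<open>For \<open>norm p \<le> R / 2\<close> the argument of \<open>flat 0\<close> is
      at least 3/4, so the cutoff is at least \<open>exp (1 - 4 / 3) \<ge> 2 / 3\<close>.\<close>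
    have "exp (- (4 / 3)) \<le> flat 0 y" if "3 / 4 \<le> y" for y using that by (simp add: flat_def divide_le_eq)
    from this[OF x] have "exp (- (4 / 3)) \<le> bump 0 ?k p" unfolding bump_def .
    then have "exp 1 * exp (- (4 / 3)) \<le> exp 1 * bump 0 ?k p" by (intro mult_left_mono) auto
    moreover have "exp 1 * exp (- (4 / 3)) = exp (- 1 / 3 :: real)" by (simp add: exp_add[symmetric])
    moreover have "1 + (- 1 / 3) \<le> exp (- 1 / 3 :: real)" by (rule exp_ge_add_one_self)
    ultimately have "1 / 2 \<le> exp 1 * bump 0 ?k p" by linarith
    then show ?thesis unfolding cutoff_def by (simp add: norm_mult bump_nonneg)
  qed
  have zero: "bump j ?k p = 0" if "R < norm p" for j
  proof (rule bump_eq_0)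
    have "R\<^sup>2 \<le> (norm p)\<^sup>2" using that R by (intro power_mono) auto
    then show "1 \<le> ?k * (norm p)\<^sup>2" using R by simp
  qed
  then show "cutoff R p = 0" if "R < norm p" using that by (simp add: cutoff_def)
  have d: "dd (cutoff R) v p = complex_of_real (exp 1 * bump 2 ?k p * (- 2 * ?k * (p \<bullet> v)))" for v
  proof -
    have "(\<lambda>p. complex_of_real (bump 0 ?k p)) differentiable (at p)" by (rule differentiableI[OF bump_has_derivative])
    then have "dd (cutoff R) v p = complex_of_real (exp 1) * dd (\<lambda>p. complex_of_real (bump 0 ?k p)) v p"
      unfolding cutoff_def[abs_def] by (subst dd_mult) auto
    then show ?thesis by (simp add: dd_eq[OF bump_has_derivative] numeral_2_eq_2)
  qed
  then show "dd (cutoff R) v p = 0" if "R < norm p" using zero[OF that] by simp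
  show "cmod (dd (cutoff R) v p) \<le> 512 * exp 1 / R" if "norm v = 1"
  proof (cases "R < norm p")
    case True
    then show ?thesis using d[of v] zero[of 2] R by simp
  next
    case False
    have "flat 2 x \<le> 256" if "x \<le> 1" for x
    proof (cases "0 < x")
      case True
      have "flat 2 x \<le> 256 * x\<^sup>2" using flat_le_square[of 2 x] by simp
      also have "x\<^sup>2 \<le> 1" using that True by (simp add: power_le_one)
      finally show ?thesis by simp
    qed (simp add: flat_def)
    then have b: "bump 2 ?k p \<le> 256" unfolding bump_def using x1 by blast
    have "\<bar>p \<bullet> v\<bar> \<le> norm p * norm v" by (rule Cauchy_Schwarz_ineq2)
    also have "\<dots> \<le> R" using False that by simp
    finally have pv: "\<bar>p \<bullet> v\<bar> \<le> R" .
    have "cmod (dd (cutoff R) v p) = exp 1 * bump 2 ?k p * (2 * ?k * \<bar>p \<bullet> v\<bar>)"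
      unfolding d norm_of_real abs_mult using bump_nonneg[of 2 ?k p] by simp
    also have "\<dots> \<le> exp 1 * 256 * (2 * ?k * R)"
      using b pv bump_nonneg[of 2 ?k p] by (intro mult_mono) auto
    also have "\<dots> = 512 * exp 1 / R" using R by (simp add: power2_eq_square)
    finally show ?thesis .
  qed
qed

lemma csupp_cutoff: "1 \<le> R \<Longrightarrow> csupp (cutoff R)"
  unfolding csupp_def using cutoff_bounds(3) by blast

lemma cutoff_wirtinger_bounds:
  assumes R: "1 \<le> R" and v: "v \<in> {(1,0), (0,1)}"
  shows "cmod (pdbar v (cutoff R) p) \<le> 512 * exp 1 / R" "cmod (pd v (cutoff R) p) \<le> 512 * exp 1 / R"
    and "R < norm p \<Longrightarrow> pdbar v (cutoff R) p = 0" "R < norm p \<Longrightarrow> pd v (cutoff R) p = 0"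
proof -
  have n: "norm v = 1" "norm (imul v) = 1" using v by (auto simp: imul_def norm_Pair)
  note b = cutoff_bounds(4)[OF R n(1), of p] cutoff_bounds(4)[OF R n(2), of p]
  have "cmod (dd (cutoff R) v p + \<i> * dd (cutoff R) (imul v) p) \<le> 512 * exp 1 / R + 512 * exp 1 / R"
    by (intro order_trans[OF norm_triangle_ineq] add_mono b(1)) (simp add: norm_mult b(2))
  then show "cmod (pdbar v (cutoff R) p) \<le> 512 * exp 1 / R" by (simp add: pdbar_def norm_divide)
  have "cmod (dd (cutoff R) v p - \<i> * dd (cutoff R) (imul v) p) \<le> 512 * exp 1 / R + 512 * exp 1 / R"
    by (intro order_trans[OF norm_triangle_ineq4] add_mono b(1)) (simp add: norm_mult b(2))
  then show "cmod (pd v (cutoff R) p) \<le> 512 * exp 1 / R" by (simp add: pd_def norm_divide)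
  show "R < norm p \<Longrightarrow> pdbar v (cutoff R) p = 0" "R < norm p \<Longrightarrow> pd v (cutoff R) p = 0"
    by (simp_all add: pdbar_def pd_def cutoff_bounds(5)[OF R])
qed

lemma square_sum4_le: "(a + b + c + d)\<^sup>2 \<le> 4 * (a\<^sup>2 + b\<^sup>2 + c\<^sup>2 + d\<^sup>2)" for a b c d :: real
  using zero_le_power2[of "a - b"] zero_le_power2[of "a - c"] zero_le_power2[of "a - d"]
    zero_le_power2[of "b - c"] zero_le_power2[of "b - d"] zero_le_power2[of "c - d"]
  by (simp add: power2_eq_square algebra_simps)

lemma square_sum3_le: "(a + b + c)\<^sup>2 \<le> 3 * (a\<^sup>2 + b\<^sup>2 + c\<^sup>2)" for a b c :: real
  using zero_le_power2[of "a - b"] zero_le_power2[of "a - c"] zero_le_power2[of "b - c"]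
  by (simp add: power2_eq_square algebra_simps)

lemma norm_mult_le: "cmod x \<le> c \<Longrightarrow> cmod (x * y) \<le> c * cmod y"
  by (simp add: norm_mult mult_right_mono)

text \<open>Here \<open>x\<close> is the cutoff, \<open>a1, b1\<close> and \<open>a2, b2\<close> are
  its \<open>pdbar\<close>- and \<open>pd\<close>-derivatives, and \<open>A1, A2\<close> are the
  coefficients \<open>2 * pd_phi\<close>; \<open>H, V, G, m1, m2\<close> are the mollifications of
  \<open>h, v, g, u1, u2\<close>. Every mollified quantity is written as the original plus a
  difference. The originals keep an absolute constant or the small factor \<open>c^2\<close>; the
  bound \<open>B\<close> of the coefficients multiplies differences only.\<close>

lemma localization_error:
  fixes x a1 b1 a2 b2 A1 A2 h v u1 u2 H V G g m1 m2 :: complex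
  assumes x: "cmod x \<le> 1" and ab: "cmod a1 \<le> c" "cmod b1 \<le> c" "cmod a2 \<le> c" "cmod b2 \<le> c"
    and B: "1 \<le> B" "cmod A1 + c \<le> B" "cmod A2 + c \<le> B" and g: "g = A1 * u1 + A2 * u2"
  shows "(cmod (x * H + a1 * m2 - b1 * m1))\<^sup>2 + (cmod (x * (V - G) + x * (A1 * m1 + A2 * m2) - a2 * m1 - b2 * m2))\<^sup>2
    \<le> 12 * ((cmod h)\<^sup>2 + (cmod v)\<^sup>2 + c\<^sup>2 * ((cmod u1)\<^sup>2 + (cmod u2)\<^sup>2))
      + 16 * B\<^sup>2 * ((cmod (H - h))\<^sup>2 + (cmod (V - v))\<^sup>2 + (cmod (G - g))\<^sup>2 + (cmod (m1 - u1))\<^sup>2 + (cmod (m2 - u2))\<^sup>2)"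
proof -
  have c: "0 \<le> c" "c \<le> B" using ab(1) B(2) norm_ge_zero[of a1] norm_ge_zero[of A1] by linarith+
  have B0: "0 \<le> B" using B by simp
  have main: "(cmod (x * k + s * y + t * z))\<^sup>2 \<le> 3 * ((cmod k)\<^sup>2 + c\<^sup>2 * (cmod y)\<^sup>2 + c\<^sup>2 * (cmod z)\<^sup>2)"
    if "cmod s \<le> c" "cmod t \<le> c" for s t k y z
  proof -
    have "cmod (x * k + s * y + t * z) \<le> cmod (x * k) + cmod (s * y) + cmod (t * z)"
      by (intro order_trans[OF norm_triangle_ineq] add_right_mono norm_triangle_ineq)
    also have "\<dots> \<le> 1 * cmod k + c * cmod y + c * cmod z"
      by (intro add_mono norm_mult_le x that)
    finally have "(cmod (x * k + s * y + t * z))\<^sup>2 \<le> (1 * cmod k + c * cmod y + c * cmod z)\<^sup>2"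
      by (intro power_mono) auto
    also have "\<dots> \<le> 3 * ((1 * cmod k)\<^sup>2 + (c * cmod y)\<^sup>2 + (c * cmod z)\<^sup>2)" by (rule square_sum3_le)
    finally show ?thesis by (simp add: power_mult_distrib)
  qed
  have err: "(cmod (q * k + r * l + s * y + t * z))\<^sup>2 \<le> 4 * B\<^sup>2 * ((cmod k)\<^sup>2 + (cmod l)\<^sup>2 + (cmod y)\<^sup>2 + (cmod z)\<^sup>2)"
    if "cmod q \<le> B" "cmod r \<le> B" "cmod s \<le> B" "cmod t \<le> B" for q r s t k l y z
  proof -
    have "cmod (q * k + r * l + s * y + t * z) \<le> cmod (q * k) + cmod (r * l) + cmod (s * y) + cmod (t * z)"
      by (intro order_trans[OF norm_triangle_ineq] add_right_mono norm_triangle_ineq)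
    also have "\<dots> \<le> B * cmod k + B * cmod l + B * cmod y + B * cmod z"
      by (intro add_mono norm_mult_le that)
    finally have "(cmod (q * k + r * l + s * y + t * z))\<^sup>2 \<le> (B * cmod k + B * cmod l + B * cmod y + B * cmod z)\<^sup>2"
      by (intro power_mono) auto
    also have "\<dots> \<le> 4 * ((B * cmod k)\<^sup>2 + (B * cmod l)\<^sup>2 + (B * cmod y)\<^sup>2 + (B * cmod z)\<^sup>2)" by (rule square_sum4_le)
    finally show ?thesis by (simp add: power_mult_distrib distrib_left mult.assoc)
  qed
  have xB: "cmod x \<le> B" "cmod (- x) \<le> B" using x B by auto
  have sB: "cmod (x * A1 - a2) \<le> B" "cmod (x * A2 - b2) \<le> B"
    using norm_triangle_ineq4[of "x * A1" a2] norm_triangle_ineq4[of "x * A2" b2] norm_mult_le[OF x, of A1] norm_mult_le[OF x, of A2] ab B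
    by linarith+
  define D where "D = (cmod (H - h))\<^sup>2 + (cmod (V - v))\<^sup>2 + (cmod (G - g))\<^sup>2 + (cmod (m1 - u1))\<^sup>2 + (cmod (m2 - u2))\<^sup>2"
  \<comment> \<open>The product \<open>0 * 0\<close> pads the error to the four terms that
    \<open>err\<close> expects.\<close>
  have "x * H + a1 * m2 - b1 * m1 = (x * h + a1 * u2 + (- b1) * u1) + (x * (H - h) + 0 * 0 + a1 * (m2 - u2) + (- b1) * (m1 - u1))"
    by (simp add: algebra_simps)
  then have "(cmod (x * H + a1 * m2 - b1 * m1))\<^sup>2 \<le> 2 * (cmod (x * h + a1 * u2 + (- b1) * u1))\<^sup>2
      + 2 * (cmod (x * (H - h) + 0 * 0 + a1 * (m2 - u2) + (- b1) * (m1 - u1)))\<^sup>2"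
    by (simp only: square_add_le)
  also have "\<dots> \<le> 2 * (3 * ((cmod h)\<^sup>2 + c\<^sup>2 * (cmod u2)\<^sup>2 + c\<^sup>2 * (cmod u1)\<^sup>2))
      + 2 * (4 * B\<^sup>2 * ((cmod (H - h))\<^sup>2 + (cmod 0)\<^sup>2 + (cmod (m2 - u2))\<^sup>2 + (cmod (m1 - u1))\<^sup>2))"
    by (intro add_mono mult_left_mono main err xB) (use ab c B0 in auto)
  also have "\<dots> \<le> 6 * ((cmod h)\<^sup>2 + c\<^sup>2 * (cmod u2)\<^sup>2 + c\<^sup>2 * (cmod u1)\<^sup>2) + 8 * (B\<^sup>2 * D)"
  proof -
    have "B\<^sup>2 * ((cmod (H - h))\<^sup>2 + (cmod 0)\<^sup>2 + (cmod (m2 - u2))\<^sup>2 + (cmod (m1 - u1))\<^sup>2) \<le> B\<^sup>2 * D"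
      by (intro mult_left_mono) (auto simp: D_def)
    then show ?thesis by (simp add: mult.assoc)
  qed
  finally have 1: "(cmod (x * H + a1 * m2 - b1 * m1))\<^sup>2 \<le> 6 * ((cmod h)\<^sup>2 + c\<^sup>2 * (cmod u2)\<^sup>2 + c\<^sup>2 * (cmod u1)\<^sup>2) + 8 * (B\<^sup>2 * D)" .
  \<comment> \<open>Here \<open>g = A1 * u1 + A2 * u2\<close> makes the zeroth-order terms cancel up
    to differences, so no coefficient \<open>A1\<close> or \<open>A2\<close> multiplies an
    original.\<close>
  have "x * (V - G) + x * (A1 * m1 + A2 * m2) - a2 * m1 - b2 * m2 = (x * v + (- a2) * u1 + (- b2) * u2)
     + (x * (V - v) + (- x) * (G - g) + (x * A1 - a2) * (m1 - u1) + (x * A2 - b2) * (m2 - u2))"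
    by (simp add: g algebra_simps)
  then have "(cmod (x * (V - G) + x * (A1 * m1 + A2 * m2) - a2 * m1 - b2 * m2))\<^sup>2 \<le> 2 * (cmod (x * v + (- a2) * u1 + (- b2) * u2))\<^sup>2
     + 2 * (cmod (x * (V - v) + (- x) * (G - g) + (x * A1 - a2) * (m1 - u1) + (x * A2 - b2) * (m2 - u2)))\<^sup>2"
    by (simp only: square_add_le)
  also have "\<dots> \<le> 2 * (3 * ((cmod v)\<^sup>2 + c\<^sup>2 * (cmod u1)\<^sup>2 + c\<^sup>2 * (cmod u2)\<^sup>2))
      + 2 * (4 * B\<^sup>2 * ((cmod (V - v))\<^sup>2 + (cmod (G - g))\<^sup>2 + (cmod (m1 - u1))\<^sup>2 + (cmod (m2 - u2))\<^sup>2))"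
    by (intro add_mono mult_left_mono main err xB sB) (use ab in auto)
  also have "\<dots> \<le> 6 * ((cmod v)\<^sup>2 + c\<^sup>2 * (cmod u1)\<^sup>2 + c\<^sup>2 * (cmod u2)\<^sup>2) + 8 * (B\<^sup>2 * D)"
  proof -
    have "B\<^sup>2 * ((cmod (V - v))\<^sup>2 + (cmod (G - g))\<^sup>2 + (cmod (m1 - u1))\<^sup>2 + (cmod (m2 - u2))\<^sup>2) \<le> B\<^sup>2 * D"
      by (intro mult_left_mono) (auto simp: D_def)
    then show ?thesis by (simp add: mult.assoc)
  qed
  finally have 2: "(cmod (x * (V - G) + x * (A1 * m1 + A2 * m2) - a2 * m1 - b2 * m2))\<^sup>2
     \<le> 6 * ((cmod v)\<^sup>2 + c\<^sup>2 * (cmod u1)\<^sup>2 + c\<^sup>2 * (cmod u2)\<^sup>2) + 8 * (B\<^sup>2 * D)" .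
  have "(cmod (x * H + a1 * m2 - b1 * m1))\<^sup>2 + (cmod (x * (V - G) + x * (A1 * m1 + A2 * m2) - a2 * m1 - b2 * m2))\<^sup>2
    \<le> 6 * (cmod h)\<^sup>2 + 6 * (cmod v)\<^sup>2 + 12 * (c\<^sup>2 * ((cmod u1)\<^sup>2 + (cmod u2)\<^sup>2)) + 16 * (B\<^sup>2 * D)"
    using 1 2 unfolding distrib_left by linarith
  also have "\<dots> \<le> 12 * ((cmod h)\<^sup>2 + (cmod v)\<^sup>2 + c\<^sup>2 * ((cmod u1)\<^sup>2 + (cmod u2)\<^sup>2)) + 16 * B\<^sup>2 * D"
    by simp
  finally show ?thesis unfolding D_def .
qed

lemma ennreal_lin:
  "0 \<le> \<alpha> \<Longrightarrow> 0 \<le> x \<Longrightarrow> 0 \<le> \<beta> \<Longrightarrow> 0 \<le> y \<Longrightarrow> ennreal (\<alpha> * x + \<beta> * y) = ennreal \<alpha> * ennreal x + ennreal \<beta> * ennreal y"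
  by (simp add: ennreal_mult)

lemma localized_forms:
  fixes R :: real
  assumes u: "(u1, u2) \<in> L2_01 (monomial_weight \<Gamma>)" and v: "v \<in> L2 (monomial_weight \<Gamma>)"
    and h: "is_dbar1 (u1, u2) h" and adj: "is_dbar_adj (monomial_weight \<Gamma>) (u1, u2) v"
  defines "U1 \<equiv> \<lambda>n p. cutoff R p * mollify u1 n p" and "U2 \<equiv> \<lambda>n p. cutoff R p * mollify u2 n p"
    and "g \<equiv> \<lambda>q. 2 * pd_phi \<Gamma> (1,0) q * u1 q + 2 * pd_phi \<Gamma> (0,1) q * u2 q"
  shows "pdbar (1,0) (U2 n) p - pdbar (0,1) (U1 n) p = cutoff R p * mollify h n p
      + pdbar (1,0) (cutoff R) p * mollify u2 n p - pdbar (0,1) (cutoff R) p * mollify u1 n p"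
    and "pdbar_adj \<Gamma> (1,0) (U1 n) p + pdbar_adj \<Gamma> (0,1) (U2 n) p = cutoff R p * (mollify v n p - mollify g n p)
      + cutoff R p * (2 * pd_phi \<Gamma> (1,0) p * mollify u1 n p + 2 * pd_phi \<Gamma> (0,1) p * mollify u2 n p)
      - pd (1,0) (cutoff R) p * mollify u1 n p - pd (0,1) (cutoff R) p * mollify u2 n p"
proof -
  have u12: "L2loc u1" "L2loc u2" using u L2_imp_L2loc by (auto simp: L2_01_def)
  have d: "cutoff R differentiable (at p)" "mollify u1 n differentiable (at p)" "mollify u2 n differentiable (at p)"
    by (intro Ck_imp_differentiable[of 0] Ck_cutoff Ck_mollify L2loc_imp_locint u12)+
  show "pdbar (1,0) (U2 n) p - pdbar (0,1) (U1 n) p = cutoff R p * mollify h n p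
      + pdbar (1,0) (cutoff R) p * mollify u2 n p - pdbar (0,1) (cutoff R) p * mollify u1 n p"
    unfolding U1_def U2_def pdbar_mult[OF d(1,2)] pdbar_mult[OF d(1,3)] dbar1_mollify[OF u12 h, symmetric]
    by (simp add: algebra_simps)
  have "pdbar_adj \<Gamma> (1,0) (U1 n) p + pdbar_adj \<Gamma> (0,1) (U2 n) p = - cutoff R p * (pd (1,0) (mollify u1 n) p + pd (0,1) (mollify u2 n) p)
      + cutoff R p * (2 * pd_phi \<Gamma> (1,0) p * mollify u1 n p + 2 * pd_phi \<Gamma> (0,1) p * mollify u2 n p)
      - pd (1,0) (cutoff R) p * mollify u1 n p - pd (0,1) (cutoff R) p * mollify u2 n p"
    unfolding pdbar_adj_def U1_def U2_def pd_mult[OF d(1,2)] pd_mult[OF d(1,3)]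
    by (simp add: algebra_simps)
  then show "pdbar_adj \<Gamma> (1,0) (U1 n) p + pdbar_adj \<Gamma> (0,1) (U2 n) p = cutoff R p * (mollify v n p - mollify g n p)
      + cutoff R p * (2 * pd_phi \<Gamma> (1,0) p * mollify u1 n p + 2 * pd_phi \<Gamma> (0,1) p * mollify u2 n p)
      - pd (1,0) (cutoff R) p * mollify u1 n p - pd (0,1) (cutoff R) p * mollify u2 n p"
    unfolding adjoint_mollify[OF u v adj] g_def by (simp add: algebra_simps)
qed

text \<open>The smooth estimate is applied to cutoff times mollification, and the mollification
  parameter tends to infinity with \<open>R\<close> fixed. On the half ball the cutoff is at least
  1/2, so passing from \<open>u\<close> to the localized form costs 2 * 4 = 8; with the 12 of
  \<open>localization_error\<close> this gives 96.\<close>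

lemma local_estimate:
  assumes fin: "finite \<Gamma>" and K: "0 < K" and R: "1 \<le> R"
    and coer: "smooth_coercive \<Gamma> K"
    and u: "(u1, u2) \<in> L2_01 (monomial_weight \<Gamma>)"
    and h: "h \<in> L2 (monomial_weight \<Gamma>)" "is_dbar1 (u1, u2) h"
    and v: "v \<in> L2 (monomial_weight \<Gamma>)" "is_dbar_adj (monomial_weight \<Gamma>) (u1, u2) v"
  defines "N \<equiv> wnorm2 (monomial_weight \<Gamma>)"
  shows "(\<integral>\<^sup>+p. indicator (cball 0 (R / 2)) p * ennreal ((mu \<Gamma> p)\<^sup>2 * ((cmod (u1 p))\<^sup>2 + (cmod (u2 p))\<^sup>2) * wexp \<Gamma> p) \<partial>lborel)
    \<le> ennreal (96 * K) * (N h + N v + ennreal ((512 * exp 1 / R)\<^sup>2) * (N u1 + N u2))"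
proof -
  define c where "c = 512 * exp 1 / R"
  define g where "g = (\<lambda>q. 2 * pd_phi \<Gamma> (1,0) q * u1 q + 2 * pd_phi \<Gamma> (0,1) q * u2 q)"
  have loc: "L2loc u1" "L2loc u2" "L2loc h" "L2loc v"
    using u h v L2_imp_L2loc by (auto simp: L2_01_def)
  have locg: "L2loc g"
    unfolding g_def by (intro L2loc_add L2loc_mult loc continuous_intros Ck_imp_continuous[OF Ck_pd_phi])
  have meas[measurable]: "u1 \<in> borel_measurable borel" "u2 \<in> borel_measurable borel" "h \<in> borel_measurable borel"
    "v \<in> borel_measurable borel" "g \<in> borel_measurable borel"
    using loc locg unfolding L2loc_def by auto
  have mm[measurable]: "mollify k n \<in> borel_measurable borel" if "L2loc k" for k n
    by (rule borel_measurable_continuous_onI[OF Ck_imp_continuous[OF Ck_mollify[OF L2loc_imp_locint[OF that]]]])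
  note mm' [measurable] = mm[OF loc(1)] mm[OF loc(2)] mm[OF loc(3)] mm[OF loc(4)] mm[OF locg]
  have bounded_on_ball: "\<exists>M. \<forall>p\<in>cball 0 R. norm (k p) \<le> M" if "continuous_on UNIV k" for k :: "c2 \<Rightarrow> 'b::real_normed_vector"
  proof -
    have "compact (k ` cball 0 R)" by (intro compact_continuous_image) (use that continuous_on_subset in auto)
    then show ?thesis by (meson bounded_iff compact_imp_bounded imageI)
  qed
  have cA: "continuous_on UNIV (\<lambda>q. 2 * pd_phi \<Gamma> e q)" for e
    by (intro continuous_intros Ck_imp_continuous[OF Ck_pd_phi])
  obtain B1 where B1: "\<And>p. p \<in> cball 0 R \<Longrightarrow> cmod (2 * pd_phi \<Gamma> (1,0) p) \<le> B1" using bounded_on_ball[OF cA] by blast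
  obtain B2 where B2: "\<And>p. p \<in> cball 0 R \<Longrightarrow> cmod (2 * pd_phi \<Gamma> (0,1) p) \<le> B2" using bounded_on_ball[OF cA] by blast
  obtain M where M: "\<And>p. p \<in> cball 0 R \<Longrightarrow> norm (mu \<Gamma> p) \<le> M" using bounded_on_ball[OF continuous_mu[OF fin]] by blast
  \<comment> \<open>\<open>B\<close> and \<open>M\<close> bound the coefficients and
    \<open>mu\<close> on the ball of radius \<open>R\<close> and are independent of
    \<open>n\<close>. Thus \<open>Q\<close>, which collects the energy error and the error of
    comparing \<open>u\<close> with its mollification, is a fixed factor of the vanishing
    \<open>Err n\<close>.\<close>
  define B where "B = 1 + \<bar>B1\<bar> + \<bar>B2\<bar> + \<bar>c\<bar>"
  define Q where "Q = 8 * K * (16 * B\<^sup>2) + 8 * M\<^sup>2"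
  define Err where "Err n = (sqnorm_on (cball 0 R) (\<lambda>p. mollify h n p - h p) + sqnorm_on (cball 0 R) (\<lambda>p. mollify v n p - v p)
    + sqnorm_on (cball 0 R) (\<lambda>p. mollify g n p - g p) + sqnorm_on (cball 0 R) (\<lambda>p. mollify u1 n p - u1 p) + sqnorm_on (cball 0 R) (\<lambda>p. mollify u2 n p - u2 p))" for n
  define Base where "Base = N h + N v + ennreal (c\<^sup>2) * (N u1 + N u2)"
  let ?L = "\<integral>\<^sup>+p. indicator (cball 0 (R / 2)) p * ennreal ((mu \<Gamma> p)\<^sup>2 * ((cmod (u1 p))\<^sup>2 + (cmod (u2 p))\<^sup>2) * wexp \<Gamma> p) \<partial>lborel"
  have est: "?L \<le> ennreal (96 * K) * Base + ennreal Q * Err n" for n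
  proof -
    define U1 U2 where "U1 = (\<lambda>p. cutoff R p * mollify u1 n p)" and "U2 = (\<lambda>p. cutoff R p * mollify u2 n p)"
    have U: "Ck k U1" "csupp U1" "Ck k U2" "csupp U2" for k
      unfolding U1_def U2_def by (intro Ck_mult Ck_cutoff Ck_mollify L2loc_imp_locint loc csupp_mult_left csupp_cutoff R)+
    define P1 P2 where "P1 = (\<lambda>p. pdbar (1,0) U2 p - pdbar (0,1) U1 p)" and "P2 = (\<lambda>p. pdbar_adj \<Gamma> (1,0) U1 p + pdbar_adj \<Gamma> (0,1) U2 p)"
    have nP: "nice P1" "nice P2"
      using nice_pdbar[OF U(1,2)] nice_pdbar[OF U(3,4)] nice_pdbar_adj[OF U(1,2)] nice_pdbar_adj[OF U(3,4)]
      unfolding P1_def P2_def nice_def by (auto intro!: continuous_intros csupp_diff csupp_add)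
    have P1: "P1 p = cutoff R p * mollify h n p + pdbar (1,0) (cutoff R) p * mollify u2 n p - pdbar (0,1) (cutoff R) p * mollify u1 n p" for p
      unfolding P1_def U1_def U2_def by (rule localized_forms(1)[OF u v(1) h(2) v(2)])
    have P2: "P2 p = cutoff R p * (mollify v n p - mollify g n p)
      + cutoff R p * (2 * pd_phi \<Gamma> (1,0) p * mollify u1 n p + 2 * pd_phi \<Gamma> (0,1) p * mollify u2 n p)
      - pd (1,0) (cutoff R) p * mollify u1 n p - pd (0,1) (cutoff R) p * mollify u2 n p" for p
      unfolding P2_def U1_def U2_def g_def by (rule localized_forms(2)[OF u v(1) h(2) v(2)])
    define D where "D = (\<lambda>p. (cmod (mollify h n p - h p))\<^sup>2 + (cmod (mollify v n p - v p))\<^sup>2 + (cmod (mollify g n p - g p))\<^sup>2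
      + (cmod (mollify u1 n p - u1 p))\<^sup>2 + (cmod (mollify u2 n p - u2 p))\<^sup>2)"
    define bs where "bs = (\<lambda>p. ((cmod (h p))\<^sup>2 + (cmod (v p))\<^sup>2 + c\<^sup>2 * ((cmod (u1 p))\<^sup>2 + (cmod (u2 p))\<^sup>2)) * wexp \<Gamma> p)"
    have D0: "0 \<le> D p" and bs0: "0 \<le> bs p" for p
      unfolding D_def bs_def by (auto intro!: add_nonneg_nonneg mult_nonneg_nonneg less_imp_le[OF wexp_pos])
    have [measurable]: "D \<in> borel_measurable borel" "bs \<in> borel_measurable borel"
      unfolding D_def bs_def by measurable
    have intD: "(\<integral>\<^sup>+p. indicator (cball 0 R) p * ennreal (D p) \<partial>lborel) = Err n"
    proof -
      have "(\<integral>\<^sup>+p. indicator (cball 0 R) p * ennreal (D p) \<partial>lborel)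
        = (\<integral>\<^sup>+p. indicator (cball 0 R) p * ennreal ((cmod (mollify h n p - h p))\<^sup>2) + indicator (cball 0 R) p * ennreal ((cmod (mollify v n p - v p))\<^sup>2)
          + indicator (cball 0 R) p * ennreal ((cmod (mollify g n p - g p))\<^sup>2) + indicator (cball 0 R) p * ennreal ((cmod (mollify u1 n p - u1 p))\<^sup>2)
          + indicator (cball 0 R) p * ennreal ((cmod (mollify u2 n p - u2 p))\<^sup>2) \<partial>lborel)"
        unfolding D_def by (intro nn_integral_cong) (simp add: distrib_left)
      also have "\<dots> = Err n"
        unfolding Err_def sqnorm_on_def by (subst nn_integral_add, measurable)+
      finally show ?thesis .
    qed
    have intbs: "(\<integral>\<^sup>+p. ennreal (bs p) \<partial>lborel) = Base"
    proof -
      have "(\<integral>\<^sup>+p. ennreal (bs p) \<partial>lborel) = (\<integral>\<^sup>+p. ennreal ((cmod (h p))\<^sup>2 * wexp \<Gamma> p) + ennreal ((cmod (v p))\<^sup>2 * wexp \<Gamma> p)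
         + ennreal (c\<^sup>2) * (ennreal ((cmod (u1 p))\<^sup>2 * wexp \<Gamma> p) + ennreal ((cmod (u2 p))\<^sup>2 * wexp \<Gamma> p)) \<partial>lborel)"
      proof (intro nn_integral_cong)
        fix p
        have w: "0 \<le> wexp \<Gamma> p" by (rule less_imp_le[OF wexp_pos])
        have "bs p = (cmod (h p))\<^sup>2 * wexp \<Gamma> p + (cmod (v p))\<^sup>2 * wexp \<Gamma> p + c\<^sup>2 * ((cmod (u1 p))\<^sup>2 * wexp \<Gamma> p + (cmod (u2 p))\<^sup>2 * wexp \<Gamma> p)"
          by (simp add: bs_def algebra_simps)
        then show "ennreal (bs p) = ennreal ((cmod (h p))\<^sup>2 * wexp \<Gamma> p) + ennreal ((cmod (v p))\<^sup>2 * wexp \<Gamma> p)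
         + ennreal (c\<^sup>2) * (ennreal ((cmod (u1 p))\<^sup>2 * wexp \<Gamma> p) + ennreal ((cmod (u2 p))\<^sup>2 * wexp \<Gamma> p))"
          using w by (simp add: ennreal_plus ennreal_mult[of "c\<^sup>2"])
      qed
      also have "\<dots> = Base"
        unfolding Base_def N_def wnorm2_eq by (simp add: nn_integral_add nn_integral_cmult)
      finally show ?thesis .
    qed
    have pw: "ennreal (((cmod (P1 p))\<^sup>2 + (cmod (P2 p))\<^sup>2) * wexp \<Gamma> p)
      \<le> ennreal 12 * ennreal (bs p) + ennreal (16 * B\<^sup>2) * (indicator (cball 0 R) p * ennreal (D p))" for p
    proof (cases "p \<in> cball 0 R")
      case True
      have w: "0 \<le> wexp \<Gamma> p" by (rule less_imp_le[OF wexp_pos])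
      have "(cmod (P1 p))\<^sup>2 + (cmod (P2 p))\<^sup>2 \<le> 12 * ((cmod (h p))\<^sup>2 + (cmod (v p))\<^sup>2 + c\<^sup>2 * ((cmod (u1 p))\<^sup>2 + (cmod (u2 p))\<^sup>2)) + 16 * B\<^sup>2 * D p"
        unfolding P1 P2 D_def
      proof (rule localization_error)
        show "cmod (cutoff R p) \<le> 1" by (rule cutoff_bounds(1)[OF R])
        show "cmod (pdbar (1,0) (cutoff R) p) \<le> c" "cmod (pdbar (0,1) (cutoff R) p) \<le> c"
          "cmod (pd (1,0) (cutoff R) p) \<le> c" "cmod (pd (0,1) (cutoff R) p) \<le> c"
          unfolding c_def by (rule cutoff_wirtinger_bounds[OF R]; simp)+
        show "1 \<le> B" "cmod (2 * pd_phi \<Gamma> (1,0) p) + c \<le> B" "cmod (2 * pd_phi \<Gamma> (0,1) p) + c \<le> B"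
          using B1[OF True] B2[OF True] unfolding B_def by linarith+
        show "g p = 2 * pd_phi \<Gamma> (1,0) p * u1 p + 2 * pd_phi \<Gamma> (0,1) p * u2 p" by (simp add: g_def)
      qed
      then have "((cmod (P1 p))\<^sup>2 + (cmod (P2 p))\<^sup>2) * wexp \<Gamma> p
          \<le> (12 * ((cmod (h p))\<^sup>2 + (cmod (v p))\<^sup>2 + c\<^sup>2 * ((cmod (u1 p))\<^sup>2 + (cmod (u2 p))\<^sup>2)) + 16 * B\<^sup>2 * D p) * wexp \<Gamma> p"
        by (rule mult_right_mono) (rule w)
      also have "\<dots> = 12 * bs p + 16 * B\<^sup>2 * D p * wexp \<Gamma> p" unfolding bs_def by (simp add: algebra_simps)
      also have "\<dots> \<le> 12 * bs p + 16 * B\<^sup>2 * D p * 1"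
        by (intro add_left_mono mult_left_mono wexp_le_1 mult_nonneg_nonneg D0) auto
      finally have "ennreal (((cmod (P1 p))\<^sup>2 + (cmod (P2 p))\<^sup>2) * wexp \<Gamma> p) \<le> ennreal (12 * bs p + (16 * B\<^sup>2) * D p)"
        by (intro ennreal_leI) simp
      also have "\<dots> = ennreal 12 * ennreal (bs p) + ennreal (16 * B\<^sup>2) * ennreal (D p)"
        by (intro ennreal_lin D0 bs0) auto
      finally show ?thesis using True by simp
    next
      case False
      then have "R < norm p" by simp
      then have "P1 p = 0" "P2 p = 0"
        unfolding P1 P2 using R by (simp_all add: cutoff_bounds(3) cutoff_wirtinger_bounds(3,4))
      then show ?thesis by simp
    qed
    have int_energy: "ennreal (wsq \<Gamma> P1 + wsq \<Gamma> P2) \<le> ennreal 12 * Base + ennreal (16 * B\<^sup>2) * Err n"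
    proof -
      have c12: "continuous_on UNIV P1" "csupp P1" "continuous_on UNIV P2" "csupp P2" using nP unfolding nice_def by auto
      have [measurable]: "P1 \<in> borel_measurable borel" "P2 \<in> borel_measurable borel"
        using c12 by (auto intro: borel_measurable_continuous_onI)
      have "ennreal (wsq \<Gamma> P1 + wsq \<Gamma> P2) = wnorm2 (monomial_weight \<Gamma>) P1 + wnorm2 (monomial_weight \<Gamma>) P2"
        by (simp add: ennreal_wsq c12 ennreal_plus wsq_nonneg)
      also have "\<dots> = (\<integral>\<^sup>+p. ennreal ((cmod (P1 p))\<^sup>2 * wexp \<Gamma> p) + ennreal ((cmod (P2 p))\<^sup>2 * wexp \<Gamma> p) \<partial>lborel)"
        unfolding wnorm2_eq by (intro nn_integral_add[symmetric]) measurable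
      also have "\<dots> = (\<integral>\<^sup>+p. ennreal (((cmod (P1 p))\<^sup>2 + (cmod (P2 p))\<^sup>2) * wexp \<Gamma> p) \<partial>lborel)"
        by (intro nn_integral_cong) (simp add: distrib_right less_imp_le[OF wexp_pos])
      also have "\<dots> \<le> (\<integral>\<^sup>+p. ennreal 12 * ennreal (bs p) + ennreal (16 * B\<^sup>2) * (indicator (cball 0 R) p * ennreal (D p)) \<partial>lborel)"
        by (intro nn_integral_mono pw)
      also have "\<dots> = ennreal 12 * (\<integral>\<^sup>+p. ennreal (bs p) \<partial>lborel) + ennreal (16 * B\<^sup>2) * (\<integral>\<^sup>+p. indicator (cball 0 R) p * ennreal (D p) \<partial>lborel)"
        by (simp add: nn_integral_add nn_integral_cmult del: ennreal_numeral)
      finally show ?thesis unfolding intD intbs .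
    qed
    have iU: "integrable lborel (\<lambda>p. (mu \<Gamma> p)\<^sup>2 * (cmod (k p))\<^sup>2 * wexp \<Gamma> p)" if "k \<in> {U1, U2}" for k
      using that U by (intro integrable_weighted_square) (auto intro: Ck_imp_continuous[of 0] continuous_intros continuous_mu[OF fin])
    have pwL: "indicator (cball 0 (R / 2)) p * ennreal ((mu \<Gamma> p)\<^sup>2 * ((cmod (u1 p))\<^sup>2 + (cmod (u2 p))\<^sup>2) * wexp \<Gamma> p)
      \<le> ennreal 8 * ennreal ((mu \<Gamma> p)\<^sup>2 * (cmod (U1 p))\<^sup>2 * wexp \<Gamma> p + (mu \<Gamma> p)\<^sup>2 * (cmod (U2 p))\<^sup>2 * wexp \<Gamma> p)
        + ennreal (8 * M\<^sup>2) * (indicator (cball 0 R) p * ennreal (D p))" for p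
    proof (cases "p \<in> cball 0 (R / 2)")
      case True
      then have p: "p \<in> cball 0 R" using R by simp
      have w: "0 \<le> wexp \<Gamma> p" by (rule less_imp_le[OF wexp_pos])
      define x where "x = cmod (cutoff R p)"
      have x: "1 / 2 \<le> x" "x \<le> 1" unfolding x_def using cutoff_bounds(1,2)[OF R] True by auto
      have "(1 / 2)\<^sup>2 \<le> x\<^sup>2" using x by (intro power_mono) auto
      then have x2: "1 \<le> 4 * x\<^sup>2" by (simp add: power2_eq_square)
      \<comment> \<open>Two steps: \<open>y\<close> is replaced by its mollified value
        \<open>m\<close> with factor 2, then \<open>m\<close> by its product with the cutoff with
        factor 4.\<close>
      have comp: "(cmod y)\<^sup>2 \<le> 8 * (cmod (cutoff R p * m))\<^sup>2 + 8 * (cmod (m - y))\<^sup>2" for y m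
      proof -
        have "(cmod y)\<^sup>2 \<le> 2 * (cmod m)\<^sup>2 + 2 * (cmod (m - y))\<^sup>2"
          using square_add_le[of m "y - m"] by (simp add: norm_minus_commute)
        moreover have "1 * (cmod m)\<^sup>2 \<le> 4 * x\<^sup>2 * (cmod m)\<^sup>2" by (intro mult_right_mono x2) auto
        moreover have "0 \<le> (cmod (m - y))\<^sup>2" by simp
        moreover have "8 * (cmod (cutoff R p * m))\<^sup>2 = 2 * (4 * x\<^sup>2 * (cmod m)\<^sup>2)"
          by (simp add: norm_mult power_mult_distrib x_def)
        ultimately show ?thesis by linarith
      qed
      have "(cmod (u1 p))\<^sup>2 + (cmod (u2 p))\<^sup>2 \<le> 8 * ((cmod (U1 p))\<^sup>2 + (cmod (U2 p))\<^sup>2) + 8 * D p"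
        using comp[of "u1 p" "mollify u1 n p"] comp[of "u2 p" "mollify u2 n p"]
        unfolding U1_def U2_def D_def distrib_left by (smt (verit) zero_le_power2)
      then have "(mu \<Gamma> p)\<^sup>2 * wexp \<Gamma> p * ((cmod (u1 p))\<^sup>2 + (cmod (u2 p))\<^sup>2)
          \<le> (mu \<Gamma> p)\<^sup>2 * wexp \<Gamma> p * (8 * ((cmod (U1 p))\<^sup>2 + (cmod (U2 p))\<^sup>2) + 8 * D p)"
        using w by (intro mult_left_mono) auto
      also have "\<dots> = 8 * ((mu \<Gamma> p)\<^sup>2 * (cmod (U1 p))\<^sup>2 * wexp \<Gamma> p + (mu \<Gamma> p)\<^sup>2 * (cmod (U2 p))\<^sup>2 * wexp \<Gamma> p)
          + 8 * ((mu \<Gamma> p)\<^sup>2 * wexp \<Gamma> p) * D p" by (simp add: algebra_simps)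
      also have "\<dots> \<le> 8 * ((mu \<Gamma> p)\<^sup>2 * (cmod (U1 p))\<^sup>2 * wexp \<Gamma> p + (mu \<Gamma> p)\<^sup>2 * (cmod (U2 p))\<^sup>2 * wexp \<Gamma> p)
          + 8 * (M\<^sup>2 * 1) * D p"
      proof (intro add_left_mono mult_right_mono mult_left_mono mult_mono wexp_le_1 D0 w)
        have "\<bar>mu \<Gamma> p\<bar> \<le> M" using M[OF p] by simp
        then show "(mu \<Gamma> p)\<^sup>2 \<le> M\<^sup>2" by (metis abs_ge_zero power2_abs power_mono)
      qed auto
      finally have "ennreal ((mu \<Gamma> p)\<^sup>2 * ((cmod (u1 p))\<^sup>2 + (cmod (u2 p))\<^sup>2) * wexp \<Gamma> p)
        \<le> ennreal (8 * ((mu \<Gamma> p)\<^sup>2 * (cmod (U1 p))\<^sup>2 * wexp \<Gamma> p + (mu \<Gamma> p)\<^sup>2 * (cmod (U2 p))\<^sup>2 * wexp \<Gamma> p) + (8 * M\<^sup>2) * D p)"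
        by (intro ennreal_leI) (simp add: mult_ac)
      also have "\<dots> = ennreal 8 * ennreal ((mu \<Gamma> p)\<^sup>2 * (cmod (U1 p))\<^sup>2 * wexp \<Gamma> p + (mu \<Gamma> p)\<^sup>2 * (cmod (U2 p))\<^sup>2 * wexp \<Gamma> p)
         + ennreal (8 * M\<^sup>2) * ennreal (D p)"
        using w by (intro ennreal_lin D0) auto
      finally show ?thesis using True p by simp
    qed simp
    have "?L \<le> (\<integral>\<^sup>+p. ennreal 8 * ennreal ((mu \<Gamma> p)\<^sup>2 * (cmod (U1 p))\<^sup>2 * wexp \<Gamma> p + (mu \<Gamma> p)\<^sup>2 * (cmod (U2 p))\<^sup>2 * wexp \<Gamma> p)
        + ennreal (8 * M\<^sup>2) * (indicator (cball 0 R) p * ennreal (D p)) \<partial>lborel)"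
      by (intro nn_integral_mono pwL)
    also have "\<dots> = ennreal 8 * (\<integral>\<^sup>+p. ennreal ((mu \<Gamma> p)\<^sup>2 * (cmod (U1 p))\<^sup>2 * wexp \<Gamma> p + (mu \<Gamma> p)\<^sup>2 * (cmod (U2 p))\<^sup>2 * wexp \<Gamma> p) \<partial>lborel)
       + ennreal (8 * M\<^sup>2) * (\<integral>\<^sup>+p. indicator (cball 0 R) p * ennreal (D p) \<partial>lborel)"
    proof -
      have [measurable]: "U1 \<in> borel_measurable borel" "U2 \<in> borel_measurable borel" "mu \<Gamma> \<in> borel_measurable borel"
        using U(1,3)[of 0] continuous_mu[OF fin] by (auto intro: borel_measurable_continuous_onI)
      show ?thesis by (simp add: nn_integral_add nn_integral_cmult del: ennreal_numeral ennreal_plus)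
    qed
    also have "(\<integral>\<^sup>+p. ennreal ((mu \<Gamma> p)\<^sup>2 * (cmod (U1 p))\<^sup>2 * wexp \<Gamma> p + (mu \<Gamma> p)\<^sup>2 * (cmod (U2 p))\<^sup>2 * wexp \<Gamma> p) \<partial>lborel)
      = ennreal ((\<integral>p. (mu \<Gamma> p)\<^sup>2 * (cmod (U1 p))\<^sup>2 * wexp \<Gamma> p \<partial>lborel) + (\<integral>p. (mu \<Gamma> p)\<^sup>2 * (cmod (U2 p))\<^sup>2 * wexp \<Gamma> p \<partial>lborel))"
      using iU by (subst nn_integral_eq_integral) (auto intro!: AE_I2 add_nonneg_nonneg mult_nonneg_nonneg less_imp_le[OF wexp_pos])
    also have "\<dots> \<le> ennreal (K * (wsq \<Gamma> P1 + wsq \<Gamma> P2))"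
      unfolding P1_def P2_def by (intro ennreal_leI coer[unfolded smooth_coercive_def, rule_format] U)
    also have "\<dots> = ennreal K * ennreal (wsq \<Gamma> P1 + wsq \<Gamma> P2)"
      using K by (intro ennreal_mult add_nonneg_nonneg wsq_nonneg) auto
    also have "\<dots> \<le> ennreal K * (ennreal 12 * Base + ennreal (16 * B\<^sup>2) * Err n)"
      by (intro mult_left_mono int_energy) auto
    finally have "?L \<le> ennreal 8 * (ennreal K * (ennreal 12 * Base + ennreal (16 * B\<^sup>2) * Err n)) + ennreal (8 * M\<^sup>2) * Err n"
      unfolding intD by (simp add: mult_left_mono add_right_mono del: ennreal_numeral)
    also have "\<dots> = (ennreal 8 * (ennreal K * ennreal 12)) * Base + (ennreal 8 * (ennreal K * ennreal (16 * B\<^sup>2)) + ennreal (8 * M\<^sup>2)) * Err n"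
      by (simp only: distrib_left distrib_right mult.assoc add.assoc)
    also have "ennreal 8 * (ennreal K * ennreal 12) = ennreal (96 * K)"
      using K by (simp add: ennreal_mult[symmetric] mult.commute del: ennreal_numeral)
    also have "ennreal 8 * (ennreal K * ennreal (16 * B\<^sup>2)) + ennreal (8 * M\<^sup>2) = ennreal Q"
      using K unfolding Q_def by (simp add: ennreal_mult[symmetric] ennreal_plus[symmetric] mult.assoc del: ennreal_numeral ennreal_plus)
    finally show ?thesis .
  qed
  have "Err \<longlonglongrightarrow> 0 + 0 + 0 + 0 + 0"
    unfolding Err_def[abs_def] by (intro tendsto_add mollify_tendsto loc locg)
  then have "(\<lambda>n. ennreal Q * Err n) \<longlonglongrightarrow> ennreal Q * 0"
    by (intro ennreal_tendsto_cmult) auto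
  then have "(\<lambda>n. ennreal (96 * K) * Base + ennreal Q * Err n) \<longlonglongrightarrow> ennreal (96 * K) * Base + 0"
    by (intro tendsto_add tendsto_const) simp
  then have "?L \<le> ennreal (96 * K) * Base + 0"
    by (rule LIMSEQ_le_const) (use est in blast)
  then show ?thesis by (simp add: Base_def c_def)
qed

section \<open>Passage to the whole space\<close>

lemma nn_integral_le_if_le_on_balls:
  fixes F :: "c2 \<Rightarrow> ennreal"
  assumes [measurable]: "F \<in> borel_measurable borel" and le: "\<And>r. (\<integral>\<^sup>+p. indicator (cball 0 r) p * F p \<partial>lborel) \<le> C"
  shows "(\<integral>\<^sup>+p. F p \<partial>lborel) \<le> C"
proof -
  have "(SUP n. indicator (cball 0 (real n)) p * F p) = F p" for p
  proof (rule antisym)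
    show "(SUP n. indicator (cball 0 (real n)) p * F p) \<le> F p"
      by (intro SUP_least) (auto simp: indicator_def)
    obtain n :: nat where "norm p \<le> real n" using real_arch_simple by blast
    then have "F p = indicator (cball 0 (real n)) p * F p" by simp
    also have "\<dots> \<le> (SUP n. indicator (cball 0 (real n)) p * F p)" by (rule SUP_upper) simp
    finally show "F p \<le> (SUP n. indicator (cball 0 (real n)) p * F p)" .
  qed
  then have "(\<integral>\<^sup>+p. F p \<partial>lborel) = (\<integral>\<^sup>+p. (SUP n. indicator (cball 0 (real n)) p * F p) \<partial>lborel)" by simp
  also have "\<dots> = (SUP n. \<integral>\<^sup>+p. indicator (cball 0 (real n)) p * F p \<partial>lborel)"
  proof (rule nn_integral_monotone_convergence_SUP)
    show "incseq (\<lambda>n p. indicator (cball 0 (real n)) p * F p)"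
      by (intro monoI le_funI mult_right_mono) (auto simp: indicator_def)
  qed measurable
  also have "\<dots> \<le> C" by (intro SUP_least le)
  finally show ?thesis .
qed

text \<open>For a fixed ball of radius \<open>r\<close> the local estimate applies to every
  sufficiently large \<open>R\<close>, and its right side depends on \<open>R\<close> only through
  the cutoff term, which tends to 0 because the norms of \<open>u1\<close> and \<open>u2\<close> are
  finite. Only afterwards does \<open>r\<close> grow.\<close>

lemma global_estimate:
  assumes fin: "finite \<Gamma>" and K: "0 < K"
    and coer: "smooth_coercive \<Gamma> K"
    and u: "(u1, u2) \<in> L2_01 (monomial_weight \<Gamma>)"
    and h: "h \<in> L2 (monomial_weight \<Gamma>)" "is_dbar1 (u1, u2) h"
    and v: "v \<in> L2 (monomial_weight \<Gamma>)" "is_dbar_adj (monomial_weight \<Gamma>) (u1, u2) v"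
  defines "N \<equiv> wnorm2 (monomial_weight \<Gamma>)"
  shows "(\<integral>\<^sup>+p. ennreal ((mu \<Gamma> p)\<^sup>2 * ((cmod (u1 p))\<^sup>2 + (cmod (u2 p))\<^sup>2) * wexp \<Gamma> p) \<partial>lborel) \<le> ennreal (96 * K) * (N h + N v)"
proof (rule nn_integral_le_if_le_on_balls)
  let ?F = "\<lambda>p. ennreal ((mu \<Gamma> p)\<^sup>2 * ((cmod (u1 p))\<^sup>2 + (cmod (u2 p))\<^sup>2) * wexp \<Gamma> p)"
  have [measurable]: "u1 \<in> borel_measurable borel" "u2 \<in> borel_measurable borel" "mu \<Gamma> \<in> borel_measurable borel"
    using u continuous_mu[OF fin] by (auto simp: L2_01_def L2_def intro: borel_measurable_continuous_onI)
  show "?F \<in> borel_measurable borel" by measurable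
  fix r
  define T where "T R = ennreal (96 * K) * (N h + N v + ennreal ((512 * exp 1 / R)\<^sup>2) * (N u1 + N u2))" for R
  have le: "(\<integral>\<^sup>+p. indicator (cball 0 r) p * ?F p \<partial>lborel) \<le> T R" if "1 \<le> R" "2 * r \<le> R" for R
  proof -
    have "(\<integral>\<^sup>+p. indicator (cball 0 r) p * ?F p \<partial>lborel) \<le> (\<integral>\<^sup>+p. indicator (cball 0 (R / 2)) p * ?F p \<partial>lborel)"
      using that by (intro nn_integral_mono mult_right_mono) (auto simp: indicator_def)
    also have "\<dots> \<le> T R"
      unfolding T_def N_def by (rule local_estimate[OF fin K that(1) coer u h v])
    finally show ?thesis .
  qed
  have fin_u: "N u1 + N u2 < top" using u by (auto simp: N_def L2_01_def L2_def)
  have "((\<lambda>R::real. (512 * exp 1 / R)\<^sup>2) \<longlongrightarrow> 0) at_top" by real_asymp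
  then have "((\<lambda>R. ennreal ((512 * exp 1 / R)\<^sup>2)) \<longlongrightarrow> ennreal 0) at_top" by (rule tendsto_ennrealI)
  then have "((\<lambda>R. (N u1 + N u2) * ennreal ((512 * exp 1 / R)\<^sup>2)) \<longlongrightarrow> (N u1 + N u2) * ennreal 0) at_top"
    by (rule ennreal_tendsto_cmult[OF fin_u])
  then have "((\<lambda>R. N h + N v + ennreal ((512 * exp 1 / R)\<^sup>2) * (N u1 + N u2)) \<longlongrightarrow> N h + N v + 0) at_top"
    by (intro tendsto_add tendsto_const) (simp add: mult.commute)
  then have "(T \<longlongrightarrow> ennreal (96 * K) * (N h + N v + 0)) at_top"
    unfolding T_def by (rule ennreal_tendsto_cmult[rotated]) simp
  moreover have "\<forall>\<^sub>F R in at_top. (\<integral>\<^sup>+p. indicator (cball 0 r) p * ?F p \<partial>lborel) \<le> T R"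
    using eventually_ge_at_top[of 1] eventually_ge_at_top[of "2 * r"] by eventually_elim (rule le)
  ultimately have "(\<integral>\<^sup>+p. indicator (cball 0 r) p * ?F p \<partial>lborel) \<le> ennreal (96 * K) * (N h + N v + 0)"
    by (rule tendsto_lowerbound) simp
  then show "(\<integral>\<^sup>+p. indicator (cball 0 r) p * ?F p \<partial>lborel) \<le> ennreal (96 * K) * (N h + N v)" by simp
qed

theorem theorem5:
  fixes \<Gamma> :: "(nat \<times> nat) set"
  assumes "finite \<Gamma>" and "homogeneous \<Gamma>"
  shows "\<exists>c::real. c > 0 \<and> kohn_laplacian_coercive (monomial_weight \<Gamma>)
    (\<lambda>(z, w). c * (1 + rpow (cmod z) (sigma_exponent \<Gamma>) + rpow (cmod w) (tau_exponent \<Gamma>)))"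
proof -
  let ?\<phi> = "monomial_weight \<Gamma>"
  obtain K where K: "0 < K" and coer: "smooth_coercive \<Gamma> K"
    using coercive_on_smooth_forms[OF assms] by blast
  \<comment> \<open>Chosen so that \<open>c^2\<close> cancels the factor \<open>96 * K\<close> of
    \<open>global_estimate\<close>.\<close>
  define c where "c = 1 / sqrt (96 * K)"
  have c: "0 < c" "c\<^sup>2 * (96 * K) = 1" using K by (auto simp: c_def power_divide)
  have mu: "(\<lambda>(z, w). c * (1 + rpow (cmod z) (sigma_exponent \<Gamma>) + rpow (cmod w) (tau_exponent \<Gamma>))) = (\<lambda>p. c * mu \<Gamma> p)"
    by (auto simp: mu_def)
  have "kohn_laplacian_coercive ?\<phi> (\<lambda>p. c * mu \<Gamma> p)"
    unfolding kohn_laplacian_coercive_def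
  proof
    fix u assume "u \<in> dom_kohn_form ?\<phi>"
    then have dom: "u \<in> dom_dbar1 ?\<phi>" "u \<in> dom_dbar_adj ?\<phi>" by (simp_all add: dom_kohn_form_def)
    obtain u1 u2 where u: "u = (u1, u2)" by (cases u)
    have u12: "(u1, u2) \<in> L2_01 ?\<phi>" using dom by (simp add: dom_dbar1_def u)
    define h where "h = dbar1 ?\<phi> u"
    define v where "v = dbar_adj ?\<phi> u"
    \<comment> \<open>\<open>dbar1\<close> and \<open>dbar_adj\<close> are choices, so their
      defining properties are recovered from membership in the domains;
      \<open>global_estimate\<close> holds for whichever representatives were chosen.\<close>
    have "\<exists>h. h \<in> L2 ?\<phi> \<and> is_dbar1 u h" using dom(1) by (auto simp: dom_dbar1_def)
    then have "h \<in> L2 ?\<phi> \<and> is_dbar1 u h" unfolding h_def dbar1_def by (rule someI_ex)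
    then have h: "h \<in> L2 ?\<phi>" "is_dbar1 (u1, u2) h" by (simp_all add: u)
    have "\<exists>v. v \<in> L2 ?\<phi> \<and> is_dbar_adj ?\<phi> u v" using dom(2) by (auto simp: dom_dbar_adj_def)
    then have "v \<in> L2 ?\<phi> \<and> is_dbar_adj ?\<phi> u v" unfolding v_def dbar_adj_def by (rule someI_ex)
    then have v: "v \<in> L2 ?\<phi>" "is_dbar_adj ?\<phi> (u1, u2) v" by (simp_all add: u)
    have [measurable]: "u1 \<in> borel_measurable borel" "u2 \<in> borel_measurable borel" "mu \<Gamma> \<in> borel_measurable borel"
      using u12 continuous_mu[OF assms(1)] by (auto simp: L2_01_def L2_def intro: borel_measurable_continuous_onI)
    have "wnorm2_01 ?\<phi> (\<lambda>p. of_real (c * mu \<Gamma> p) * u1 p, \<lambda>p. of_real (c * mu \<Gamma> p) * u2 p)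
      = (\<integral>\<^sup>+p. ennreal ((cmod (of_real (c * mu \<Gamma> p) * u1 p))\<^sup>2 * wexp \<Gamma> p) + ennreal ((cmod (of_real (c * mu \<Gamma> p) * u2 p))\<^sup>2 * wexp \<Gamma> p) \<partial>lborel)"
      unfolding wnorm2_01_def wnorm2_eq fst_conv snd_conv by (intro nn_integral_add[symmetric]) measurable
    also have "\<dots> = (\<integral>\<^sup>+p. ennreal (c\<^sup>2) * ennreal ((mu \<Gamma> p)\<^sup>2 * ((cmod (u1 p))\<^sup>2 + (cmod (u2 p))\<^sup>2) * wexp \<Gamma> p) \<partial>lborel)"
    proof (intro nn_integral_cong)
      fix p
      have w: "0 \<le> wexp \<Gamma> p" by (rule less_imp_le[OF wexp_pos])
      have "(cmod (of_real (c * mu \<Gamma> p) * y))\<^sup>2 = c\<^sup>2 * ((mu \<Gamma> p)\<^sup>2 * (cmod y)\<^sup>2)" for y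
        by (simp only: norm_mult norm_of_real power_mult_distrib power2_abs abs_mult mult.assoc)
      then have "(cmod (of_real (c * mu \<Gamma> p) * u1 p))\<^sup>2 * wexp \<Gamma> p + (cmod (of_real (c * mu \<Gamma> p) * u2 p))\<^sup>2 * wexp \<Gamma> p
          = c\<^sup>2 * ((mu \<Gamma> p)\<^sup>2 * ((cmod (u1 p))\<^sup>2 + (cmod (u2 p))\<^sup>2) * wexp \<Gamma> p)"
        by (simp only:) (simp add: algebra_simps)
      then show "ennreal ((cmod (of_real (c * mu \<Gamma> p) * u1 p))\<^sup>2 * wexp \<Gamma> p) + ennreal ((cmod (of_real (c * mu \<Gamma> p) * u2 p))\<^sup>2 * wexp \<Gamma> p)
          = ennreal (c\<^sup>2) * ennreal ((mu \<Gamma> p)\<^sup>2 * ((cmod (u1 p))\<^sup>2 + (cmod (u2 p))\<^sup>2) * wexp \<Gamma> p)"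
        using w by (subst ennreal_plus[symmetric]) (auto simp: ennreal_mult[symmetric] intro!: mult_nonneg_nonneg)
    qed
    also have "\<dots> = ennreal (c\<^sup>2) * (\<integral>\<^sup>+p. ennreal ((mu \<Gamma> p)\<^sup>2 * ((cmod (u1 p))\<^sup>2 + (cmod (u2 p))\<^sup>2) * wexp \<Gamma> p) \<partial>lborel)"
      by (rule nn_integral_cmult) measurable
    also have "\<dots> \<le> ennreal (c\<^sup>2) * (ennreal (96 * K) * (wnorm2 ?\<phi> h + wnorm2 ?\<phi> v))"
      by (intro mult_left_mono global_estimate[OF assms(1) K coer u12 h v]) auto
    also have "\<dots> = kohn_form ?\<phi> u"
      using K c(2) by (simp add: mult.assoc[symmetric] ennreal_mult[symmetric] kohn_form_def h_def v_def)
    finally show "wnorm2_01 ?\<phi> (\<lambda>p. of_real (c * mu \<Gamma> p) * fst u p, \<lambda>p. of_real (c * mu \<Gamma> p) * snd u p) \<le> kohn_form ?\<phi> u"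
      by (simp add: u)
  qed
  then show ?thesis using c(1) unfolding mu[symmetric] by blast
qed

end
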